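(* Let $\sigma\colon \mathbb{M}^{m\times n}\to \mathbb{M}^{m\times n}$ be continuous and satisfy Condition (OC) with open set $\Sigma \subset \mathbb{M}^{m\times n}\times (\mathbb{R}^n)^m$. Let $\bar u \in C^1(\bar\Omega_T;\mathbb{R}^m)$ and $\bar v^1,\dots,\bar v^m\in C^1(\bar\Omega_T;\mathbb{R}^n)$ satisfy $$\bar u^i=\operatorname{div} \bar v^i \;\; (i=1,\dots,m), \qquad [D\bar u,\,(\bar v^i_t)]\in \Sigma \quad \text{on } \bar\Omega_T.$$ Then there exists a sequence $\{u_\alpha\}$ in $W^{1,\infty}(\Omega_T;\mathbb{R}^m)$ of weak solutions of the diffusion system $u_t=\operatorname{div}\sigma(Du)$ in $\Omega_T$, satisfying $u_\alpha|_{\partial \Omega_T}=\bar u$, that converges weakly* to $\bar u$ in $W^{1,\infty}(\Omega_T;\mathbb{R}^m)$ as $\alpha\to\infty$.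
   Context: Setting: $m,n\ge 1$, $T>0$, $\Omega\subset\mathbb{R}^n$ is a bounded domain with Lipschitz boundary, $\Omega_T=\Omega\times(0,T)$. $\mathbb{M}^{m\times n}$ is the space of real $m\times n$ matrices. For $\sigma=(\sigma^i_k)\colon\mathbb{M}^{m\times n}\to\mathbb{M}^{m\times n}$, $\sigma^i(A)=(\sigma^i_1(A),\dots,\sigma^i_n(A))\in\mathbb{R}^n$ is the $i$-th row. For functions of $(x,t)\in\Omega_T$, $D$ and $\operatorname{div}$ are the Jacobi matrix and the divergence in $x$ only, and the subscript $t$ denotes the time derivative. $[A,(b^i)]$ denotes the element of $\mathbb{M}^{m\times n}\times(\mathbb{R}^n)^m$ with components $A$ and $b^1,\dots,b^m\in\mathbb{R}^n$. For $p\in\mathbb{R}^a$, $\alpha\in\mathbb{R}^b$, $p\otimes\alpha$ is the matrix $(p_i\alpha_k)$. Weak solution of $u_t=\operatorname{div}\sigma(Du)$ in $\Omega_T$: a function $u\in W^{1,1}_{loc}(\Omega_T;\mathbb{R}^m)$ with $\int_{\Omega_T}\big(u^i\phi_t-\sum_{k=1}^n\sigma^i_k(Du)\phi_{x_k}\big)\,dx\,dt=0$ for all $\phi\in C_c^\infty(\Omega_T)$ and $i=1,\dots,m$. $\tau_N$-configuration: an $N$-tuple $(\xi_1,\dots,\xi_N)$ of elements of $\mathbb{M}^{m\times n}\times(\mathbb{R}^n)^m$ for which there exist $\rho,\gamma_1,\dots,\gamma_N\in\mathbb{M}^{m\times n}\times(\mathbb{R}^n)^m$ and $\kappa_1>1,\dots,\kappa_N>1$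 such that $\xi_1=\rho+\kappa_1\gamma_1$ and $\xi_j=\rho+\gamma_1+\dots+\gamma_{j-1}+\kappa_j\gamma_j$ for $2\le j\le N$, where $\gamma_j=[p_j\otimes\alpha_j,(s_j\beta^i_j)]$ with $s_j\in\mathbb{R}$, $\alpha_j\in\mathbb{R}^n\setminus\{0\}$, $\beta_j^i\in\mathbb{R}^n$, $p_j\in\mathbb{R}^m$ satisfying $\sum_j s_jp_j=0$, $\sum_j s_j\beta^i_j=0$, $\sum_j p_j\otimes\alpha_j=0$, $\sum_j\beta^i_j\otimes\alpha_j=0$ (for all $i$), and $\beta^i_j\cdot\alpha_j=0$ (for all $i,j$). In this case put $\rho_1=\rho$, $\rho_j=\rho+\gamma_1+\dots+\gamma_{j-1}$ ($2\le j\le N$), and $\tau(\xi_1,\dots,\xi_N)=\bigcup_{j=1}^N\{(1-\lambda)\xi_j+\lambda\rho_j:0<\lambda<1\}$. Graph of $\sigma$: $\mathbb{K}=\{[A,(\sigma^i(A))]:A\in\mathbb{M}^{m\times n}\}$. Condition (OC): $\sigma$ satisfies Condition (OC) with open set $\Sigma$ if $\Sigma\subset\mathbb{M}^{m\times n}\times(\mathbb{R}^n)^m$ is a nonempty bounded open set such that for every $[A,(b^i)]\in\Sigma$ there exist $N\ge2$ and a $\tau_N$-configuration $(\xi_1,\dots,\xi_N)$ with $\xi_j\in\mathbb{K}$ for all $j$ and $[A,(b^i)]\in\tau(\xi_1,\dots,\xi_N)\subseteq\Sigma$. *)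

theory Defs
  imports "HOL-Analysis.Analysis"
begin

text \<open>Near each boundary point the set is the strict epigraph of a Lipschitz function, in
  orthonormal coordinates whose last axis is the unit vector e; the function g is defined
  on the hyperplane orthogonal to e.\<close>

definition lipschitz_boundary :: "'a::euclidean_space set \<Rightarrow> bool" where
  "lipschitz_boundary \<Omega> \<longleftrightarrow>
     (\<forall>x0\<in>frontier \<Omega>. \<exists>r>0. \<exists>e g L. norm e = 1 \<and> L-lipschitz_on {y. y \<bullet> e = 0} (g :: 'a \<Rightarrow> real) \<and>
        \<Omega> \<inter> ball x0 r = {x \<in> ball x0 r. x \<bullet> e > g (x - (x \<bullet> e) *\<^sub>R e)})"

definition bounded_lipschitz_domain :: "'a::euclidean_space set \<Rightarrow> bool" where
  "bounded_lipschitz_domain \<Omega> \<longleftrightarrow>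
     open \<Omega> \<and> connected \<Omega> \<and> \<Omega> \<noteq> {} \<and> bounded \<Omega> \<and> lipschitz_boundary \<Omega>"

definition cylinder :: "(real^'n) set \<Rightarrow> real \<Rightarrow> ((real^'n) \<times> real) set" where
  "cylinder \<Omega> T = \<Omega> \<times> {0<..<T}"

definition e_x :: "'n \<Rightarrow> (real^'n) \<times> real" where
  "e_x k = (axis k 1, 0)"

definition e_t :: "(real^'n) \<times> real" where
  "e_t = (0, 1)"

definition partial :: "'a::real_normed_vector \<Rightarrow> ('a \<Rightarrow> 'b::real_normed_vector) \<Rightarrow> 'a \<Rightarrow> 'b" where
  "partial v f z = frechet_derivative f (at z) v"

text \<open>f is in C1 of the closure of the open set S: f is continuous up to the boundary, and its
  derivative on S extends continuously to the closure. The extension f' is unique on the closure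
  and gives the meaning of the derivatives of f at boundary points.\<close>

definition C1_closure_deriv ::
  "'a::euclidean_space set \<Rightarrow> ('a \<Rightarrow> 'b::euclidean_space) \<Rightarrow> ('a \<Rightarrow> 'a \<Rightarrow>\<^sub>L 'b) \<Rightarrow> bool" where
  "C1_closure_deriv S f f' \<longleftrightarrow>
     continuous_on (closure S) f \<and> continuous_on (closure S) f' \<and>
     (\<forall>z\<in>S. (f has_derivative blinfun_apply (f' z)) (at z))"

fun Ck :: "nat \<Rightarrow> ('a::euclidean_space \<Rightarrow> real) \<Rightarrow> bool" where
  "Ck 0 f \<longleftrightarrow> continuous_on UNIV f"
| "Ck (Suc k) f \<longleftrightarrow> (\<forall>z. f differentiable (at z)) \<and> (\<forall>b\<in>Basis. Ck k (partial b f))"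

definition test_functions :: "'a::euclidean_space set \<Rightarrow> ('a \<Rightarrow> real) set" where
  "test_functions S =
     {\<phi>. (\<forall>k. Ck k \<phi>) \<and> compact (closure {z. \<phi> z \<noteq> 0}) \<and> closure {z. \<phi> z \<noteq> 0} \<subseteq> S}"

text \<open>All functions below are total; only their values on the open set S matter, and only
  up to Lebesgue null sets.\<close>

definition locally_integrable ::
  "'a::euclidean_space set \<Rightarrow> ('a \<Rightarrow> 'b::euclidean_space) \<Rightarrow> bool" where
  "locally_integrable S f \<longleftrightarrow> (\<forall>K. compact K \<and> K \<subseteq> S \<longrightarrow> integrable (lebesgue_on K) f)"

definition has_weak_partial ::
  "'a::euclidean_space set \<Rightarrow> 'a \<Rightarrow> ('a \<Rightarrow> 'b::euclidean_space) \<Rightarrow> ('a \<Rightarrow> 'b) \<Rightarrow> bool" where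
  "has_weak_partial S b u g \<longleftrightarrow> locally_integrable S u \<and> locally_integrable S g \<and>
     (\<forall>\<phi>\<in>test_functions S.
        (LINT z|lebesgue_on S. partial b \<phi> z *\<^sub>R u z) = - (LINT z|lebesgue_on S. \<phi> z *\<^sub>R g z))"

definition W11_loc :: "'a::euclidean_space set \<Rightarrow> ('a \<Rightarrow> 'b::euclidean_space) \<Rightarrow> bool" where
  "W11_loc S u \<longleftrightarrow> locally_integrable S u \<and> (\<forall>b\<in>Basis. \<exists>g. has_weak_partial S b u g)"

definition L_inf :: "'a::euclidean_space set \<Rightarrow> ('a \<Rightarrow> 'b::euclidean_space) \<Rightarrow> bool" where
  "L_inf S f \<longleftrightarrow> f \<in> borel_measurable (lebesgue_on S) \<and>
     (\<exists>C. AE z in lebesgue_on S. norm (f z) \<le> C)"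

definition W1_inf :: "'a::euclidean_space set \<Rightarrow> ('a \<Rightarrow> 'b::euclidean_space) \<Rightarrow> bool" where
  "W1_inf S u \<longleftrightarrow> L_inf S u \<and> (\<forall>b\<in>Basis. \<exists>g. L_inf S g \<and> has_weak_partial S b u g)"

text \<open>Convergence in the duality of L-infinity with L1.\<close>

definition weak_star_L_inf ::
  "'a::euclidean_space set \<Rightarrow> (nat \<Rightarrow> 'a \<Rightarrow> 'b::euclidean_space) \<Rightarrow> ('a \<Rightarrow> 'b) \<Rightarrow> bool" where
  "weak_star_L_inf S F f \<longleftrightarrow> (\<forall>j. L_inf S (F j)) \<and> L_inf S f \<and>
     (\<forall>\<psi>. integrable (lebesgue_on S) \<psi> \<longrightarrow>
        (\<lambda>j. LINT z|lebesgue_on S. F j z \<bullet> \<psi> z) \<longlonglongrightarrow> (LINT z|lebesgue_on S. f z \<bullet> \<psi> z))"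

text \<open>The functions and all their first-order weak derivatives converge weakly* in L-infinity.
  Weak derivatives are unique almost everywhere, so the choice of G and g is immaterial.\<close>

definition weak_star_W1_inf ::
  "'a::euclidean_space set \<Rightarrow> (nat \<Rightarrow> 'a \<Rightarrow> 'b::euclidean_space) \<Rightarrow> ('a \<Rightarrow> 'b) \<Rightarrow> bool" where
  "weak_star_W1_inf S U u \<longleftrightarrow> weak_star_L_inf S U u \<and>
     (\<forall>b\<in>Basis. \<exists>G g. (\<forall>j. has_weak_partial S b (U j) (G j)) \<and> has_weak_partial S b u g \<and>
        weak_star_L_inf S G g)"

text \<open>Boundary values of a W1-infinity function on a bounded Lipschitz domain: the boundary
  restriction of its representative that is continuous up to the boundary.\<close>

definition boundary_values ::
  "'a::euclidean_space set \<Rightarrow> ('a \<Rightarrow> 'b::euclidean_space) \<Rightarrow> ('a \<Rightarrow> 'b) \<Rightarrow> bool" where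
  "boundary_values S u w \<longleftrightarrow>
     (\<exists>v. continuous_on (closure S) v \<and> (AE z in lebesgue_on S. u z = v z) \<and>
          (\<forall>z\<in>frontier S. v z = w z))"

text \<open>Integrability is required explicitly because the Bochner integral of a non-integrable
  function is 0. The matrix function A is the weak spatial Jacobi matrix Du.\<close>

definition weak_solution ::
  "(real^'n^'m \<Rightarrow> real^'n^'m) \<Rightarrow> ((real^'n) \<times> real) set \<Rightarrow> ((real^'n) \<times> real \<Rightarrow> real^'m) \<Rightarrow> bool" where
  "weak_solution \<sigma> S u \<longleftrightarrow> W11_loc S u \<and>
     (\<exists>A. (\<forall>k. has_weak_partial S (e_x k) u (\<lambda>z. column k (A z))) \<and>
        (\<forall>\<phi>\<in>test_functions S. \<forall>i.
           has_bochner_integral (lebesgue_on S)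
             (\<lambda>z. u z $ i * partial e_t \<phi> z - (\<Sum>k\<in>UNIV. \<sigma> (A z) $ i $ k * partial (e_x k) \<phi> z)) 0))"

text \<open>An element of the product of the matrix space with the m-fold power of n-space is a pair of
  type (real^'n^'m) * (real^'n^'m): the i-th row of the second component is the vector
  b superscript i. Tuples indexed by 1, ..., N are functions on nat, of which only the values
  on {1..N} are used.\<close>

definition outer :: "real^'a \<Rightarrow> real^'b \<Rightarrow> real^'b^'a" where
  "outer p a = (\<chi> i k. p $ i * a $ k)"

definition base_point :: "'v::real_vector \<Rightarrow> (nat \<Rightarrow> 'v) \<Rightarrow> nat \<Rightarrow> 'v" where
  "base_point \<rho> \<gamma> j = \<rho> + (\<Sum>l\<in>{1..<j}. \<gamma> l)"

definition tau_configuration_with ::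
  "nat \<Rightarrow> (nat \<Rightarrow> (real^'n^'m) \<times> (real^'n^'m)) \<Rightarrow> (real^'n^'m) \<times> (real^'n^'m)
    \<Rightarrow> (nat \<Rightarrow> (real^'n^'m) \<times> (real^'n^'m)) \<Rightarrow> bool" where
  "tau_configuration_with N \<xi> \<rho> \<gamma> \<longleftrightarrow>
     (\<exists>(\<kappa> :: nat \<Rightarrow> real) (s :: nat \<Rightarrow> real) (\<alpha> :: nat \<Rightarrow> real^'n) (p :: nat \<Rightarrow> real^'m)
        (\<beta> :: 'm \<Rightarrow> nat \<Rightarrow> real^'n).
        (\<forall>j\<in>{1..N}. \<kappa> j > 1 \<and> \<xi> j = base_point \<rho> \<gamma> j + \<kappa> j *\<^sub>R \<gamma> j) \<and>
        (\<forall>j\<in>{1..N}. \<alpha> j \<noteq> 0 \<and> \<gamma> j = (outer (p j) (\<alpha> j), \<chi> i. s j *\<^sub>R \<beta> i j)) \<and>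
        (\<Sum>j\<in>{1..N}. s j *\<^sub>R p j) = 0 \<and>
        (\<forall>i. (\<Sum>j\<in>{1..N}. s j *\<^sub>R \<beta> i j) = 0) \<and>
        (\<Sum>j\<in>{1..N}. outer (p j) (\<alpha> j)) = 0 \<and>
        (\<forall>i. (\<Sum>j\<in>{1..N}. outer (\<beta> i j) (\<alpha> j)) = 0) \<and>
        (\<forall>i. \<forall>j\<in>{1..N}. \<beta> i j \<bullet> \<alpha> j = 0))"

definition tau_set ::
  "nat \<Rightarrow> (nat \<Rightarrow> 'v::real_vector) \<Rightarrow> 'v \<Rightarrow> (nat \<Rightarrow> 'v) \<Rightarrow> 'v set" where
  "tau_set N \<xi> \<rho> \<gamma> =
     (\<Union>j\<in>{1..N}. {(1 - \<mu>) *\<^sub>R \<xi> j + \<mu> *\<^sub>R base_point \<rho> \<gamma> j | \<mu>::real. 0 < \<mu> \<and> \<mu> < 1})"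

definition graph_set ::
  "(real^'n^'m \<Rightarrow> real^'n^'m) \<Rightarrow> ((real^'n^'m) \<times> (real^'n^'m)) set" where
  "graph_set \<sigma> = {(A, \<sigma> A) | A. True}"

text \<open>The points rho_j entering the set tau are not determined by the tuple alone, so the
  configuration is quantified together with the data rho, gamma realising it.\<close>

definition condition_OC ::
  "(real^'n^'m \<Rightarrow> real^'n^'m) \<Rightarrow> ((real^'n^'m) \<times> (real^'n^'m)) set \<Rightarrow> bool" where
  "condition_OC \<sigma> \<Sigma> \<longleftrightarrow> \<Sigma> \<noteq> {} \<and> bounded \<Sigma> \<and> open \<Sigma> \<and>
     (\<forall>\<eta>\<in>\<Sigma>. \<exists>N\<ge>2. \<exists>\<xi> \<rho> \<gamma>. tau_configuration_with N \<xi> \<rho> \<gamma> \<and>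
        (\<forall>j\<in>{1..N}. \<xi> j \<in> graph_set \<sigma>) \<and>
        \<eta> \<in> tau_set N \<xi> \<rho> \<gamma> \<and> tau_set N \<xi> \<rho> \<gamma> \<subseteq> \<Sigma>)"

end

theory Submission
  imports Defs
begin

text \<open>
A pair \<open>(u, v)\<close> with \<open>u\<^sup>i = div v\<^sup>i\<close> and \<open>v\<^sup>i\<^sub>t = \<sigma>\<^sup>i(Du)\<close> almost everywhere gives a weak solution, because then
\<open>u\<^sup>i\<^sub>t = div v\<^sup>i\<^sub>t = div \<sigma>\<^sup>i(Du)\<close> in the sense of distributions. So the task is the differential inclusion
\<open>[Du, v\<^sub>t] \<in> K\<close> for the graph \<open>K\<close> of \<open>\<sigma>\<close>, under the linear constraint \<open>u\<^sup>i = div v\<^sup>i\<close>. It is solved by convex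
integration. The given pair has a field \<open>W = [Du, v\<^sub>t]\<close> with values in \<open>\<Sigma>\<close>; compactly supported perturbations of
higher and higher frequency preserve the constraint and the inclusion in \<open>\<Sigma>\<close>, and drive the field to \<open>K\<close>.

One oscillation (\<open>wave_cone_oscillation\<close>). The field can oscillate between \<open>\<eta> + \<gamma>\<close> and \<open>\<eta> - \<gamma>\<close> when
\<open>\<gamma> = [p \<otimes> \<alpha>, (b\<^sup>i)]\<close> with \<open>b\<^sup>i\<close> orthogonal to \<open>\<alpha>\<close>: the perturbation is a plane wave in the direction \<open>(\<alpha>, s)\<close> of
space-time, derived from a scalar profile so that the constraint holds exactly. The time frequency \<open>s > 0\<close>
is free as only \<open>s \<beta>\<^sup>i = b\<^sup>i\<close> is prescribed, and the change of \<open>u\<^sub>t\<close> is about \<open>s\<close> times \<open>\<bar>p\<bar>\<close>. With tiny \<open>s\<close> the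
changes of \<open>u\<^sub>t\<close> in all steps have a small sum; this is what makes the limit Lipschitz in time.

Laminates (\<open>cost_zero_on_configuration\<close>). Let the cost of \<open>\<eta> \<in> \<Sigma>\<close> be the infimum of the mean distances
from \<open>K\<close> that oscillations inside \<open>\<Sigma>\<close> can produce from a field near \<open>\<eta>\<close>. By the first step the cost is midpoint convex
along wave cone segments in \<open>\<Sigma>\<close>. In a \<open>\<tau>\<^sub>N\<close>-configuration each base point \<open>\<rho>\<^sub>j\<^sub>+\<^sub>1\<close> lies between \<open>\<rho>\<^sub>j\<close> and the point
\<open>\<xi>\<^sub>j\<close> of \<open>K\<close>, where the cost tends to zero; so the cost of the next base point is at most a factor less than one times the
cost of the present one, and as the base points are cyclic, it is zero. Condition (OC) puts every point of \<open>\<Sigma>\<close> on such a configuration.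

Convergence (\<open>convex_integration_of_fields\<close>). Uniformly small perturbations with bounded field are weakly small
(\<open>weakly_null_integrable\<close>). Hence each one can be chosen almost orthogonal in \<open>L\<^sup>2\<close> to the fields before it, and
the squared norms of the fields increase up to summable errors. They are bounded because \<open>\<Sigma>\<close> is bounded, and so
the fields converge strongly. The limit takes its values in the closed set \<open>K\<close>.

The solutions equal the given function on the boundary because the perturbations have compact support. Making
the perturbations uniformly smaller gives a sequence converging uniformly; its derivatives converge weakly* by
weak smallness again.
\<close>

section \<open>Continuously differentiable functions\<close>

text \<open>The derivative is a function of the point and of the direction, and its continuity is required for
each fixed direction. In finite dimensions this is equivalent to continuity in the operator norm,
and it is the form in which derivatives of explicit formulas are obtained.\<close>

definition C1_on ::
  "'a::euclidean_space set \<Rightarrow> ('a \<Rightarrow> 'b::euclidean_space) \<Rightarrow> ('a \<Rightarrow> 'a \<Rightarrow> 'b) \<Rightarrow> bool" where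
  "C1_on S f f' \<longleftrightarrow> (\<forall>z\<in>S. (f has_derivative f' z) (at z)) \<and> (\<forall>v. continuous_on S (\<lambda>z. f' z v))"

definition C1_compact ::
  "'a::euclidean_space set \<Rightarrow> ('a \<Rightarrow> 'b::euclidean_space) \<Rightarrow> ('a \<Rightarrow> 'a \<Rightarrow> 'b) \<Rightarrow> bool" where
  "C1_compact S f f' \<longleftrightarrow> C1_on UNIV f f' \<and> (\<exists>K. compact K \<and> K \<subseteq> S \<and> (\<forall>z. z \<notin> K \<longrightarrow> f z = 0))"

lemma C1_compactE:
  assumes "C1_compact S f f'"
  obtains K where "compact K" "K \<subseteq> S" "\<And>z. z \<notin> K \<Longrightarrow> f z = 0" "\<And>z v. z \<notin> K \<Longrightarrow> f' z v = 0"
proof -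
  obtain K where K: "compact K" "K \<subseteq> S" "\<And>z. z \<notin> K \<Longrightarrow> f z = 0"
    and d: "\<And>z. (f has_derivative f' z) (at z)"
    using assms unfolding C1_compact_def C1_on_def by blast
  have "f' z v = 0" if "z \<notin> K" for z v
  proof -
    have "((\<lambda>_. 0) has_derivative f' z) (at z)"
      by (rule has_derivative_transform_within_open[OF d, of "- K"])
        (use that K in \<open>auto simp: compact_imp_closed\<close>)
    moreover have "((\<lambda>_. 0::'b) has_derivative (\<lambda>_. 0)) (at z)" by simp
    ultimately have "f' z = (\<lambda>_. 0)" by (rule has_derivative_unique)
    then show ?thesis by simp
  qed
  with K that show ?thesis by blast
qed

lemma C1_compact_derivative: "C1_compact S f f' \<Longrightarrow> (f has_derivative f' z) (at z)"
  and C1_compact_continuous_derivative: "C1_compact S f f' \<Longrightarrow> continuous_on T (\<lambda>z. f' z v)"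
  unfolding C1_compact_def C1_on_def by (auto intro: continuous_on_subset)

lemma C1_on_continuous: "C1_on S f f' \<Longrightarrow> continuous_on S f"
  unfolding C1_on_def
  by (meson continuous_at_imp_continuous_on has_derivative_continuous)

lemma C1_compact_continuous: "C1_compact S f f' \<Longrightarrow> continuous_on T f"
  unfolding C1_compact_def using C1_on_continuous continuous_on_subset by blast

lemma C1_compact_mono: "C1_compact S f f' \<Longrightarrow> S \<subseteq> T \<Longrightarrow> C1_compact T f f'"
  unfolding C1_compact_def by blast

lemma C1_compact_zero: "C1_compact S (\<lambda>_. 0) (\<lambda>_ _. 0)"
  unfolding C1_compact_def C1_on_def by (auto intro!: exI[of _ "{}"])

lemma C1_compact_add:
  assumes "C1_compact S f f'" "C1_compact S g g'"
  shows "C1_compact S (\<lambda>z. f z + g z) (\<lambda>z v. f' z v + g' z v)"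
proof -
  obtain K L where "compact K" "K \<subseteq> S" "\<And>z. z \<notin> K \<Longrightarrow> f z = 0"
    "compact L" "L \<subseteq> S" "\<And>z. z \<notin> L \<Longrightarrow> g z = 0"
    using assms unfolding C1_compact_def by blast
  then have "\<exists>K. compact K \<and> K \<subseteq> S \<and> (\<forall>z. z \<notin> K \<longrightarrow> f z + g z = 0)"
    by (intro exI[of _ "K \<union> L"]) auto
  then show ?thesis using assms unfolding C1_compact_def C1_on_def
    by (auto intro!: derivative_intros continuous_intros)
qed

lemma C1_on_add:
  assumes "C1_on S f f'" "C1_on S g g'"
  shows "C1_on S (\<lambda>z. f z + g z) (\<lambda>z v. f' z v + g' z v)"
  using assms unfolding C1_on_def by (auto intro!: derivative_intros continuous_intros)

lemma C1_on_subset: "C1_on T f f' \<Longrightarrow> S \<subseteq> T \<Longrightarrow> C1_on S f f'"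
  unfolding C1_on_def by (blast intro: continuous_on_subset)

lemma C1_on_bounded_linear:
  assumes "C1_on S f f'" "bounded_linear L"
  shows "C1_on S (\<lambda>z. L (f z)) (\<lambda>z v. L (f' z v))"
  using assms unfolding C1_on_def
  by (auto intro: bounded_linear.has_derivative bounded_linear.continuous_on)

lemma C1_compact_bounded_linear:
  assumes "C1_compact S f f'" "bounded_linear L"
  shows "C1_compact S (\<lambda>z. L (f z)) (\<lambda>z v. L (f' z v))"
proof -
  have "L 0 = 0" using assms(2) by (simp add: linear_0 bounded_linear.linear)
  then show ?thesis
    using assms C1_on_bounded_linear[of UNIV f f' L] unfolding C1_compact_def by metis
qed

text \<open>Multiplying by a compactly supported \<open>\<phi>\<close> makes a function that is of class \<open>C\<^sup>1\<close> only on \<open>S\<close>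
into one of class \<open>C\<^sup>1\<close> on the whole space. This is how integration by parts on \<open>S\<close> is reduced
to the vanishing of integrals of derivatives over the whole space.\<close>

lemma C1_compact_scaleR:
  fixes \<phi> :: "'a::euclidean_space \<Rightarrow> real" and w :: "'a \<Rightarrow> 'b::euclidean_space"
  assumes "open S" and \<phi>: "C1_compact S \<phi> \<phi>'" and w: "C1_on S w w'"
  shows "C1_compact S (\<lambda>z. indicator S z *\<^sub>R (\<phi> z *\<^sub>R w z))
           (\<lambda>z v. indicator S z *\<^sub>R (\<phi> z *\<^sub>R w' z v + \<phi>' z v *\<^sub>R w z))"
    (is "C1_compact S ?f ?f'")
proof -
  obtain K where K: "compact K" "K \<subseteq> S" "\<And>z. z \<notin> K \<Longrightarrow> \<phi> z = 0" "\<And>z v. z \<notin> K \<Longrightarrow> \<phi>' z v = 0"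
    using C1_compactE[OF \<phi>] by blast
  have opK: "open (- K)" using K(1) compact_imp_closed by blast
  have cover: "S \<union> (- K) = UNIV" using K(2) by auto
  have "(?f has_derivative ?f' z) (at z)" for z
  proof (cases "z \<in> S")
    case True
    have "((\<lambda>z. \<phi> z *\<^sub>R w z) has_derivative (\<lambda>v. \<phi> z *\<^sub>R w' z v + \<phi>' z v *\<^sub>R w z)) (at z)"
      by (rule has_derivative_scaleR[OF C1_compact_derivative[OF \<phi>]])
        (use w True in \<open>auto simp: C1_on_def\<close>)
    then have "(?f has_derivative (\<lambda>v. \<phi> z *\<^sub>R w' z v + \<phi>' z v *\<^sub>R w z)) (at z)"
      by (rule has_derivative_transform_within_open[OF _ \<open>open S\<close> True]) auto
    then show ?thesis using True by simp
  next
    case False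
    have "((\<lambda>_. 0) has_derivative (\<lambda>_. 0)) (at z)" by simp
    then have "(?f has_derivative (\<lambda>_. 0)) (at z)"
      by (rule has_derivative_transform_within_open[OF _ opK]) (use False K in auto)
    then show ?thesis using False by simp
  qed
  moreover have "continuous_on UNIV (\<lambda>z. ?f' z v)" for v
  proof -
    have "continuous_on S (\<lambda>z. \<phi> z *\<^sub>R w' z v + \<phi>' z v *\<^sub>R w z)"
      using C1_compact_continuous[OF \<phi>] C1_compact_continuous_derivative[OF \<phi>]
        C1_on_continuous[OF w] w[unfolded C1_on_def]
      by (intro continuous_intros) auto
    then have 1: "continuous_on S (\<lambda>z. ?f' z v)"
      by (rule continuous_on_eq) auto
    have "continuous_on (- K) (\<lambda>_. 0::'b)" by simp
    then have 2: "continuous_on (- K) (\<lambda>z. ?f' z v)"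
      by (rule continuous_on_eq) (use K in auto)
    from continuous_on_open_Un[OF \<open>open S\<close> opK 1 2] show ?thesis using cover by simp
  qed
  ultimately show ?thesis
    unfolding C1_compact_def C1_on_def using K by (auto intro!: exI[of _ K])
qed

lemma integral_lborel_translation:
  fixes f :: "'a::euclidean_space \<Rightarrow> 'b::euclidean_space"
  assumes "continuous_on UNIV f"
  shows "(LINT z|lborel. f (z + c)) = (LINT z|lborel. f z)"
proof -
  have [measurable]: "f \<in> borel_measurable borel"
    using assms by (simp add: borel_measurable_continuous_onI)
  have "(LINT z|lborel. f z) = (LINT z|distr lborel borel ((+) c). f z)"
    by (simp only: lborel_distr_plus)
  also have "\<dots> = (LINT z|lborel. f (c + z))"
    by (rule integral_distr) auto
  finally show ?thesis by (simp add: add.commute)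
qed

lemma integrable_translation:
  fixes f :: "'a::euclidean_space \<Rightarrow> 'b::euclidean_space"
  assumes "continuous_on UNIV f" "integrable lborel f"
  shows "integrable lborel (\<lambda>z. f (z + c))"
proof -
  have [measurable]: "f \<in> borel_measurable borel"
    using assms by (simp add: borel_measurable_continuous_onI)
  have "integrable (distr lborel borel ((+) c)) f"
    by (simp only: lborel_distr_plus assms)
  then have "integrable lborel (\<lambda>z. f (c + z))"
    by (subst (asm) integrable_distr_eq) auto
  then show ?thesis by (simp add: add.commute)
qed

lemma integrable_continuous_compact_support:
  fixes f :: "'a::euclidean_space \<Rightarrow> 'b::euclidean_space"
  assumes "continuous_on UNIV f" "compact K" "\<And>z. z \<notin> K \<Longrightarrow> f z = 0"
  shows "integrable lborel f"
proof -
  have "integrable lborel (\<lambda>z. indicator K z *\<^sub>R f z)"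
    using borel_integrable_compact[OF assms(2), of f] assms(1) continuous_on_subset by blast
  moreover have "indicator K z *\<^sub>R f z = f z" for z
    using assms(3) by (cases "z \<in> K") auto
  ultimately show ?thesis by simp
qed

text \<open>The difference quotients of \<open>f\<close> in direction \<open>b\<close> have integral \<open>0\<close> by translation invariance, and they
converge to the derivative, boundedly and with supports in a fixed ball.\<close>

lemma integral_directional_derivative_zero:
  assumes f: "C1_compact S f f'"
  shows "(LINT z|lborel. f' z b) = 0"
proof -
  obtain K where K: "compact K" "\<And>z. z \<notin> K \<Longrightarrow> f z = 0" "\<And>z v. z \<notin> K \<Longrightarrow> f' z v = 0"
    using C1_compactE[OF f] by metis
  note cf = C1_compact_continuous[OF f] and cf' = C1_compact_continuous_derivative[OF f]
  have intf: "integrable lborel f"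
    by (rule integrable_continuous_compact_support[OF cf K(1,2)])
  have "bounded ((\<lambda>z. f' z b) ` K)"
    by (intro compact_imp_bounded compact_continuous_image K cf')
  then obtain B where B: "B > 0" "\<And>z. z \<in> K \<Longrightarrow> norm (f' z b) \<le> B"
    unfolding bounded_pos by auto
  then have B': "norm (f' z b) \<le> B" for z
    using K(3)[of z b] by (cases "z \<in> K") auto
  obtain R where R: "R > 0" "\<And>z. z \<in> K \<Longrightarrow> norm z \<le> R"
    using compact_imp_bounded[OF K(1)] unfolding bounded_pos by auto
  define h where "h n = inverse (real (Suc n))" for n
  have h: "0 < h n" "h n \<le> 1" "h n \<noteq> 0" for n unfolding h_def by (auto simp: field_simps)
  define s where "s n z = (1 / h n) *\<^sub>R (f (z + h n *\<^sub>R b) - f z)" for n z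
  have line: "((\<lambda>t. f (z + t *\<^sub>R b)) has_derivative (\<lambda>t. t *\<^sub>R f' (z + r *\<^sub>R b) b)) (at r)" for z r
  proof -
    have 1: "((\<lambda>t. z + t *\<^sub>R b) has_derivative (\<lambda>t. t *\<^sub>R b)) (at r)"
      by (auto intro!: derivative_eq_intros)
    have "((\<lambda>t. f (z + t *\<^sub>R b)) has_derivative (\<lambda>t. f' (z + r *\<^sub>R b) (t *\<^sub>R b))) (at r)"
      by (rule has_derivative_compose[OF 1 C1_compact_derivative[OF f]])
    moreover have "linear (f' (z + r *\<^sub>R b))"
      using C1_compact_derivative[OF f] has_derivative_linear by blast
    ultimately show ?thesis by (simp add: linear_scale)
  qed
  have lim: "(\<lambda>n. s n z) \<longlonglongrightarrow> f' z b" for z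
  proof -
    have "((\<lambda>t. f (z + t *\<^sub>R b)) has_vector_derivative f' z b) (at 0)"
      using line[of z 0] by (simp add: has_vector_derivative_def)
    then have "((\<lambda>t. norm ((f (z + t *\<^sub>R b) - f z - t *\<^sub>R f' z b) /\<^sub>R \<bar>t\<bar>)) \<longlongrightarrow> 0) (at 0)"
      unfolding tendsto_norm_zero_iff by (simp add: has_vector_derivative_def has_derivative_def)
    moreover have "\<forall>\<^sub>F t in at 0. norm ((f (z + t *\<^sub>R b) - f z - t *\<^sub>R f' z b) /\<^sub>R \<bar>t\<bar>)
        = norm ((f (z + t *\<^sub>R b) - f z) /\<^sub>R t - f' z b)"
      unfolding eventually_at_filter
    proof (intro always_eventually allI impI)
      fix t :: real assume "t \<noteq> 0"
      then have "(f (z + t *\<^sub>R b) - f z) /\<^sub>R t - f' z b = (f (z + t *\<^sub>R b) - f z - t *\<^sub>R f' z b) /\<^sub>R t"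
        by (simp add: algebra_simps)
      then show "norm ((f (z + t *\<^sub>R b) - f z - t *\<^sub>R f' z b) /\<^sub>R \<bar>t\<bar>)
        = norm ((f (z + t *\<^sub>R b) - f z) /\<^sub>R t - f' z b)" by simp
    qed
    ultimately have "((\<lambda>t. norm ((f (z + t *\<^sub>R b) - f z) /\<^sub>R t - f' z b)) \<longlongrightarrow> 0) (at 0)"
      by (rule Lim_transform_eventually)
    then have "((\<lambda>t. (f (z + t *\<^sub>R b) - f z) /\<^sub>R t) \<longlongrightarrow> f' z b) (at 0)"
      by (simp add: tendsto_norm_zero_iff LIM_zero_iff)
    moreover have "filterlim h (at 0) sequentially"
      unfolding filterlim_at using h LIMSEQ_inverse_real_of_nat
      by (auto simp: h_def[abs_def])
    ultimately have "((\<lambda>n. (f (z + h n *\<^sub>R b) - f z) /\<^sub>R h n) \<longlongrightarrow> f' z b) sequentially"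
      by (rule filterlim_compose)
    then show ?thesis by (simp add: s_def divide_inverse)
  qed
  have bound: "norm (s n z) \<le> B" for n z
  proof -
    have "norm (f (z + h n *\<^sub>R b) - f (z + 0 *\<^sub>R b)) \<le> B * norm (h n - 0)"
    proof (rule differentiable_bound[of "{0..h n}" _ "\<lambda>r t. t *\<^sub>R f' (z + r *\<^sub>R b) b"])
      show "((\<lambda>t. f (z + t *\<^sub>R b)) has_derivative (\<lambda>t. t *\<^sub>R f' (z + x *\<^sub>R b) b)) (at x within {0..h n})" for x
        using line has_derivative_at_withinI by blast
      show "onorm (\<lambda>t. t *\<^sub>R f' (z + x *\<^sub>R b) b) \<le> B" for x
        by (rule onorm_le) (use B'[of "z + x *\<^sub>R b"] in
            \<open>auto simp: mult.commute[of B] intro!: mult_left_mono\<close>)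
    qed (use h[of n] in auto)
    then show ?thesis using h[of n] by (simp add: s_def divide_simps)
  qed
  have supp: "s n z = 0" if "z \<notin> cball 0 (R + norm b)" for n z
  proof -
    have "norm z \<le> norm (z + h n *\<^sub>R b) + norm (h n *\<^sub>R b)"
      by (metis add_diff_cancel_right' norm_triangle_ineq4)
    also have "norm (h n *\<^sub>R b) \<le> norm b" using h[of n] by (simp add: mult_left_le_one_le)
    finally have "norm z \<le> norm (z + h n *\<^sub>R b) + norm b" by simp
    moreover have "R + norm b < norm z" using that by simp
    ultimately have "norm (z + h n *\<^sub>R b) > R" "norm z > R"
      using norm_ge_zero[of b] by linarith+
    then show ?thesis using R(2) K(2) by (auto simp: s_def) (metis linorder_not_less)
  qed
  have "(\<lambda>n. LINT z|lborel. s n z) \<longlonglongrightarrow> (LINT z|lborel. f' z b)"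
  proof (rule integral_dominated_convergence[of _ _ _ "\<lambda>z. B * indicator (cball (0::'a) (R + norm b)) z"])
    show "(\<lambda>z. f' z b) \<in> borel_measurable lborel"
      using cf' by (auto intro!: borel_measurable_continuous_onI)
    show "s n \<in> borel_measurable lborel" for n
    proof -
      have "continuous_on UNIV (\<lambda>z. f (z + h n *\<^sub>R b))"
        by (rule continuous_on_compose2[OF cf]) (auto intro!: continuous_intros)
      then have "continuous_on UNIV (s n)"
        unfolding s_def using cf by (intro continuous_intros)
      then show ?thesis by (simp add: borel_measurable_continuous_onI)
    qed
    show "integrable lborel (\<lambda>z. B * indicator (cball (0::'a) (R + norm b)) z :: real)"
      by (intro integrable_mult_right integrable_real_indicator) (use emeasure_bounded_finite[OF bounded_cball, of "0::'a" "R + norm b"] in auto)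
    show "AE z in lborel. norm (s n z) \<le> B * indicator (cball (0::'a) (R + norm b)) z" for n
    proof (rule AE_I2)
      show "norm (s n z) \<le> B * indicator (cball 0 (R + norm b)) z" for z
        using bound[of n z] supp[of z n] by (cases "z \<in> cball 0 (R + norm b)") auto
    qed
  qed (use lim in auto)
  moreover have "(LINT z|lborel. s n z) = 0" for n
    unfolding s_def using integral_lborel_translation[OF cf] integrable_translation[OF cf intf] intf
    by simp
  ultimately show ?thesis by (simp add: LIMSEQ_const_iff)
qed

section \<open>Integration by parts and cutoff functions\<close>

lemma continuous_extension_by_zero:
  fixes g :: "'a::euclidean_space \<Rightarrow> 'b::euclidean_space"
  assumes "open S" "continuous_on S g" "compact K" "K \<subseteq> S" "\<And>z. z \<in> S - K \<Longrightarrow> g z = 0"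
  shows "continuous_on UNIV (\<lambda>z. indicator S z *\<^sub>R g z)"
proof -
  have opK: "open (- K)" using assms compact_imp_closed by blast
  have 1: "continuous_on S (\<lambda>z. indicator S z *\<^sub>R g z)"
    by (rule continuous_on_eq[OF assms(2)]) auto
  have "continuous_on (- K) (\<lambda>_. 0::'b)" by simp
  then have 2: "continuous_on (- K) (\<lambda>z. indicator S z *\<^sub>R g z)"
    by (rule continuous_on_eq) (use assms in \<open>auto simp: indicator_def\<close>)
  have "S \<union> - K = UNIV" using assms by auto
  with continuous_on_open_Un[OF assms(1) opK 1 2] show ?thesis by simp
qed

lemma lebesgue_on_compact_support:
  fixes g :: "'a::euclidean_space \<Rightarrow> 'b::euclidean_space"
  assumes "open S" "continuous_on S g" "compact K" "K \<subseteq> S" "\<And>z. z \<in> S - K \<Longrightarrow> g z = 0"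
  shows "integrable (lebesgue_on S) g"
    and "(LINT z|lebesgue_on S. g z) = (LINT z|lborel. indicator S z *\<^sub>R g z)"
proof -
  have c: "continuous_on UNIV (\<lambda>z. indicator S z *\<^sub>R g z)"
    by (rule continuous_extension_by_zero[OF assms])
  then have [measurable]: "(\<lambda>z. indicator S z *\<^sub>R g z) \<in> borel_measurable borel"
    by (rule borel_measurable_continuous_onI)
  have "integrable lborel (\<lambda>z. indicator S z *\<^sub>R g z)"
    by (rule integrable_continuous_compact_support[OF c assms(3)])
       (use assms in \<open>auto simp: indicator_def\<close>)
  moreover have S: "S \<inter> space lebesgue \<in> sets lebesgue" using assms(1) by auto
  ultimately show "integrable (lebesgue_on S) g"
    by (subst integrable_restrict_space[OF S]) (simp add: integrable_completion)
  show "(LINT z|lebesgue_on S. g z) = (LINT z|lborel. indicator S z *\<^sub>R g z)"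
    by (subst integral_restrict_space[OF S]) (simp add: integral_completion)
qed

lemma integration_by_parts:
  fixes \<phi> :: "'a::euclidean_space \<Rightarrow> real" and w :: "'a \<Rightarrow> 'b::euclidean_space"
  assumes "open S" and \<phi>: "C1_compact S \<phi> \<phi>'" and w: "C1_on S w w'"
  shows "integrable (lebesgue_on S) (\<lambda>z. \<phi> z *\<^sub>R w' z b)"
    and "integrable (lebesgue_on S) (\<lambda>z. \<phi>' z b *\<^sub>R w z)"
    and "(LINT z|lebesgue_on S. \<phi>' z b *\<^sub>R w z) = - (LINT z|lebesgue_on S. \<phi> z *\<^sub>R w' z b)"
proof -
  obtain K where K: "compact K" "K \<subseteq> S" "\<And>z. z \<notin> K \<Longrightarrow> \<phi> z = 0" "\<And>z v. z \<notin> K \<Longrightarrow> \<phi>' z v = 0"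
    using C1_compactE[OF \<phi>] by blast
  have 1: "continuous_on S (\<lambda>z. \<phi> z *\<^sub>R w' z b)"
    using C1_compact_continuous[OF \<phi>] w[unfolded C1_on_def] by (intro continuous_intros) auto
  have 2: "continuous_on S (\<lambda>z. \<phi>' z b *\<^sub>R w z)"
    using C1_compact_continuous_derivative[OF \<phi>] C1_on_continuous[OF w]
    by (intro continuous_intros) auto
  note i1 = lebesgue_on_compact_support[OF \<open>open S\<close> 1 K(1,2)]
  note i2 = lebesgue_on_compact_support[OF \<open>open S\<close> 2 K(1,2)]
  show I1: "integrable (lebesgue_on S) (\<lambda>z. \<phi> z *\<^sub>R w' z b)" by (rule i1(1)) (use K in auto)
  show I2: "integrable (lebesgue_on S) (\<lambda>z. \<phi>' z b *\<^sub>R w z)" by (rule i2(1)) (use K in auto)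
  have "0 = (LINT z|lborel. indicator S z *\<^sub>R (\<phi> z *\<^sub>R w' z b + \<phi>' z b *\<^sub>R w z))"
    using integral_directional_derivative_zero[OF C1_compact_scaleR[OF assms]] by simp
  also have "\<dots> = (LINT z|lebesgue_on S. \<phi> z *\<^sub>R w' z b + \<phi>' z b *\<^sub>R w z)"
    by (rule lebesgue_on_compact_support(2)[OF \<open>open S\<close> continuous_on_add[OF 1 2] K(1,2), symmetric])
      (use K in auto)
  also have "\<dots> = (LINT z|lebesgue_on S. \<phi> z *\<^sub>R w' z b) + (LINT z|lebesgue_on S. \<phi>' z b *\<^sub>R w z)"
    by (rule Bochner_Integration.integral_add[OF I1 I2])
  finally show "(LINT z|lebesgue_on S. \<phi>' z b *\<^sub>R w z) = - (LINT z|lebesgue_on S. \<phi> z *\<^sub>R w' z b)"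
    by (simp add: eq_neg_iff_add_eq_0 add.commute)
qed

text \<open>The second difference of \<open>\<phi>\<close> over the parallelogram spanned by \<open>h a\<close> and \<open>h b\<close> is symmetric in \<open>a\<close> and
\<open>b\<close>. Two applications of the mean value theorem identify it with \<open>h\<^sup>2\<close> times either mixed derivative at
some point of the parallelogram; then \<open>h\<close> tends to \<open>0\<close>.\<close>

lemma second_derivative_symmetric:
  fixes \<phi> :: "'a::real_normed_vector \<Rightarrow> real"
  assumes \<phi>: "\<And>z. (\<phi> has_derivative \<phi>' z) (at z)"
    and A: "\<And>z. ((\<lambda>z. \<phi>' z a) has_derivative A z) (at z)"
    and B: "\<And>z. ((\<lambda>z. \<phi>' z b) has_derivative B z) (at z)"
    and cA: "continuous_on UNIV (\<lambda>z. A z b)" and cB: "continuous_on UNIV (\<lambda>z. B z a)"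
  shows "A z b = B z a"
proof -
  have line: "((\<lambda>s. f (y + s *\<^sub>R v)) has_real_derivative f' (y + r *\<^sub>R v) v) (at r)"
    if "\<And>z. (f has_derivative f' z) (at z)" for f :: "'a \<Rightarrow> real" and f' y v r
  proof -
    have 1: "((\<lambda>t. y + t *\<^sub>R v) has_derivative (\<lambda>t. t *\<^sub>R v)) (at r)"
      by (auto intro!: derivative_eq_intros)
    have "((\<lambda>t. f (y + t *\<^sub>R v)) has_derivative (\<lambda>t. f' (y + r *\<^sub>R v) (t *\<^sub>R v))) (at r)"
      by (rule has_derivative_compose[OF 1 that])
    moreover have "linear (f' (y + r *\<^sub>R v))"
      using that has_derivative_linear by blast
    ultimately show ?thesis
      by (simp add: linear_scale has_field_derivative_def mult_commute_abs)
  qed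
  have mixed: "\<exists>s r. 0 < s \<and> s < h \<and> 0 < r \<and> r < h \<and>
      \<phi> (y + h *\<^sub>R a + h *\<^sub>R b) - \<phi> (y + h *\<^sub>R a) - \<phi> (y + h *\<^sub>R b) + \<phi> y
        = h * h * A (y + s *\<^sub>R a + r *\<^sub>R b) b"
    if "h > 0" and A: "\<And>z. ((\<lambda>z. \<phi>' z a) has_derivative A z) (at z)" for h y a b A
  proof -
    have "\<exists>s>0. s < h \<and> (\<phi> ((y + h *\<^sub>R b) + h *\<^sub>R a) - \<phi> (y + h *\<^sub>R a)) -
           (\<phi> ((y + h *\<^sub>R b) + 0 *\<^sub>R a) - \<phi> (y + 0 *\<^sub>R a))
       = (h - 0) * (\<phi>' ((y + h *\<^sub>R b) + s *\<^sub>R a) a - \<phi>' (y + s *\<^sub>R a) a)"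
      by (rule MVT2[OF \<open>h > 0\<close>]) (intro DERIV_diff line \<phi>)
    then obtain s where s: "0 < s" "s < h" "\<phi> (y + h *\<^sub>R a + h *\<^sub>R b) - \<phi> (y + h *\<^sub>R a) - \<phi> (y + h *\<^sub>R b) + \<phi> y
       = h * (\<phi>' ((y + s *\<^sub>R a) + h *\<^sub>R b) a - \<phi>' ((y + s *\<^sub>R a) + 0 *\<^sub>R b) a)"
      by (auto simp: algebra_simps)
    have "\<exists>r>0. r < h \<and> \<phi>' ((y + s *\<^sub>R a) + h *\<^sub>R b) a - \<phi>' ((y + s *\<^sub>R a) + 0 *\<^sub>R b) a
        = (h - 0) * A (y + s *\<^sub>R a + r *\<^sub>R b) b"
      by (rule MVT2[OF \<open>h > 0\<close>]) (intro line A)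
    with s show ?thesis by (metis diff_zero mult.assoc)
  qed
  define h where "h n = inverse (real (Suc n))" for n
  have h: "h n > 0" for n by (simp add: h_def)
  have lim: "h \<longlonglongrightarrow> 0" unfolding h_def[abs_def] by (rule LIMSEQ_inverse_real_of_nat)
  have "\<forall>n. \<exists>s r s' r'. 0 < s \<and> s < h n \<and> 0 < r \<and> r < h n \<and> 0 < s' \<and> s' < h n \<and> 0 < r' \<and> r' < h n \<and>
      A (z + s *\<^sub>R a + r *\<^sub>R b) b = B (z + s' *\<^sub>R b + r' *\<^sub>R a) a"
  proof
    fix n
    obtain s r where 1: "0 < s" "s < h n" "0 < r" "r < h n"
      "\<phi> (z + h n *\<^sub>R a + h n *\<^sub>R b) - \<phi> (z + h n *\<^sub>R a) - \<phi> (z + h n *\<^sub>R b) + \<phi> z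
        = h n * h n * A (z + s *\<^sub>R a + r *\<^sub>R b) b"
      using mixed[OF h A] by blast
    obtain s' r' where 2: "0 < s'" "s' < h n" "0 < r'" "r' < h n"
      "\<phi> (z + h n *\<^sub>R b + h n *\<^sub>R a) - \<phi> (z + h n *\<^sub>R b) - \<phi> (z + h n *\<^sub>R a) + \<phi> z
        = h n * h n * B (z + s' *\<^sub>R b + r' *\<^sub>R a) a"
      using mixed[OF h B] by blast
    have "h n * h n * A (z + s *\<^sub>R a + r *\<^sub>R b) b = h n * h n * B (z + s' *\<^sub>R b + r' *\<^sub>R a) a"
      using 1(5) 2(5) by (simp add: algebra_simps)
    then have "A (z + s *\<^sub>R a + r *\<^sub>R b) b = B (z + s' *\<^sub>R b + r' *\<^sub>R a) a"
      using h[of n] by simp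
    with 1 2 show "\<exists>s r s' r'. 0 < s \<and> s < h n \<and> 0 < r \<and> r < h n \<and> 0 < s' \<and> s' < h n \<and> 0 < r' \<and> r' < h n \<and>
      A (z + s *\<^sub>R a + r *\<^sub>R b) b = B (z + s' *\<^sub>R b + r' *\<^sub>R a) a" by blast
  qed
  then obtain s r s' r' where X: "\<And>n. 0 < s n" "\<And>n. s n < h n" "\<And>n. 0 < r n" "\<And>n. r n < h n"
     "\<And>n. 0 < s' n" "\<And>n. s' n < h n" "\<And>n. 0 < r' n" "\<And>n. r' n < h n"
     and eq: "\<And>n. A (z + s n *\<^sub>R a + r n *\<^sub>R b) b = B (z + s' n *\<^sub>R b + r' n *\<^sub>R a) a"
    by metis
  have to0: "t \<longlonglongrightarrow> 0" if "\<And>n. 0 < t n" "\<And>n. t n < h n" for t :: "nat \<Rightarrow> real"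
    by (rule tendsto_sandwich[OF _ _ tendsto_const lim])
       (use that in \<open>auto intro!: always_eventually less_imp_le\<close>)
  have "(\<lambda>n. z + s n *\<^sub>R a + r n *\<^sub>R b) \<longlonglongrightarrow> z + 0 *\<^sub>R a + 0 *\<^sub>R b"
    by (intro tendsto_intros to0 X)
  then have l1: "(\<lambda>n. A (z + s n *\<^sub>R a + r n *\<^sub>R b) b) \<longlonglongrightarrow> A z b"
    by (intro continuous_on_tendsto_compose[OF cA]) auto
  have "(\<lambda>n. z + s' n *\<^sub>R b + r' n *\<^sub>R a) \<longlonglongrightarrow> z + 0 *\<^sub>R b + 0 *\<^sub>R a"
    by (intro tendsto_intros to0 X)
  then have l2: "(\<lambda>n. B (z + s' n *\<^sub>R b + r' n *\<^sub>R a) a) \<longlonglongrightarrow> B z a"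
    by (intro continuous_on_tendsto_compose[OF cB]) auto
  show ?thesis using LIMSEQ_unique[OF l1] l2 by (simp add: eq)
qed

text \<open>\<open>G\<close> is the gradient and \<open>H z v\<close> the derivative of the gradient at \<open>z\<close> in direction \<open>v\<close>.\<close>

definition C2 :: "('a::euclidean_space \<Rightarrow> real) \<Rightarrow> ('a \<Rightarrow> 'a) \<Rightarrow> ('a \<Rightarrow> 'a \<Rightarrow> 'a) \<Rightarrow> bool" where
  "C2 P G H \<longleftrightarrow> (\<forall>z. (P has_derivative (\<lambda>v. G z \<bullet> v)) (at z)) \<and> C1_on UNIV G H"

lemma C2_D:
  assumes "C2 P G H"
  shows "(P has_derivative (\<lambda>v. G z \<bullet> v)) (at z)" "(G has_derivative H z) (at z)"
    "continuous_on T (\<lambda>z. H z v)" "continuous_on T G" "continuous_on T P"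
proof -
  show "(P has_derivative (\<lambda>v. G z \<bullet> v)) (at z)" "(G has_derivative H z) (at z)" for z
    using assms unfolding C2_def C1_on_def by auto
  show "continuous_on T (\<lambda>z. H z v)"
    using assms unfolding C2_def C1_on_def by (auto intro: continuous_on_subset)
  show "continuous_on T G"
    using assms C1_on_continuous continuous_on_subset unfolding C2_def by blast
  show "continuous_on T P"
    using assms unfolding C2_def
    by (meson continuous_at_imp_continuous_on has_derivative_continuous)
qed

lemma C2_symmetric:
  assumes "C2 P G H" shows "H z v \<bullet> w = H z w \<bullet> v"
proof -
  have "((\<lambda>z. G z \<bullet> u) has_derivative (\<lambda>v. H z v \<bullet> u)) (at z)" for u z
    by (intro bounded_linear.has_derivative[OF bounded_linear_inner_left] C2_D[OF assms])
  moreover have "continuous_on UNIV (\<lambda>z. H z u \<bullet> u')" for u u'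
    by (intro continuous_intros C2_D(3)[OF assms])
  ultimately show ?thesis
    by (intro second_derivative_symmetric[OF C2_D(1)[OF assms], of w _ v])
qed

lemma C2_const: "C2 (\<lambda>_. c) (\<lambda>_. 0) (\<lambda>_ _. 0)"
proof -
  have "((\<bullet>) 0) = (\<lambda>_::'a. 0::real)" by auto
  then show ?thesis unfolding C2_def C1_on_def by simp
qed

lemma C2_inner: "C2 (\<lambda>z. z \<bullet> a) (\<lambda>_. a) (\<lambda>_ _. 0)"
  unfolding C2_def C1_on_def by (auto intro!: derivative_eq_intros simp: inner_commute)

lemma C2_add:
  assumes "C2 P G H" "C2 P2 G2 H2"
  shows "C2 (\<lambda>z. P z + P2 z) (\<lambda>z. G z + G2 z) (\<lambda>z v. H z v + H2 z v)"
  using assms C1_on_add[of UNIV G H G2 H2] unfolding C2_def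
  by (auto intro!: derivative_eq_intros simp: inner_add_left)

lemma C2_mult:
  assumes 1: "C2 P G H" and 2: "C2 P2 G2 H2"
  shows "C2 (\<lambda>z. P z * P2 z) (\<lambda>z. P z *\<^sub>R G2 z + P2 z *\<^sub>R G z)
     (\<lambda>z v. P z *\<^sub>R H2 z v + (G z \<bullet> v) *\<^sub>R G2 z + P2 z *\<^sub>R H z v + (G2 z \<bullet> v) *\<^sub>R G z)"
  unfolding C2_def C1_on_def
proof (intro conjI allI ballI)
  fix z v
  show "((\<lambda>z. P z * P2 z) has_derivative (\<lambda>v. (P z *\<^sub>R G2 z + P2 z *\<^sub>R G z) \<bullet> v)) (at z)"
    by (rule has_derivative_eq_rhs[OF has_derivative_mult[OF C2_D(1)[OF 1] C2_D(1)[OF 2]]])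
       (simp add: inner_add_left fun_eq_iff mult.commute)
  show "((\<lambda>z. P z *\<^sub>R G2 z + P2 z *\<^sub>R G z) has_derivative
      (\<lambda>v. P z *\<^sub>R H2 z v + (G z \<bullet> v) *\<^sub>R G2 z + P2 z *\<^sub>R H z v + (G2 z \<bullet> v) *\<^sub>R G z)) (at z)"
    by (rule has_derivative_eq_rhs[OF has_derivative_add[OF
          has_derivative_scaleR[OF C2_D(1)[OF 1] C2_D(2)[OF 2]]
          has_derivative_scaleR[OF C2_D(1)[OF 2] C2_D(2)[OF 1]]]])
       (simp add: fun_eq_iff add.assoc)
  show "continuous_on UNIV (\<lambda>z. P z *\<^sub>R H2 z v + (G z \<bullet> v) *\<^sub>R G2 z + P2 z *\<^sub>R H z v + (G2 z \<bullet> v) *\<^sub>R G z)"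
    by (intro continuous_intros C2_D[OF 1] C2_D[OF 2])
qed

lemma C2_compose:
  assumes 1: "C2 P G H" and f: "\<And>s. (f has_real_derivative f' s) (at s)"
    and f': "\<And>s. (f' has_real_derivative f'' s) (at s)" and f'': "continuous_on UNIV f''"
  shows "C2 (\<lambda>z. f (P z)) (\<lambda>z. f' (P z) *\<^sub>R G z)
     (\<lambda>z v. f' (P z) *\<^sub>R H z v + (f'' (P z) * (G z \<bullet> v)) *\<^sub>R G z)"
  unfolding C2_def C1_on_def
proof (intro conjI allI ballI)
  fix z v
  have d: "((\<lambda>z. g (P z)) has_derivative (\<lambda>v. g' (P z) * (G z \<bullet> v))) (at z)"
    if "\<And>s. (g has_real_derivative g' s) (at s)" for g g'
    using has_derivative_compose[OF C2_D(1)[OF 1], of g "(*) (g' (P z))"] that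
    by (simp add: has_field_derivative_def)
  show "((\<lambda>z. f (P z)) has_derivative (\<lambda>v. (f' (P z) *\<^sub>R G z) \<bullet> v)) (at z)"
    using d[OF f] by simp
  show "((\<lambda>z. f' (P z) *\<^sub>R G z) has_derivative
      (\<lambda>v. f' (P z) *\<^sub>R H z v + (f'' (P z) * (G z \<bullet> v)) *\<^sub>R G z)) (at z)"
    by (rule has_derivative_scaleR[OF d[OF f'] C2_D(2)[OF 1]])
  have "continuous_on UNIV f'" using f'
    by (meson DERIV_isCont continuous_at_imp_continuous_on)
  then have "continuous_on UNIV (\<lambda>z. f' (P z))" "continuous_on UNIV (\<lambda>z. f'' (P z))"
    using continuous_on_compose2[OF _ C2_D(5)[OF 1] subset_UNIV] f'' by blast+
  then show "continuous_on UNIV (\<lambda>z. f' (P z) *\<^sub>R H z v + (f'' (P z) * (G z \<bullet> v)) *\<^sub>R G z)"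
    by (intro continuous_intros C2_D[OF 1])
qed

lemma C2_sum:
  assumes "finite D" "\<And>x. x \<in> D \<Longrightarrow> \<exists>G H. C2 (P x) G H"
  shows "\<exists>G H. C2 (\<lambda>z. \<Sum>x\<in>D. P x z) G H"
  using assms
proof (induction D)
  case empty show ?case using C2_const[of 0] by auto
next
  case (insert x D)
  then obtain G H G2 H2 where "C2 (P x) G H" "C2 (\<lambda>z. \<Sum>x\<in>D. P x z) G2 H2"
    by (metis insertI1 insertI2)
  from C2_add[OF this] insert(1,2) show ?case by auto
qed

lemma DERIV_positive_part_power:
  "((\<lambda>s::real. max 0 s ^ Suc (Suc n)) has_real_derivative real (Suc (Suc n)) * max 0 s ^ Suc n) (at s)"
proof -
  consider "s < 0" | "s > 0" | "s = 0" by linarith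
  then show ?thesis
  proof cases
    case 1
    have "((\<lambda>s. 0) has_real_derivative 0) (at s)" by simp
    then have "((\<lambda>s. max 0 s ^ Suc (Suc n)) has_real_derivative 0) (at s)"
      by (rule DERIV_cong_ev[THEN iffD1, rotated 3])
        (use 1 in \<open>auto simp: eventually_nhds intro!: exI[of _ "{..<0}"]\<close>)
    then show ?thesis using 1 by simp
  next
    case 2
    have "((\<lambda>s. s ^ Suc (Suc n)) has_real_derivative real (Suc (Suc n)) * s ^ Suc n) (at s)"
      using DERIV_pow[of "Suc (Suc n)" s] by simp
    then have "((\<lambda>s. max 0 s ^ Suc (Suc n)) has_real_derivative real (Suc (Suc n)) * s ^ Suc n) (at s)"
      by (rule DERIV_cong_ev[THEN iffD1, rotated 3])
        (use 2 in \<open>auto simp: eventually_nhds intro!: exI[of _ "{0<..}"]\<close>)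
    then show ?thesis using 2 by simp
  next
    case 3
    have "((\<lambda>h::real. \<bar>h\<bar> ^ Suc n) \<longlongrightarrow> \<bar>0\<bar> ^ Suc n) (at 0)"
      by (intro tendsto_intros)
    then have l: "((\<lambda>h::real. \<bar>h\<bar> ^ Suc n) \<longlongrightarrow> 0) (at 0)" by simp
    have "((\<lambda>h::real. (max 0 (0 + h) ^ Suc (Suc n) - max 0 0 ^ Suc (Suc n)) / h) \<longlongrightarrow> 0) (at 0)"
    proof (rule Lim_null_comparison[OF _ l], rule always_eventually, rule allI)
      fix h :: real
      have "\<bar>max 0 h\<bar> \<le> \<bar>h\<bar>" by auto
      then have "\<bar>max 0 h\<bar> ^ Suc (Suc n) \<le> \<bar>h\<bar> ^ Suc (Suc n)" by (intro power_mono) auto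
      then have "\<bar>max 0 h\<bar> ^ Suc (Suc n) / \<bar>h\<bar> \<le> \<bar>h\<bar> ^ Suc n"
        by (cases "h = 0") (auto simp: field_simps)
      then show "norm ((max 0 (0 + h) ^ Suc (Suc n) - max 0 0 ^ Suc (Suc n)) / h) \<le> \<bar>h\<bar> ^ Suc n"
        by (simp add: abs_mult power_abs)
    qed
    then show ?thesis using 3 by (simp add: DERIV_def)
  qed
qed

lemma C2_positive_part_cubed:
  assumes "C2 P G H" shows "\<exists>G H. C2 (\<lambda>z. max 0 (P z) ^ 3) G H"
proof -
  have "((\<lambda>s::real. max 0 s ^ 3) has_real_derivative 3 * max 0 s ^ 2) (at s)" for s
    using DERIV_positive_part_power[of 1 s] by (simp add: eval_nat_numeral)
  moreover have "((\<lambda>s::real. 3 * max 0 s ^ 2) has_real_derivative 3 * (2 * max 0 s)) (at s)" for s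
    using DERIV_cmult[OF DERIV_positive_part_power[of 0 s], of 3] by (simp add: eval_nat_numeral)
  moreover have "continuous_on UNIV (\<lambda>s::real. 3 * (2 * max 0 s))" by (intro continuous_intros)
  ultimately show ?thesis by (intro exI) (rule C2_compose[OF assms])
qed

text \<open>The bumps \<open>max 0 (r\<^sup>2 - \<bar>z - x\<bar>\<^sup>2) ^ 3\<close> are of class \<open>C\<^sup>2\<close>, and a finite sum \<open>B\<close> of them is at least some
\<open>m > 0\<close> on \<open>C\<close>. The function \<open>1 - max 0 (1 - B / m) ^ 3\<close> is \<open>1\<close> where \<open>B \<ge> m\<close> and \<open>0\<close> where \<open>B = 0\<close>.\<close>

lemma C2_cutoff:
  fixes C S :: "'a::euclidean_space set"
  assumes "compact C" "open S" "C \<subseteq> S"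
  obtains \<theta> G H K where "C2 \<theta> G H" "\<And>z. 0 \<le> \<theta> z" "\<And>z. \<theta> z \<le> 1" "\<And>z. z \<in> C \<Longrightarrow> \<theta> z = 1"
    "compact K" "K \<subseteq> S" "\<And>z. z \<notin> K \<Longrightarrow> \<theta> z = 0"
proof (cases "C = {}")
  case True
  show ?thesis by (rule that[OF C2_const[of 0], of "{}"]) (use True in auto)
next
  case False
  have "\<forall>x\<in>C. \<exists>r>0. cball x r \<subseteq> S"
    using assms open_contains_cball by blast
  then obtain r where r: "\<And>x. x \<in> C \<Longrightarrow> r x > 0" "\<And>x. x \<in> C \<Longrightarrow> cball x (r x) \<subseteq> S"
    by metis
  obtain D where D: "D \<subseteq> C" "finite D" "C \<subseteq> (\<Union>x\<in>D. ball x (r x))"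
    using compactE_image[OF \<open>compact C\<close>, of C "\<lambda>x. ball x (r x)"] r(1)
    by (metis (no_types, lifting) UN_I centre_in_ball open_ball subsetI)
  define b where "b x z = max 0 ((r x)\<^sup>2 - (z - x) \<bullet> (z - x)) ^ 3" for x z
  have bpos: "b x z > 0 \<longleftrightarrow> z \<in> ball x (r x)" if "x \<in> C" for x z
  proof -
    have "b x z > 0 \<longleftrightarrow> (z - x) \<bullet> (z - x) < (r x)\<^sup>2"
      unfolding b_def by (auto simp: max_def zero_less_power_eq)
    also have "\<dots> \<longleftrightarrow> z \<in> ball x (r x)"
      using r(1)[OF that] power2_eq_iff_nonneg
      by (metis (no_types, lifting) abs_of_pos dist_commute dist_norm mem_ball norm_lt_square power2_norm_eq_inner)
    finally show ?thesis .
  qed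
  have b0: "b x z \<ge> 0" for x z by (simp add: b_def)
  have C2b: "\<exists>G H. C2 (b x) G H" for x
  proof -
    have "C2 (\<lambda>z. (r x)\<^sup>2 - (z - x) \<bullet> (z - x)) (\<lambda>z. (- 2) *\<^sub>R (z - x)) (\<lambda>z v. (- 2) *\<^sub>R v)"
      unfolding C2_def C1_on_def
      by (auto intro!: derivative_eq_intros simp: inner_commute inner_diff_left inner_diff_right)
    from C2_positive_part_cubed[OF this] show ?thesis unfolding b_def .
  qed
  define B where "B z = (\<Sum>x\<in>D. b x z)" for z
  obtain G H where B: "C2 B G H" using C2_sum[OF D(2), of b] C2b unfolding B_def by blast
  have Bpos: "B z > 0" if z: "z \<in> C" for z
  proof -
    obtain x where "x \<in> D" "z \<in> ball x (r x)" using D z by blast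
    then show ?thesis using D(1) bpos b0 unfolding B_def
      by (metis (no_types, lifting) D(2) subsetD sum_pos2)
  qed
  obtain m where m: "m > 0" "\<And>z. z \<in> C \<Longrightarrow> B z \<ge> m"
    using continuous_attains_inf[OF \<open>compact C\<close> False C2_D(5)[OF B]] Bpos by blast
  define \<theta> where "\<theta> z = 1 + (- 1) * max 0 (1 + (- 1 / m) * B z) ^ 3" for z
  obtain G1 H1 where "C2 (\<lambda>z. max 0 (1 + (- 1 / m) * B z) ^ 3) G1 H1"
    using C2_positive_part_cubed[OF C2_add[OF C2_const C2_mult[OF C2_const B]]] by blast
  then obtain G2 H2 where "C2 \<theta> G2 H2"
    using C2_add[OF C2_const C2_mult[OF C2_const]] unfolding \<theta>_def by blast
  moreover have B0: "B z \<ge> 0" for z unfolding B_def by (intro sum_nonneg b0)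
  have "1 + (- 1 / m) * B z \<le> 1" for z using B0[of z] m(1) by (simp add: field_simps)
  then have "max 0 (1 + (- 1 / m) * B z) ^ 3 \<le> 1" for z
    by (intro power_le_one) auto
  moreover have "max 0 (1 + (- 1 / m) * B z) ^ 3 \<ge> 0" for z by simp
  moreover have "\<theta> z = 1" if "z \<in> C" for z
    using m(1) m(2)[OF that] by (simp add: \<theta>_def max_def field_simps)
  moreover have "compact (\<Union>x\<in>D. cball x (r x))" using D(2) by (intro compact_UN) auto
  moreover have "(\<Union>x\<in>D. cball x (r x)) \<subseteq> S" using r D by blast
  moreover have "\<theta> z = 0" if "z \<notin> (\<Union>x\<in>D. cball x (r x))" for z
  proof -
    have "b x z = 0" if "x \<in> D" for x
      using bpos[of x z] D(1) b0[of x z] that \<open>z \<notin> _\<close>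
      by (metis UN_iff ball_subset_cball less_eq_real_def subsetD)
    then show ?thesis by (simp add: \<theta>_def B_def)
  qed
  ultimately show ?thesis
    by (intro that[of \<theta> G2 H2 "\<Union>x\<in>D. cball x (r x)"]) (auto simp: \<theta>_def)
qed

section \<open>An oscillating profile\<close>

text \<open>\<open>h\<close> is the rounded triangular wave \<open>arcsin (c sin t)\<close> with \<open>c < 1\<close> close to \<open>1\<close>, so that its derivative \<open>g\<close>
is a continuous approximation of the square wave \<open>sgn (cos t)\<close>; \<open>q\<close> is an antiderivative of \<open>h\<close>. The
linear growth of \<open>q\<close> does no harm: it will occur only as \<open>q (l t) / l\<^sup>2\<close> with bounded \<open>t\<close>.\<close>

lemma square_wave:
  fixes \<epsilon> r :: real
  assumes "0 < \<epsilon>" "\<epsilon> < 1" "0 < r"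
  obtains q h g :: "real \<Rightarrow> real" where
    "\<And>t. (q has_real_derivative h t) (at t)" "\<And>t. (h has_real_derivative g t) (at t)"
    "continuous_on UNIV g" "\<And>t. \<bar>q t\<bar> \<le> 2 * \<bar>t\<bar>" "\<And>t. \<bar>h t\<bar> \<le> 2" "\<And>t. \<bar>g t\<bar> \<le> 1"
    "\<And>t. g (t + pi) = - g t" "\<And>t. \<bar>cos t\<bar> > r \<Longrightarrow> \<bar>g t\<bar> > 1 - \<epsilon>"
proof -
  define d where "d = (1 - \<epsilon>)\<^sup>2"
  have d: "0 < d" "d < 1" using assms unfolding d_def by (auto simp: power_less_one_iff)
  \<comment> \<open>Here \<open>g\<^sup>2 = cos\<^sup>2 / (k + cos\<^sup>2)\<close>, which exceeds \<open>d\<close> as soon as \<open>cos\<^sup>2 (1 - d) > d k\<close>.\<close>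
  define k where "k = r\<^sup>2 * (1 - d) / 2"
  have k: "k > 0" using d assms by (simp add: k_def)
  define h where "h t = arcsin (sin t / sqrt (1 + k))" for t
  define g where "g t = cos t / sqrt (k + (cos t)\<^sup>2)" for t
  have s1: "\<bar>sin t / sqrt (1 + k)\<bar> < 1" for t
  proof -
    have "\<bar>sin t\<bar> \<le> 1" by simp
    also have "1 < sqrt (1 + k)" using k by simp
    finally have "\<bar>sin t\<bar> < sqrt (1 + k)" .
    then show ?thesis using k by (simp add: pos_divide_less_eq)
  qed
  have pos: "k + (cos t)\<^sup>2 > 0" for t using k by (simp add: add_pos_nonneg)
  have hd: "(h has_real_derivative g t) (at t)" for t
  proof -
    have b: "- 1 < sin t / sqrt (1 + k)" "sin t / sqrt (1 + k) < 1" using s1[of t] by linarith+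
    have "(h has_real_derivative inverse (sqrt (1 - (sin t / sqrt (1 + k))\<^sup>2)) * (cos t / sqrt (1 + k))) (at t)"
      unfolding h_def
      by (rule DERIV_chain2[where f = arcsin and g = "\<lambda>t. sin t / sqrt (1 + k)", OF DERIV_arcsin[OF b]])
         (rule DERIV_cdivide[OF DERIV_sin])
    moreover have "sqrt (1 - (sin t / sqrt (1 + k))\<^sup>2) * sqrt (1 + k) = sqrt (k + (cos t)\<^sup>2)"
      using k by (simp add: power_divide cos_squared_eq field_simps flip: real_sqrt_mult)
    moreover have "1 - (sin t / sqrt (1 + k))\<^sup>2 > 0" 
      using s1[of t] by (simp add: abs_square_less_1)
    ultimately show ?thesis using k
      by (simp add: g_def divide_inverse mult_ac flip: inverse_mult_distrib)
  qed
  have hb: "\<bar>h t\<bar> \<le> 2" for t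
  proof -
    have "\<bar>h t\<bar> \<le> pi / 2" unfolding h_def
      using arcsin_bounded[of "sin t / sqrt (1 + k)"] s1[of t] unfolding abs_le_iff by linarith
    then show ?thesis using pi_less_4 by linarith
  qed
  have hc: "isCont h t" for t using hd DERIV_isCont by blast
  obtain q0 where q0: "\<And>t. (q0 has_real_derivative h t) (at t)"
    using einterval_antiderivative[of "-\<infinity>" \<infinity> h] hc
    by (auto simp: has_real_derivative_iff_has_vector_derivative)
  define q where "q t = q0 t - q0 0" for t
  have qd: "(q has_real_derivative h t) (at t)" for t
    unfolding q_def using q0[of t] by (auto intro!: derivative_eq_intros)
  have qb: "\<bar>q t\<bar> \<le> 2 * \<bar>t\<bar>" for t
  proof -
    have "norm (q t - q 0) \<le> 2 * norm (t - 0)"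
    proof (rule field_differentiable_bound[of UNIV])
      show "(q has_field_derivative h z) (at z within UNIV)" for z using qd by simp
      show "norm (h z) \<le> 2" for z using hb by simp
    qed auto
    then show ?thesis by (simp add: q_def)
  qed
  have gb: "\<bar>g t\<bar> \<le> 1" for t
  proof -
    have "\<bar>cos t\<bar> \<le> sqrt (k + (cos t)\<^sup>2)" using k by (intro real_le_rsqrt) auto
    then show ?thesis using pos[of t] by (simp add: g_def)
  qed
  have gc: "continuous_on UNIV g"
    unfolding g_def using pos by (intro continuous_intros) (auto simp: less_imp_neq[symmetric])
  have gl: "\<bar>g t\<bar> > 1 - \<epsilon>" if t: "\<bar>cos t\<bar> > r" for t
  proof -
    have "r\<^sup>2 < (cos t)\<^sup>2" using t assms(3) by (metis abs_of_pos abs_le_square_iff not_le)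
    then have "r\<^sup>2 * (1 - d) < (cos t)\<^sup>2 * (1 - d)" using d by simp
    moreover have "d * k \<le> k" using d k by (simp add: mult_left_le_one_le)
    moreover have "k \<le> r\<^sup>2 * (1 - d)" using k by (simp add: k_def mult.commute)
    ultimately have "d * (k + (cos t)\<^sup>2) < (cos t)\<^sup>2" by (simp add: algebra_simps)
    then have "d < (g t)\<^sup>2" using pos[of t] by (simp add: g_def power_divide field_simps)
    then show ?thesis using assms(2) unfolding d_def
      by (metis abs_le_square_iff abs_of_pos diff_gt_0_iff_gt not_le)
  qed
  show ?thesis by (rule that[OF qd hd gc qb hb gb _ gl]) (auto simp: g_def)
qed

lemma translate_into_open:
  fixes C S :: "'a::euclidean_space set"
  assumes "compact C" "open S" "C \<subseteq> S"
  obtains e where "e > 0" "\<And>z w. z \<in> C \<Longrightarrow> norm w < e \<Longrightarrow> z + w \<in> S"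
proof -
  obtain e where e: "e > 0" "(\<Union>x\<in>C. ball x e) \<subseteq> S"
    using compact_subset_open_imp_ball_epsilon_subset[OF assms] by blast
  show ?thesis by (rule that[OF e(1)]) (use e(2) in \<open>force simp: dist_norm\<close>)
qed

lemma compact_inner_approximation:
  fixes S :: "'a::euclidean_space set"
  assumes "bounded S" "S \<in> lmeasurable" "e > 0"
  obtains C where "compact C" "C \<subseteq> S" "S - C \<in> lmeasurable" "measure lebesgue (S - C) < e"
proof -
  obtain C where C: "closed C" "C \<subseteq> S" "S - C \<in> lmeasurable" "emeasure lebesgue (S - C) < ennreal e"
    using sets_lebesgue_inner_closed[OF fmeasurableD[OF assms(2)] \<open>e > 0\<close>] by metis
  have "compact C" using C assms(1) bounded_subset compact_eq_bounded_closed by blast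
  moreover have "measure lebesgue (S - C) < e"
    using C(3,4) assms(3) by (simp add: emeasure_eq_measure2 ennreal_less_iff)
  ultimately show ?thesis using that C by blast
qed

text \<open>The phase shifts by \<open>0, 1/m, ..., (m - 1)/m\<close> move the layer where the cosine is at most \<open>r\<close> in absolute
value to disjoint sets: if the cosines of \<open>x\<close> and \<open>x'\<close> are at most \<open>r\<close> in absolute value, then
\<open>sin (x - x') \<le> 2 r < sin (1/m)\<close>. For large \<open>l\<close> the corresponding translations are so short that the
points of \<open>C\<close> stay in \<open>S\<close>, so \<open>m\<close> disjoint copies of the layer fit into \<open>S\<close>.\<close>

lemma transition_layer_small:
  fixes C S :: "'a::euclidean_space set" and m :: nat
  assumes "compact C" "open S" "bounded S" "C \<subseteq> S" "a \<noteq> 0" "m > 0"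
  obtains r l0 where "r > 0" "l0 > 0"
    "\<And>l. l \<ge> l0 \<Longrightarrow> m * measure lebesgue {z \<in> C. \<bar>cos (l * (z \<bullet> a))\<bar> \<le> r} \<le> measure lebesgue S"
proof -
  obtain e where e: "e > 0" "\<And>z w. z \<in> C \<Longrightarrow> norm w < e \<Longrightarrow> z + w \<in> S"
    using translate_into_open[OF assms(1,2,4)] by blast
  define r where "r = sin (1 / m) / 4"
  have m1: "0 < 1 / real m" "1 / real m \<le> 1" using assms(6) by (auto simp: field_simps)
  have sm: "sin (1 / m) > 0" using m1 by (intro sin_gt_zero) (use pi_gt3 in linarith)+
  then have r: "r > 0" "2 * r < sin (1 / m)" by (auto simp: r_def)
  define l0 where "l0 = 2 / (norm a * e)"
  have l0: "l0 > 0" using e assms(5) by (simp add: l0_def)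
  have "m * measure lebesgue {z \<in> C. \<bar>cos (l * (z \<bullet> a))\<bar> \<le> r} \<le> measure lebesgue S" if l: "l \<ge> l0" for l
  proof -
    define E where "E = {z \<in> C. \<bar>cos (l * (z \<bullet> a))\<bar> \<le> r}"
    have "closed {z. \<bar>cos (l * (z \<bullet> a))\<bar> \<le> r}" by (intro closed_Collect_le continuous_intros)
    then have cE: "compact E" unfolding E_def
      using compact_Int_closed[OF assms(1)] by (simp add: Collect_conj_eq)
    then have E: "E \<in> lmeasurable" by (rule lmeasurable_compact)
    have l_pos: "l > 0" using l l0 by linarith
    define w where "w k = ((real k / m) / (l * (a \<bullet> a))) *\<^sub>R a" for k :: nat
    have wa: "l * (w k \<bullet> a) = real k / m" for k
      using l_pos assms(5) by (simp add: w_def)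
    have nw: "norm (w k) < e" if "k < m" for k
    proof -
      have "norm (w k) = (real k / m) / (l * norm a)"
        using l_pos assms(5,6) by (simp add: w_def dot_square_norm power2_eq_square)
      also have "\<dots> \<le> 1 / (l * norm a)"
        using that l_pos assms(5) by (intro divide_right_mono) auto
      also have "\<dots> \<le> 1 / (l0 * norm a)"
        using l l0 assms(5) by (intro divide_left_mono mult_right_mono mult_pos_pos) auto
      also have "\<dots> = e / 2" using assms(5) e by (simp add: l0_def)
      finally show ?thesis using e by simp
    qed
    have disj: False if jk: "j < k" "k < m" and z: "z1 \<in> E" "z2 \<in> E" "w j + z1 = w k + z2" for j k z1 z2
    proof -
      have c: "\<bar>cos (l * (z1 \<bullet> a))\<bar> \<le> r" "\<bar>cos (l * (z2 \<bullet> a))\<bar> \<le> r" using z by (auto simp: E_def)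
      have "z1 \<bullet> a - z2 \<bullet> a = w k \<bullet> a - w j \<bullet> a"
        using arg_cong[OF z(3), of "\<lambda>x. x \<bullet> a"] by (simp add: inner_add_left)
      then have "l * (z1 \<bullet> a) - l * (z2 \<bullet> a) = real k / m - real j / m"
        using wa by (metis right_diff_distrib)
      also have "\<dots> = (real k - real j) / m" by (simp add: diff_divide_distrib)
      finally have eq: "l * (z1 \<bullet> a) - l * (z2 \<bullet> a) = (real k - real j) / m" .
      have kj: "1 / m \<le> (real k - real j) / m" "(real k - real j) / m \<le> 1"
        using jk by (auto simp: field_simps)
      have "sin (1 / m) \<le> sin ((real k - real j) / m)"
        by (rule sin_monotone_2pi_le) (use m1 pi_gt3 kj in linarith)+
      also have "\<dots> = sin (l * (z1 \<bullet> a)) * cos (l * (z2 \<bullet> a)) - cos (l * (z1 \<bullet> a)) * sin (l * (z2 \<bullet> a))"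
        by (simp flip: eq add: sin_diff)
      also have "\<dots> \<le> \<bar>sin (l * (z1 \<bullet> a))\<bar> * \<bar>cos (l * (z2 \<bullet> a))\<bar> + \<bar>cos (l * (z1 \<bullet> a))\<bar> * \<bar>sin (l * (z2 \<bullet> a))\<bar>"
        by (simp flip: abs_mult)
      also have "\<dots> \<le> 1 * r + r * 1"
        using c r by (intro add_mono mult_mono) auto
      finally show False using r by simp
    qed
    have "disjoint_family_on (\<lambda>k. (+) (w k) ` E) {..<m}"
      unfolding disjoint_family_on_def using disj by (auto) (metis linorder_neqE_nat)
    then have "measure lebesgue (\<Union>k<m. (+) (w k) ` E) = (\<Sum>k<m. measure lebesgue ((+) (w k) ` E))"
      using fmeasurableD[OF measurable_translation[OF E]] fmeasurableD2[OF measurable_translation[OF E]]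
      by (intro measure_finite_Union) (auto simp del: emeasure_completion)
    also have "\<dots> = m * measure lebesgue E" by (simp add: measure_translation)
    finally have "m * measure lebesgue E = measure lebesgue (\<Union>k<m. (+) (w k) ` E)" by simp
    also have "\<dots> \<le> measure lebesgue S"
    proof (rule measure_mono_fmeasurable)
      show "(\<Union>k<m. (+) (w k) ` E) \<subseteq> S"
        using e(2) nw by (auto simp: E_def add.commute)
      show "(\<Union>k<m. (+) (w k) ` E) \<in> sets lebesgue"
        using measurable_translation[OF E] by (auto simp: fmeasurable_def)
      show "S \<in> lmeasurable" using assms by (simp add: lmeasurable_open)
    qed
    finally show ?thesis unfolding E_def .
  qed
  with r(1) l0 show ?thesis by (rule that)
qed

lemma C2_compact_support:
  assumes P: "C2 P G H" and K: "compact K" "\<And>z. z \<notin> K \<Longrightarrow> P z = 0"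
  shows "\<And>z. z \<notin> K \<Longrightarrow> G z = 0" "\<And>z v. z \<notin> K \<Longrightarrow> H z v = 0"
    and "\<exists>M>0. \<forall>z v. norm (G z) \<le> M \<and> norm (H z v) \<le> M * norm v"
proof -
  have opK: "open (- K)" using K(1) compact_imp_closed by blast
  show G0: "G z = 0" if "z \<notin> K" for z
  proof -
    have "((\<lambda>_. 0) has_derivative (\<lambda>v. G z \<bullet> v)) (at z)"
      by (rule has_derivative_transform_within_open[OF C2_D(1)[OF P] opK]) (use that K in auto)
    then have "(\<lambda>v. G z \<bullet> v) = (\<lambda>_. 0)"
      using has_derivative_const has_derivative_unique by blast
    then show ?thesis by (metis inner_eq_zero_iff)
  qed
  show H0: "H z v = 0" if "z \<notin> K" for z v
  proof -
    have "((\<lambda>_. 0) has_derivative H z) (at z)"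
      by (rule has_derivative_transform_within_open[OF C2_D(2)[OF P] opK]) (use that G0 in auto)
    then have "H z = (\<lambda>_. 0)"
      using has_derivative_const has_derivative_unique by blast
    then show ?thesis by simp
  qed
  have bd: "\<exists>M\<ge>0. \<forall>z. norm (f z) \<le> M" if "continuous_on K f" "\<And>z. z \<notin> K \<Longrightarrow> f z = 0" for f :: "'a \<Rightarrow> 'a"
  proof -
    have "bounded (f ` K)" by (intro compact_imp_bounded compact_continuous_image that K)
    then obtain M where "M > 0" "\<And>z. z \<in> K \<Longrightarrow> norm (f z) \<le> M" unfolding bounded_pos by auto
    then show ?thesis using that(2) by (intro exI[of _ M]) (metis less_imp_le norm_zero)
  qed
  obtain MG where MG: "MG \<ge> 0" "\<And>z. norm (G z) \<le> MG"
    using bd[OF C2_D(4)[OF P] G0] by blast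
  have "\<forall>b. \<exists>M\<ge>0. \<forall>z. norm (H z b) \<le> M"
    using bd[OF C2_D(3)[OF P] H0] by blast
  then obtain MH where MH: "\<And>b. MH b \<ge> 0" "\<And>b z. norm (H z b) \<le> MH b" by metis
  have MHs: "norm (H z v) \<le> (\<Sum>b\<in>Basis. MH b) * norm v" for z v
  proof -
    have "linear (H z)" using C2_D(2)[OF P] has_derivative_linear by blast
    then have "H z v = (\<Sum>b\<in>Basis. (v \<bullet> b) *\<^sub>R H z b)"
      by (metis (no_types, lifting) euclidean_representation linear_scale linear_sum sum.cong)
    also have "norm \<dots> \<le> (\<Sum>b\<in>Basis. norm v * MH b)"
      by (rule sum_norm_le) (auto intro!: mult_mono simp: Basis_le_norm MH)
    finally show ?thesis by (simp add: sum_distrib_left mult.commute)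
  qed
  have S0: "(\<Sum>b\<in>Basis. MH b) \<ge> 0" using MH(1) by (simp add: sum_nonneg)
  have "norm (G z) \<le> MG + (\<Sum>b\<in>Basis. MH b) + 1 \<and> norm (H z v) \<le> (MG + (\<Sum>b\<in>Basis. MH b) + 1) * norm v" for z v
    using MG(1) MG(2)[of z] S0 by (auto intro!: order_trans[OF MHs] mult_right_mono)
  then show "\<exists>M>0. \<forall>z v. norm (G z) \<le> M \<and> norm (H z v) \<le> M * norm v"
    using MG(1) S0
    by (intro exI[of _ "MG + (\<Sum>b\<in>Basis. MH b) + 1"]) auto
qed

text \<open>The shift by half a period exchanges the two phases of the wave; hence neither occupies more than half
of \<open>S\<close>.\<close>

lemma half_measure:
  fixes S A :: "'a::euclidean_space set"
  assumes "S \<in> lmeasurable" "A \<in> lmeasurable" "A \<subseteq> S" "\<And>z. z \<in> A \<Longrightarrow> z + w \<in> S - A"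
  shows "measure lebesgue A \<le> measure lebesgue S / 2"
proof -
  have T: "(+) w ` A \<in> lmeasurable" by (rule measurable_translation[OF assms(2)])
  have "A \<inter> (+) w ` A = {}" using assms(4) by (auto simp: add.commute)
  then have "measure lebesgue (A \<union> (+) w ` A) = measure lebesgue A + measure lebesgue ((+) w ` A)"
    using measure_Un3[OF assms(2) T] by simp
  moreover have "measure lebesgue (A \<union> (+) w ` A) \<le> measure lebesgue S"
    using assms T by (intro measure_mono_fmeasurable) (auto simp: add.commute fmeasurable_def)
  ultimately show ?thesis by (simp add: measure_translation)
qed

text \<open>With a cutoff \<open>\<theta>\<close> that is \<open>1\<close> on most of \<open>S\<close> and a large frequency \<open>l\<close> put
\<open>P z = \<theta> z * q (l * (z \<bullet> a)) / l\<^sup>2\<close>, where \<open>q'' = g\<close> is the square wave. Differentiating \<open>q\<close> twice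
cancels \<open>l\<^sup>2\<close>, and every term in which a derivative falls on \<open>\<theta>\<close> keeps a factor \<open>1 / l\<close>. So \<open>P\<close> and
its gradient are small, while its Hessian is close to \<open>F z\<close> times the rank-one form \<open>a \<otimes> a\<close> with
\<open>F z = \<theta> z * g (l * (z \<bullet> a))\<close>, and \<open>F\<close> is close to \<open>1\<close> and to \<open>-1\<close> on almost one half of \<open>S\<close> each.\<close>

proposition oscillating_profile:
  fixes S :: "'a::euclidean_space set"
  assumes "open S" "bounded S" "a \<noteq> 0" "0 < \<epsilon>" "\<epsilon> < 1"
  obtains P G H F K S1 S2 where "C2 P G H" "compact K" "K \<subseteq> S" "\<And>z. z \<notin> K \<Longrightarrow> P z = 0"
    "\<And>z. \<bar>P z\<bar> \<le> \<epsilon>" "\<And>z. norm (G z) \<le> \<epsilon>"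
    "\<And>z v. norm (H z v - (F z * (a \<bullet> v)) *\<^sub>R a) \<le> \<epsilon> * norm v" "\<And>z. \<bar>F z\<bar> \<le> 1"
    "open S1" "open S2" "S1 \<subseteq> S" "S2 \<subseteq> S" "S1 \<inter> S2 = {}"
    "measure lebesgue S1 \<le> measure lebesgue S / 2" "measure lebesgue S2 \<le> measure lebesgue S / 2"
    "measure lebesgue (S - (S1 \<union> S2)) \<le> \<epsilon>"
    "\<And>z. z \<in> S1 \<Longrightarrow> F z > 1 - \<epsilon>" "\<And>z. z \<in> S2 \<Longrightarrow> F z < - 1 + \<epsilon>"
proof -
  have S: "S \<in> lmeasurable" using assms by (simp add: lmeasurable_open)
  obtain C where C: "compact C" "C \<subseteq> S" "S - C \<in> lmeasurable" "measure lebesgue (S - C) < \<epsilon> / 2"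
    using compact_inner_approximation[OF assms(2) S, of "\<epsilon> / 2"] assms(4) by auto
  obtain \<theta> G0 H0 K where \<theta>: "C2 \<theta> G0 H0" "\<And>z. 0 \<le> \<theta> z" "\<And>z. \<theta> z \<le> 1" "\<And>z. z \<in> C \<Longrightarrow> \<theta> z = 1"
    and K: "compact K" "K \<subseteq> S" "\<And>z. z \<notin> K \<Longrightarrow> \<theta> z = 0"
    using C2_cutoff[OF C(1) assms(1) C(2)] by metis
  note supp0 = C2_compact_support(1,2)[OF \<theta>(1) K(1,3)]
  obtain M where M: "M > 0" "\<And>z. norm (G0 z) \<le> M" "\<And>z v. norm (H0 z v) \<le> M * norm v"
    using C2_compact_support(3)[OF \<theta>(1) K(1,3)] by blast
  obtain R where R: "R > 0" "\<And>z. z \<in> K \<Longrightarrow> norm z \<le> R"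
    using compact_imp_bounded[OF K(1)] unfolding bounded_pos by blast
  obtain m :: nat where m: "measure lebesgue S / (\<epsilon> / 2) < m" "m > 0"
    using reals_Archimedean2 measure_nonneg assms(4)
    by (metis divide_nonneg_pos half_gt_zero_iff of_nat_0_less_iff order_le_less_trans)
  obtain r l0 where r: "r > 0" "l0 > 0" and layer:
    "\<And>l. l \<ge> l0 \<Longrightarrow> m * measure lebesgue {z \<in> C. \<bar>cos (l * (z \<bullet> a))\<bar> \<le> r} \<le> measure lebesgue S"
    using transition_layer_small[OF C(1) assms(1,2) C(2) assms(3) m(2)] by blast
  obtain q h g where q: "\<And>t. (q has_real_derivative h t) (at t)" "\<And>t. (h has_real_derivative g t) (at t)"
    "continuous_on UNIV g" "\<And>t. \<bar>q t\<bar> \<le> 2 * \<bar>t\<bar>" "\<And>t. \<bar>h t\<bar> \<le> 2" "\<And>t. \<bar>g t\<bar> \<le> 1"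
    "\<And>t. g (t + pi) = - g t" "\<And>t. \<bar>cos t\<bar> > r \<Longrightarrow> \<bar>g t\<bar> > 1 - \<epsilon>"
    using square_wave[OF assms(4,5) r(1)] by blast
  obtain e where e: "e > 0" "\<And>z w. z \<in> K \<Longrightarrow> norm w < e \<Longrightarrow> z + w \<in> S"
    using translate_into_open[OF K(1) assms(1) K(2)] by blast
  \<comment> \<open>\<open>Q / l\<close> bounds all the terms that contain a factor \<open>1 / l\<close>; the last entry of \<open>l\<close> below makes half a period of the wave shorter than \<open>e\<close>.\<close>
  define Q where "Q = 4 * norm a * M + 2 * R * norm a * M + 2 * R * norm a + 2 * norm a"
  define l where "l = max l0 (max (Q / \<epsilon>) (2 * pi / (norm a * e)))"
  have l: "l \<ge> l0" "l > 0" "Q / \<epsilon> \<le> l" "2 * pi / (norm a * e) \<le> l"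
    using r(2) by (auto simp: l_def less_max_iff_disj)
  have Ql: "Q / l \<le> \<epsilon>" using l assms(4) by (simp add: field_simps)
  define f where "f s = q (l * s) / l\<^sup>2" for s
  define f1 where "f1 s = h (l * s) / l" for s
  define f2 where "f2 s = g (l * s)" for s
  have f: "(f has_real_derivative f1 s) (at s)" for s
    unfolding f_def f1_def using l(2)
    by (auto intro!: derivative_eq_intros DERIV_chain2[OF q(1)] simp: power2_eq_square)
  have f1: "(f1 has_real_derivative f2 s) (at s)" for s
    unfolding f1_def f2_def using l(2) by (auto intro!: derivative_eq_intros DERIV_chain2[OF q(2)])
  have f2: "continuous_on UNIV f2" unfolding f2_def
    by (intro continuous_on_compose2[OF q(3)] continuous_intros) auto
  have fb: "\<bar>f (z \<bullet> a)\<bar> \<le> 2 * R * norm a / l" if "z \<in> K" for z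
  proof -
    have "\<bar>f (z \<bullet> a)\<bar> \<le> 2 * (l * \<bar>z \<bullet> a\<bar>) / l\<^sup>2"
      using q(4)[of "l * (z \<bullet> a)"] l(2) unfolding f_def by (simp add: abs_mult divide_right_mono)
    also have "\<dots> = 2 * \<bar>z \<bullet> a\<bar> / l" using l(2) by (simp add: power2_eq_square)
    also have "\<bar>z \<bullet> a\<bar> \<le> R * norm a"
      using Cauchy_Schwarz_ineq2[of z a] R(2)[OF that] by (meson mult_right_mono norm_ge_zero order_trans)
    finally show ?thesis using l(2) by (simp add: divide_right_mono mult.assoc)
  qed
  have f1b: "\<bar>f1 s\<bar> \<le> 2 / l" for s unfolding f1_def using q(5)[of "l * s"] l(2)
    by (simp add: divide_right_mono)
  have f2b: "\<bar>f2 s\<bar> \<le> 1" for s unfolding f2_def by (rule q(6))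
  define P where "P z = \<theta> z * f (z \<bullet> a)" for z
  define G where "G z = \<theta> z *\<^sub>R (f1 (z \<bullet> a) *\<^sub>R a) + f (z \<bullet> a) *\<^sub>R G0 z" for z
  define H where "H z v = \<theta> z *\<^sub>R (f1 (z \<bullet> a) *\<^sub>R 0 + (f2 (z \<bullet> a) * (a \<bullet> v)) *\<^sub>R a) +
     (G0 z \<bullet> v) *\<^sub>R (f1 (z \<bullet> a) *\<^sub>R a) + f (z \<bullet> a) *\<^sub>R H0 z v + ((f1 (z \<bullet> a) *\<^sub>R a) \<bullet> v) *\<^sub>R G0 z" for z v
  define F where "F z = \<theta> z * f2 (z \<bullet> a)" for z
  have CP: "C2 P G H"
    unfolding P_def G_def H_def
    by (rule C2_mult[OF \<theta>(1) C2_compose[OF C2_inner f f1 f2]])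
  have P0: "P z = 0" if "z \<notin> K" for z using K(3)[OF that] by (simp add: P_def)
  note supp = C2_compact_support(1,2)[OF CP K(1) P0]
  have bP: "\<bar>P z\<bar> \<le> \<epsilon>" for z
  proof (cases "z \<in> K")
    case True
    have "\<bar>P z\<bar> \<le> 1 * (2 * R * norm a / l)"
      unfolding P_def abs_mult using \<theta>(2,3)[of z] fb[OF True] by (intro mult_mono) auto
    also have "\<dots> \<le> Q / l" using l(2) M R by (simp add: Q_def divide_right_mono)
    finally show ?thesis using Ql by linarith
  qed (use P0 assms in auto)
  have bG: "norm (G z) \<le> \<epsilon>" for z
  proof (cases "z \<in> K")
    case True
    have "norm (G z) \<le> \<bar>\<theta> z\<bar> * (\<bar>f1 (z \<bullet> a)\<bar> * norm a) + \<bar>f (z \<bullet> a)\<bar> * norm (G0 z)"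
      unfolding G_def by (rule norm_triangle_le) (simp add: abs_mult)
    also have "\<dots> \<le> 1 * (2 / l * norm a) + 2 * R * norm a / l * M"
      using \<theta>(2,3)[of z] fb[OF True] f1b[of "z \<bullet> a"] M R l(2) by (intro add_mono mult_mono) auto
    also have "\<dots> = (2 * norm a + 2 * R * norm a * M) / l" by (simp add: add_divide_distrib)
    also have "\<dots> \<le> Q / l" using l(2) M R by (simp add: Q_def divide_right_mono)
    finally show ?thesis using Ql by linarith
  qed (use supp assms in auto)
  have bH: "norm (H z v - (F z * (a \<bullet> v)) *\<^sub>R a) \<le> \<epsilon> * norm v" for z v
  proof (cases "z \<in> K")
    case True
    have "H z v - (F z * (a \<bullet> v)) *\<^sub>R a =
       (G0 z \<bullet> v) *\<^sub>R (f1 (z \<bullet> a) *\<^sub>R a) + f (z \<bullet> a) *\<^sub>R H0 z v + ((f1 (z \<bullet> a) *\<^sub>R a) \<bullet> v) *\<^sub>R G0 z"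
      by (simp add: H_def F_def)
    also have "norm \<dots> \<le> \<bar>G0 z \<bullet> v\<bar> * (\<bar>f1 (z \<bullet> a)\<bar> * norm a) + \<bar>f (z \<bullet> a)\<bar> * norm (H0 z v)
        + \<bar>f1 (z \<bullet> a)\<bar> * \<bar>a \<bullet> v\<bar> * norm (G0 z)"
      by (intro norm_triangle_le add_mono) (auto simp: abs_mult)
    also have "\<dots> \<le> (M * norm v) * (2 / l * norm a) + (2 * R * norm a / l) * (M * norm v)
        + 2 / l * (norm a * norm v) * M"
    proof -
      have "\<bar>G0 z \<bullet> v\<bar> \<le> M * norm v"
        using Cauchy_Schwarz_ineq2[of "G0 z" v] M(2)[of z] by (meson mult_right_mono norm_ge_zero order_trans)
      then show ?thesis
        using fb[OF True] f1b[of "z \<bullet> a"] M R l(2) Cauchy_Schwarz_ineq2[of a v]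
        by (intro add_mono mult_mono) auto
    qed
    also have "\<dots> = (4 * norm a * M + 2 * R * norm a * M) / l * norm v"
      by (simp add: add_divide_distrib ring_distribs mult_ac)
    also have "\<dots> \<le> Q / l * norm v"
      using l(2) M R by (intro mult_right_mono divide_right_mono) (auto simp: Q_def)
    also have "\<dots> \<le> \<epsilon> * norm v" using Ql by (intro mult_right_mono) auto
    finally show ?thesis .
  qed (use supp assms K in \<open>auto simp: F_def\<close>)
  have bF: "\<bar>F z\<bar> \<le> 1" for z
    unfolding F_def abs_mult using \<theta>(2,3)[of z] f2b[of "z \<bullet> a"] by (intro mult_le_one) auto
  have cF: "continuous_on UNIV F" unfolding F_def
    by (intro continuous_intros C2_D(5)[OF \<theta>(1)] continuous_on_compose2[OF f2]) auto
  define S1 where "S1 = {z. F z > 1 - \<epsilon>}"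
  define S2 where "S2 = {z. F z < - 1 + \<epsilon>}"
  have op: "open S1" "open S2" unfolding S1_def S2_def
    by (intro open_Collect_less cF continuous_intros)+
  have SK: "S1 \<subseteq> K" "S2 \<subseteq> K" using K(3) assms(5) by (force simp: S1_def S2_def F_def)+
  then have SS: "S1 \<subseteq> S" "S2 \<subseteq> S" using K(2) by auto
  have disj: "S1 \<inter> S2 = {}" using assms(5) by (auto simp: S1_def S2_def)
  have lm: "S1 \<in> lmeasurable" "S2 \<in> lmeasurable"
    using op SS bounded_subset[OF assms(2)] by (auto intro!: lmeasurable_open)
  define w where "w = (pi / (l * (a \<bullet> a))) *\<^sub>R a"
  have wl: "l * ((z + w) \<bullet> a) = l * (z \<bullet> a) + pi" for z
    using l(2) assms(3) by (simp add: w_def inner_add_left ring_distribs)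
  have "norm w = pi / (l * norm a)"
    using l(2) assms(3) by (simp add: w_def dot_square_norm power2_eq_square)
  also have "\<dots> < e"
  proof -
    have "2 * pi \<le> l * (norm a * e)"
      using l(4) assms(3) e(1) by (simp add: pos_divide_le_eq)
    then have "2 * pi \<le> e * (l * norm a)" by (simp add: mult_ac)
    then have "pi < e * (l * norm a)" using pi_gt_zero by linarith
    then show ?thesis using l(2) assms(3) by (simp add: pos_divide_less_eq)
  qed
  finally have nw: "norm w < e" .
  have f2w: "f2 ((z + w) \<bullet> a) = - f2 (z \<bullet> a)" for z unfolding f2_def wl q(7) ..
  have h1: "measure lebesgue S1 \<le> measure lebesgue S / 2"
  proof (rule half_measure[OF S lm(1) SS(1)])
    fix z assume z: "z \<in> S1"
    then have "\<theta> z * f2 (z \<bullet> a) > 0" using assms(5) by (simp add: S1_def F_def)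
    then have "f2 (z \<bullet> a) > 0" using \<theta>(2)[of z] by (simp add: zero_less_mult_iff)
    then have "F (z + w) \<le> 0" unfolding F_def f2w using \<theta>(2) by simp
    then have "z + w \<notin> S1" using assms(5) by (simp add: S1_def)
    then show "z + w \<in> S - S1" using e(2)[of z w] nw SK z by auto
  qed
  have h2: "measure lebesgue S2 \<le> measure lebesgue S / 2"
  proof (rule half_measure[OF S lm(2) SS(2)])
    fix z assume z: "z \<in> S2"
    then have "\<theta> z * f2 (z \<bullet> a) < 0" using assms(5) by (simp add: S2_def F_def)
    then have "f2 (z \<bullet> a) < 0" using \<theta>(2)[of z] by (simp add: mult_less_0_iff)
    then have "F (z + w) \<ge> 0" unfolding F_def f2w using \<theta>(2) by (simp add: mult_nonneg_nonpos)
    then have "z + w \<notin> S2" using assms(5) by (simp add: S2_def)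
    then show "z + w \<in> S - S2" using e(2)[of z w] nw SK z by auto
  qed
  define E where "E = {z \<in> C. \<bar>cos (l * (z \<bullet> a))\<bar> \<le> r}"
  have "closed {z. \<bar>cos (l * (z \<bullet> a))\<bar> \<le> r}" by (intro closed_Collect_le continuous_intros)
  then have "compact E" unfolding E_def
    using compact_Int_closed[OF C(1)] by (simp add: Collect_conj_eq)
  then have E: "E \<in> lmeasurable" by (rule lmeasurable_compact)
  have mE: "measure lebesgue E \<le> \<epsilon> / 2"
  proof -
    have "m * measure lebesgue E \<le> measure lebesgue S" using layer[OF l(1)] by (simp add: E_def)
    also have "\<dots> \<le> m * (\<epsilon> / 2)" using m assms(4) by (simp add: field_simps)
    finally show ?thesis using m(2) by simp
  qed
  have "S - (S1 \<union> S2) \<subseteq> (S - C) \<union> E"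
  proof
    fix z assume z: "z \<in> S - (S1 \<union> S2)"
    show "z \<in> (S - C) \<union> E"
    proof (rule ccontr)
      assume n: "z \<notin> (S - C) \<union> E"
      then have "z \<in> C" "\<bar>cos (l * (z \<bullet> a))\<bar> > r" using z by (auto simp: E_def)
      then have "\<bar>F z\<bar> > 1 - \<epsilon>" using q(8) \<theta>(4) by (simp add: F_def f2_def)
      then show False using z by (auto simp: S1_def S2_def)
    qed
  qed
  then have "measure lebesgue (S - (S1 \<union> S2)) \<le> measure lebesgue ((S - C) \<union> E)"
    using S lm by (intro measure_mono_fmeasurable fmeasurable.Un[OF C(3) E]) auto
  also have "\<dots> \<le> measure lebesgue (S - C) + measure lebesgue E"
    using C(3) E by (intro measure_Un_le) (auto simp: fmeasurable_def)
  finally have rest: "measure lebesgue (S - (S1 \<union> S2)) \<le> \<epsilon>" using C(4) mE by linarith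
  show ?thesis
    by (rule that[OF CP K(1,2) P0 bP bG bH bF op SS disj h1 h2 rest]) (auto simp: S1_def S2_def)
qed

section \<open>Oscillations in the directions of the wave cone\<close>

text \<open>For the derivative \<open>L\<close> of a pair \<open>(u, v)\<close> at a point this is the pair \<open>[Du, v\<^sub>t]\<close>, on which the
differential inclusion is imposed.\<close>

definition field ::
  "((real^'n) \<times> real \<Rightarrow> (real^'m) \<times> (real^'n^'m)) \<Rightarrow> (real^'n^'m) \<times> (real^'n^'m)" where
  "field L = ((\<chi> i k. fst (L (e_x k)) $ i), snd (L e_t))"

text \<open>The admissible changes of \<open>(u, v)\<close>: they respect \<open>u\<^sup>i = div v\<^sup>i\<close> and are uniformly small together with the
time derivative of the first component. The latter keeps \<open>u\<^sub>t\<close> bounded through infinitely many steps.\<close>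

definition perturbation ::
  "((real^'n) \<times> real) set \<Rightarrow> real \<Rightarrow> ((real^'n) \<times> real \<Rightarrow> (real^'m) \<times> (real^'n^'m)) \<Rightarrow>
    ((real^'n) \<times> real \<Rightarrow> (real^'n) \<times> real \<Rightarrow> (real^'m) \<times> (real^'n^'m)) \<Rightarrow> bool" where
  "perturbation S \<epsilon> y y' \<longleftrightarrow> C1_compact S y y' \<and>
     (\<forall>z i. fst (y z) $ i = (\<Sum>k\<in>UNIV. snd (y' z (e_x k)) $ i $ k)) \<and>
     (\<forall>z. norm (y z) \<le> \<epsilon> \<and> norm (fst (y' z e_t)) \<le> \<epsilon>)"

text \<open>The directions in which the field \<open>[Du, v\<^sub>t]\<close> can oscillate.\<close>

definition wave_cone :: "((real^'n^'m) \<times> (real^'n^'m)) set" where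
  "wave_cone = {(outer p \<alpha>, b) | p \<alpha> b. \<alpha> \<noteq> 0 \<and> (\<forall>i. b $ i \<bullet> \<alpha> = 0)}"

lemma norm_vec_le_sum: "norm (x :: 'a::real_normed_vector^'m) \<le> (\<Sum>i\<in>UNIV. norm (x $ i))"
  unfolding norm_vec_def by (rule L2_set_le_sum) auto

lemma norm_vec_leI:
  fixes x :: "'a::real_normed_vector^'m"
  assumes "\<And>i. norm (x $ i) \<le> c i" shows "norm x \<le> (\<Sum>i\<in>UNIV. c i)"
  using norm_vec_le_sum[of x] sum_mono[of UNIV "\<lambda>i. norm (x $ i)" c] assms by fastforce

lemma has_derivative_vec_lambda:
  fixes f :: "'i::finite \<Rightarrow> 'a::real_normed_vector \<Rightarrow> 'b::euclidean_space"
  assumes "\<And>i. (f i has_derivative f' i) (at z)"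
  shows "((\<lambda>z. \<chi> i. f i z) has_derivative (\<lambda>v. \<chi> i. f' i v)) (at z)"
proof -
  have bl: "bounded_linear (\<lambda>v. \<chi> i. f' i v)"
  proof (rule bounded_linear_intro[where K = "\<Sum>i\<in>UNIV. onorm (f' i)"])
    have b: "bounded_linear (f' i)" for i using assms by (rule has_derivative_bounded_linear)
    show "(\<chi> i. f' i (x + y)) = (\<chi> i. f' i x) + (\<chi> i. f' i y)" for x y
      by (simp add: vec_eq_iff linear_add[OF bounded_linear.linear[OF b]])
    show "(\<chi> i. f' i (r *\<^sub>R x)) = r *\<^sub>R (\<chi> i. f' i x)" for r x
      by (simp add: vec_eq_iff linear_scale[OF bounded_linear.linear[OF b]])
    show "norm (\<chi> i. f' i x) \<le> norm x * (\<Sum>i\<in>UNIV. onorm (f' i))" for x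
      by (rule order_trans[OF norm_vec_le_sum])
        (auto simp: sum_distrib_left mult.commute[of "norm x"] intro!: sum_mono onorm b)
  qed
  show ?thesis
    unfolding has_derivative_within
  proof (intro conjI bl)
    show "((\<lambda>y. (1 / norm (y - z)) *\<^sub>R ((\<chi> i. f i y) - ((\<chi> i. f i z) + (\<chi> i. f' i (y - z))))) \<longlongrightarrow> 0) (at z)"
      by (rule vec_tendstoI) (use assms in \<open>simp add: has_derivative_within\<close>)
  qed
qed

lemma outer_scaleR: "outer (c *\<^sub>R p) a = outer p (c *\<^sub>R a)"
  by (simp add: outer_def vec_eq_iff)

lemma inner_e_x: "x \<bullet> e_x k = fst x $ k"
  by (simp add: e_x_def inner_prod_def inner_axis)

lemma norm_e_x: "norm (e_x k) = 1" and norm_e_t: "norm e_t = 1"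
  by (simp_all add: e_x_def e_t_def norm_prod_def)

text \<open>Let \<open>\<bar>\<alpha>\<bar> = 1\<close> and let \<open>P\<close> be the profile for the space-time direction \<open>a = (\<alpha>, s)\<close>. Put
\<open>\<phi> = (\<partial>\<^sub>\<alpha> P) p\<close> and \<open>\<psi>\<^sup>i = (\<partial>\<^sub>\<alpha> P) \<beta>\<^sup>i - (\<partial>\<^sub>\<beta> P) \<alpha> + P p\<^sup>i \<alpha>\<close> with \<open>\<beta> = \<beta>\<^sup>i\<close> in the middle term. The first two
terms of \<open>\<psi>\<^sup>i\<close> are the divergence of a skew matrix field, hence free of divergence, and the
third gives \<open>div \<psi>\<^sup>i = \<phi>\<^sup>i\<close> exactly, also where the cutoff varies. As the Hessian of \<open>P\<close> is
nearly \<open>F a \<otimes> a\<close>, the spatial derivative of \<open>\<phi>\<close> is nearly \<open>F p \<otimes> \<alpha>\<close> and the time derivative of \<open>\<psi>\<^sup>i\<close> is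
nearly \<open>F s \<beta>\<^sup>i\<close>, because \<open>\<beta>\<^sup>i \<bullet> \<alpha> = 0\<close>.

Only the product \<open>s \<beta>\<^sup>i = b\<^sup>i\<close> is prescribed. Therefore \<open>s\<close> can be taken so small that the time derivative of
\<open>\<phi>\<close>, which is nearly \<open>F s p\<close>, is at most \<open>\<epsilon>\<close>; the vectors \<open>\<beta>\<^sup>i\<close> then become large, but they are fixed
before the accuracy of the profile is chosen.\<close>

proposition wave_cone_oscillation:
  fixes S :: "((real^'n) \<times> real) set" and \<gamma> :: "(real^'n^'m) \<times> (real^'n^'m)"
  assumes "\<gamma> \<in> wave_cone" "open S" "bounded S" "0 < \<epsilon>"
  obtains y y' F S1 S2 where "perturbation S \<epsilon> y y'"
    "\<And>z. norm (field (y' z) - F z *\<^sub>R \<gamma>) \<le> \<epsilon>" "\<And>z. \<bar>F z\<bar> \<le> 1"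
    "open S1" "open S2" "S1 \<subseteq> S" "S2 \<subseteq> S" "S1 \<inter> S2 = {}"
    "measure lebesgue S1 \<le> measure lebesgue S / 2" "measure lebesgue S2 \<le> measure lebesgue S / 2"
    "measure lebesgue (S - (S1 \<union> S2)) \<le> \<epsilon>"
    "\<And>z. z \<in> S1 \<Longrightarrow> F z > 1 - \<epsilon>" "\<And>z. z \<in> S2 \<Longrightarrow> F z < - 1 + \<epsilon>"
proof -
  obtain p0 \<alpha>0 b where g0: "\<gamma> = (outer p0 \<alpha>0, b)" "\<alpha>0 \<noteq> 0" "\<And>i. b $ i \<bullet> \<alpha>0 = 0"
    using assms(1) unfolding wave_cone_def by blast
  define \<alpha> where "\<alpha> = (1 / norm \<alpha>0) *\<^sub>R \<alpha>0"
  define p where "p = norm \<alpha>0 *\<^sub>R p0"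
  have g: "\<gamma> = (outer p \<alpha>, b)" "norm \<alpha> = 1" "\<And>i. b $ i \<bullet> \<alpha> = 0"
    using g0 by (simp_all add: \<alpha>_def p_def outer_scaleR)
  have aa: "\<alpha> \<bullet> \<alpha> = 1" using g(2) by (simp add: dot_square_norm)
  define s where "s = min 1 (\<epsilon> / (2 * (1 + norm p)))"
  have n1: "1 + norm p > 0" by (simp add: add_pos_nonneg)
  have s: "s > 0" "s \<le> 1" using assms(4) n1 by (auto simp: s_def)
  have "s * norm p \<le> \<epsilon> / (2 * (1 + norm p)) * norm p"
    by (intro mult_right_mono) (auto simp: s_def)
  also have "\<dots> \<le> \<epsilon> / 2" using assms(4) n1 by (simp add: field_simps)
  finally have sp: "s * norm p \<le> \<epsilon> / 2" .
  define \<beta> where "\<beta> i = (1 / s) *\<^sub>R (b $ i)" for i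
  have \<beta>: "\<beta> i \<bullet> \<alpha> = 0" "s *\<^sub>R \<beta> i = b $ i" for i using g(3) s by (auto simp: \<beta>_def)
  \<comment> \<open>\<open>N\<close> collects the factors by which the accuracy \<open>d\<close> of the profile is multiplied in the estimates below.\<close>
  define N where "N = 1 + norm p + (\<Sum>i\<in>UNIV. 2 * norm (\<beta> i) + \<bar>p $ i\<bar>) + (\<Sum>i\<in>UNIV. \<Sum>k\<in>(UNIV::'n set). \<bar>p $ i\<bar>)"
  have sumpos: "(\<Sum>i\<in>UNIV. 2 * norm (\<beta> i) + \<bar>p $ i\<bar>) \<ge> 0" "(\<Sum>i\<in>UNIV. \<Sum>k\<in>(UNIV::'n set). \<bar>p $ i\<bar>) \<ge> 0"
    by (auto intro!: sum_nonneg)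
  then have N: "N \<ge> 1" "norm p \<le> N" "norm p + (\<Sum>i\<in>UNIV. 2 * norm (\<beta> i) + \<bar>p $ i\<bar>) \<le> N"
    "(\<Sum>i\<in>UNIV. \<Sum>k\<in>(UNIV::'n set). \<bar>p $ i\<bar>) + (\<Sum>i\<in>UNIV. 2 * norm (\<beta> i) + \<bar>p $ i\<bar>) \<le> N"
    unfolding N_def by (auto simp: add_nonneg_nonneg)
  define d where "d = min (1 / 2) (\<epsilon> / (2 * N))"
  have d: "0 < d" "d < 1" using assms(4) N by (auto simp: d_def)
  have "d * N \<le> \<epsilon> / (2 * N) * N" using N by (intro mult_right_mono) (auto simp: d_def)
  then have dN: "d * N \<le> \<epsilon> / 2" using N by simp
  have "d * 1 \<le> d * N" using N d by (intro mult_left_mono) auto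
  then have de: "d \<le> \<epsilon>" using dN assms(4) by simp
  define a where "a = (\<alpha>, s)"
  have a0: "a \<noteq> 0" using s by (simp add: a_def prod_eq_iff)
  obtain P G H F K S1 S2 where P: "C2 P G H" "compact K" "K \<subseteq> S" "\<And>z. z \<notin> K \<Longrightarrow> P z = 0"
    "\<And>z. \<bar>P z\<bar> \<le> d" "\<And>z. norm (G z) \<le> d"
    "\<And>z v. norm (H z v - (F z * (a \<bullet> v)) *\<^sub>R a) \<le> d * norm v" and F: "\<And>z. \<bar>F z\<bar> \<le> 1"
    and S12: "open S1" "open S2" "S1 \<subseteq> S" "S2 \<subseteq> S" "S1 \<inter> S2 = {}"
    "measure lebesgue S1 \<le> measure lebesgue S / 2" "measure lebesgue S2 \<le> measure lebesgue S / 2"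
    "measure lebesgue (S - (S1 \<union> S2)) \<le> d"
    "\<And>z. z \<in> S1 \<Longrightarrow> F z > 1 - d" "\<And>z. z \<in> S2 \<Longrightarrow> F z < - 1 + d"
    using oscillating_profile[OF assms(2,3) a0 d] by metis
  define A :: "(real^'n) \<times> real" where "A = (\<alpha>, 0)"
  define B :: "'m \<Rightarrow> (real^'n) \<times> real" where "B i = (\<beta> i, 0)" for i
  have nA: "norm A = 1" and nB: "norm (B i) = norm (\<beta> i)" for i
    using g(2) by (simp_all add: A_def B_def norm_prod_def)
  have aA: "a \<bullet> A = 1" and aB: "a \<bullet> B i = 0" and aet: "a \<bullet> e_t = s" and aex: "a \<bullet> e_x k = \<alpha> $ k" for i k
  proof -
    show "a \<bullet> A = 1" by (simp add: a_def A_def aa)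
    show "a \<bullet> B i = 0" using \<beta>(1)[of i] by (simp add: a_def B_def inner_commute)
    show "a \<bullet> e_t = s" by (simp add: a_def e_t_def)
    show "a \<bullet> e_x k = \<alpha> $ k" by (simp add: a_def inner_e_x)
  qed
  have HA: "\<bar>H z v \<bullet> A - F z * (a \<bullet> v)\<bar> \<le> d * norm v"
   and HB: "\<bar>H z v \<bullet> B i\<bar> \<le> d * norm v * norm (\<beta> i)" for z v i
  proof -
    have "H z v \<bullet> A - F z * (a \<bullet> v) = (H z v - (F z * (a \<bullet> v)) *\<^sub>R a) \<bullet> A"
      by (simp add: inner_diff_left aA)
    also have "\<bar>\<dots>\<bar> \<le> d * norm v" using Cauchy_Schwarz_ineq2[of "H z v - (F z * (a \<bullet> v)) *\<^sub>R a" A] P(7)[of z v] nA by simp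
    finally show "\<bar>H z v \<bullet> A - F z * (a \<bullet> v)\<bar> \<le> d * norm v" .
    have "H z v \<bullet> B i = (H z v - (F z * (a \<bullet> v)) *\<^sub>R a) \<bullet> B i"
      by (simp add: inner_diff_left aB)
    also have "\<bar>\<dots>\<bar> \<le> norm (H z v - (F z * (a \<bullet> v)) *\<^sub>R a) * norm (\<beta> i)"
      using Cauchy_Schwarz_ineq2[of _ "B i"] nB by metis
    also have "\<dots> \<le> d * norm v * norm (\<beta> i)" by (intro mult_right_mono P) auto
    finally show "\<bar>H z v \<bullet> B i\<bar> \<le> d * norm v * norm (\<beta> i)" .
  qed
  have GA: "\<bar>G z \<bullet> v\<bar> \<le> d * norm v" for z v
    using Cauchy_Schwarz_ineq2[of "G z" v] P(6)[of z] by (meson mult_right_mono norm_ge_zero order_trans)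
  define y where "y z = ((G z \<bullet> A) *\<^sub>R p,
     \<chi> i. (G z \<bullet> A) *\<^sub>R \<beta> i - (G z \<bullet> B i) *\<^sub>R \<alpha> + (P z * p $ i) *\<^sub>R \<alpha>)" for z
  define y' where "y' z v = ((H z v \<bullet> A) *\<^sub>R p,
     \<chi> i. (H z v \<bullet> A) *\<^sub>R \<beta> i - (H z v \<bullet> B i) *\<^sub>R \<alpha> + ((G z \<bullet> v) * p $ i) *\<^sub>R \<alpha>)" for z v
  have C1y: "C1_compact S y y'"
    unfolding C1_compact_def C1_on_def
  proof (intro conjI ballI allI exI[of _ K])
    fix z v
    have hG: "((\<lambda>z. G z \<bullet> c) has_derivative (\<lambda>v. H z v \<bullet> c)) (at z)" for c
      by (intro bounded_linear.has_derivative[OF bounded_linear_inner_left] C2_D[OF P(1)])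
    show "(y has_derivative y' z) (at z)"
      unfolding y_def[abs_def] y'_def[abs_def]
    proof (intro has_derivative_Pair has_derivative_vec_lambda)
      show "((\<lambda>z. (G z \<bullet> A) *\<^sub>R p) has_derivative (\<lambda>v. (H z v \<bullet> A) *\<^sub>R p)) (at z)"
        by (intro bounded_linear.has_derivative[OF bounded_linear_scaleR_left] hG)
      show "((\<lambda>z. (G z \<bullet> A) *\<^sub>R \<beta> i - (G z \<bullet> B i) *\<^sub>R \<alpha> + (P z * p $ i) *\<^sub>R \<alpha>) has_derivative
         (\<lambda>v. (H z v \<bullet> A) *\<^sub>R \<beta> i - (H z v \<bullet> B i) *\<^sub>R \<alpha> + ((G z \<bullet> v) * p $ i) *\<^sub>R \<alpha>)) (at z)" for i
        by (intro has_derivative_add has_derivative_diff hG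
             bounded_linear.has_derivative[OF bounded_linear_scaleR_left]
             bounded_linear.has_derivative[OF bounded_linear_mult_left] C2_D[OF P(1)])
    qed
    show "continuous_on UNIV (\<lambda>z. y' z v)"
      unfolding y'_def
      by (intro continuous_on_Pair continuous_on_vec_lambda continuous_on_add continuous_on_diff
          continuous_on_scaleR continuous_on_mult continuous_on_inner continuous_on_const C2_D[OF P(1)])
    show "compact K" "K \<subseteq> S" by fact+
    show "z \<notin> K \<longrightarrow> y z = 0"
    proof
      assume "z \<notin> K"
      then have "P z = 0" "G z = 0"
        using P(4) C2_compact_support(1)[OF P(1,2,4)] by blast+
      then have "y z = (0, \<chi> i. 0)" by (simp add: y_def)
      then show "y z = 0" by (simp add: prod_eq_iff vec_eq_iff)
    qed
  qed
  have div: "fst (y z) $ i = (\<Sum>k\<in>UNIV. snd (y' z (e_x k)) $ i $ k)" for z i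
  proof -
    have X: "(\<Sum>k\<in>UNIV. (H z (e_x k) \<bullet> c) * e $ k) = H z c \<bullet> (e, 0)" for c :: "(real^'n) \<times> real" and e
    proof -
      have "H z (e_x k) \<bullet> c = fst (H z c) $ k" for k
        using C2_symmetric[OF P(1), of z "e_x k" c] by (simp add: inner_e_x)
      then show ?thesis by (simp only:) (simp add: inner_prod_def inner_vec_def)
    qed
    have Y: "(\<Sum>k\<in>UNIV. (G z \<bullet> e_x k) * \<alpha> $ k) = G z \<bullet> A"
      unfolding inner_e_x by (simp add: A_def inner_prod_def inner_vec_def)
    have "(\<Sum>k\<in>UNIV. snd (y' z (e_x k)) $ i $ k) =
      (\<Sum>k\<in>UNIV. (H z (e_x k) \<bullet> A) * \<beta> i $ k) - (\<Sum>k\<in>UNIV. (H z (e_x k) \<bullet> B i) * \<alpha> $ k)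
       + p $ i * (\<Sum>k\<in>UNIV. (G z \<bullet> e_x k) * \<alpha> $ k)"
      by (simp add: y'_def sum.distrib sum_subtractf sum_distrib_left mult_ac)
    also have "\<dots> = H z A \<bullet> B i - H z (B i) \<bullet> A + p $ i * (G z \<bullet> A)"
      unfolding X Y by (simp add: A_def B_def)
    also have "\<dots> = p $ i * (G z \<bullet> A)" using C2_symmetric[OF P(1), of z A "B i"] by simp
    finally show ?thesis by (simp add: y_def mult.commute)
  qed
  have bound: "norm (y z) \<le> \<epsilon>" for z
  proof -
    have "norm ((G z \<bullet> A) *\<^sub>R \<beta> i - (G z \<bullet> B i) *\<^sub>R \<alpha> + (P z * p $ i) *\<^sub>R \<alpha>) \<le> d * (2 * norm (\<beta> i) + \<bar>p $ i\<bar>)" for i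
    proof -
      have "norm ((G z \<bullet> A) *\<^sub>R \<beta> i - (G z \<bullet> B i) *\<^sub>R \<alpha> + (P z * p $ i) *\<^sub>R \<alpha>)
          \<le> \<bar>G z \<bullet> A\<bar> * norm (\<beta> i) + \<bar>G z \<bullet> B i\<bar> * norm \<alpha> + \<bar>P z\<bar> * \<bar>p $ i\<bar> * norm \<alpha>"
        by (intro norm_triangle_le add_mono order_trans[OF norm_triangle_ineq4]) (auto simp: abs_mult)
      also have "\<dots> \<le> (d * 1) * norm (\<beta> i) + (d * norm (\<beta> i)) * 1 + d * \<bar>p $ i\<bar> * 1"
        using GA[of z A] GA[of z "B i"] nA nB g(2) P(5)[of z] d by (intro add_mono mult_mono) auto
      finally show ?thesis by (simp add: algebra_simps)
    qed
    then have 1: "norm (snd (y z)) \<le> (\<Sum>i\<in>UNIV. d * (2 * norm (\<beta> i) + \<bar>p $ i\<bar>))"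
      unfolding y_def snd_conv by (intro norm_vec_leI) simp
    have 2: "norm (fst (y z)) \<le> d * norm p"
      using GA[of z A] nA by (simp add: y_def mult_right_mono)
    have "norm (y z) \<le> norm (fst (y z)) + norm (snd (y z))"
      by (metis norm_Pair_le prod.collapse)
    also have "\<dots> \<le> d * (norm p + (\<Sum>i\<in>UNIV. 2 * norm (\<beta> i) + \<bar>p $ i\<bar>))"
      using 1 2 by (simp add: sum_distrib_left distrib_left)
    also have "\<dots> \<le> d * N" using N d by (intro mult_left_mono) auto
    finally show ?thesis using dN assms(4) by linarith
  qed
  have bound_t: "norm (fst (y' z e_t)) \<le> \<epsilon>" for z
  proof -
    have "\<bar>H z e_t \<bullet> A\<bar> \<le> d + s"
    proof -
      have "\<bar>F z * s\<bar> \<le> s" using F[of z] s by (simp add: abs_mult mult_left_le_one_le)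
      then show ?thesis using HA[of z e_t] by (simp add: norm_e_t aet)
    qed
    then have "norm (fst (y' z e_t)) \<le> (d + s) * norm p"
      by (simp add: y'_def mult_right_mono)
    also have "\<dots> = d * norm p + s * norm p" by (simp add: distrib_right)
    also have "\<dots> \<le> d * N + \<epsilon> / 2" using N d sp by (intro add_mono mult_left_mono) auto
    finally show ?thesis using dN by linarith
  qed
  have close: "norm (field (y' z) - F z *\<^sub>R \<gamma>) \<le> \<epsilon>" for z
  proof -
    have "norm (((H z (e_x k) \<bullet> A) * p $ i) - F z * (p $ i * \<alpha> $ k)) \<le> d * \<bar>p $ i\<bar>" for i k
    proof -
      have "((H z (e_x k) \<bullet> A) * p $ i) - F z * (p $ i * \<alpha> $ k) = (H z (e_x k) \<bullet> A - F z * (a \<bullet> e_x k)) * p $ i"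
        by (simp add: aex algebra_simps)
      then show ?thesis using HA[of z "e_x k"] by (simp add: abs_mult norm_e_x mult_right_mono)
    qed
    then have 1: "norm (fst (field (y' z) - F z *\<^sub>R \<gamma>)) \<le> (\<Sum>i\<in>UNIV. \<Sum>k\<in>(UNIV::'n set). d * \<bar>p $ i\<bar>)"
      unfolding field_def y'_def g(1) outer_def
      by (intro norm_vec_leI) simp
    have "norm ((H z e_t \<bullet> A) *\<^sub>R \<beta> i - (H z e_t \<bullet> B i) *\<^sub>R \<alpha> + ((G z \<bullet> e_t) * p $ i) *\<^sub>R \<alpha> - F z *\<^sub>R (b $ i))
        \<le> d * (2 * norm (\<beta> i) + \<bar>p $ i\<bar>)" for i
    proof -
      have "(H z e_t \<bullet> A) *\<^sub>R \<beta> i - (H z e_t \<bullet> B i) *\<^sub>R \<alpha> + ((G z \<bullet> e_t) * p $ i) *\<^sub>R \<alpha> - F z *\<^sub>R (b $ i)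
        = (H z e_t \<bullet> A - F z * s) *\<^sub>R \<beta> i - (H z e_t \<bullet> B i) *\<^sub>R \<alpha> + ((G z \<bullet> e_t) * p $ i) *\<^sub>R \<alpha>"
        by (simp add: \<beta>(2)[symmetric] algebra_simps)
      also have "norm \<dots> \<le> \<bar>H z e_t \<bullet> A - F z * s\<bar> * norm (\<beta> i) + \<bar>H z e_t \<bullet> B i\<bar> * norm \<alpha> + \<bar>G z \<bullet> e_t\<bar> * \<bar>p $ i\<bar> * norm \<alpha>"
        by (intro norm_triangle_le add_mono order_trans[OF norm_triangle_ineq4]) (auto simp: abs_mult)
      also have "\<dots> \<le> (d * 1) * norm (\<beta> i) + (d * norm (\<beta> i)) * 1 + d * \<bar>p $ i\<bar> * 1"
        using HA[of z e_t] HB[of z e_t i] GA[of z e_t] g(2) d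
        by (intro add_mono mult_mono) (auto simp: norm_e_t aet)
      finally show ?thesis by (simp add: algebra_simps)
    qed
    then have 2: "norm (snd (field (y' z) - F z *\<^sub>R \<gamma>)) \<le> (\<Sum>i\<in>UNIV. d * (2 * norm (\<beta> i) + \<bar>p $ i\<bar>))"
      unfolding field_def y'_def g(1)
      by (intro norm_vec_leI) simp
    have "norm (field (y' z) - F z *\<^sub>R \<gamma>) \<le> norm (fst (field (y' z) - F z *\<^sub>R \<gamma>)) + norm (snd (field (y' z) - F z *\<^sub>R \<gamma>))"
      by (metis norm_Pair_le prod.collapse)
    also have "\<dots> \<le> d * ((\<Sum>i\<in>UNIV. \<Sum>k\<in>(UNIV::'n set). \<bar>p $ i\<bar>) + (\<Sum>i\<in>UNIV. 2 * norm (\<beta> i) + \<bar>p $ i\<bar>))"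
      using add_mono[OF 1 2] by (simp only: sum_distrib_left[symmetric] distrib_left[symmetric])
    also have "\<dots> \<le> d * N" using N d by (intro mult_left_mono) auto
    finally show ?thesis using dN assms(4) by linarith
  qed
  have "perturbation S \<epsilon> y y'"
    unfolding perturbation_def using C1y div bound bound_t by blast
  then show ?thesis
    by (rule that[OF _ close F S12(1-7)]) (use S12(8-10) de in \<open>fastforce+\<close>)
qed

text \<open>The convex integration scheme only sees the fields of perturbations, not the perturbations themselves.\<close>

definition perturbation_field where
  "perturbation_field S \<epsilon> w \<longleftrightarrow> (\<exists>y y'. perturbation S \<epsilon> y y' \<and> w = (\<lambda>z. field (y' z)))"

lemma field_add: "field (\<lambda>v. L v + L' v) = field L + field L'"
  by (simp add: field_def vec_eq_iff)

lemma perturbation_zero: "0 \<le> \<epsilon> \<Longrightarrow> perturbation S \<epsilon> (\<lambda>_. 0) (\<lambda>_ _. 0)"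
  unfolding perturbation_def by (simp add: C1_compact_zero)

lemma perturbation_add:
  assumes "perturbation S \<epsilon> y y'" "perturbation S \<delta> x x'"
  shows "perturbation S (\<epsilon> + \<delta>) (\<lambda>z. y z + x z) (\<lambda>z v. y' z v + x' z v)"
  using assms unfolding perturbation_def
  by (auto intro!: C1_compact_add norm_triangle_mono simp: sum.distrib)

lemma perturbation_mono:
  assumes "perturbation S \<epsilon> y y'" "S \<subseteq> T" "\<epsilon> \<le> \<delta>"
  shows "perturbation T \<delta> y y'"
  using assms C1_compact_mono unfolding perturbation_def by (meson order_trans)

lemma field_zero: "field (\<lambda>_. 0) = 0"
  by (simp add: field_def prod_eq_iff vec_eq_iff)

lemma perturbation_field_zero: "0 \<le> \<epsilon> \<Longrightarrow> perturbation_field S \<epsilon> (\<lambda>_. 0)"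
  unfolding perturbation_field_def
  by (rule exI[of _ "\<lambda>_. 0"], rule exI[of _ "\<lambda>_ _. 0"]) (simp add: perturbation_zero field_zero)

lemma perturbation_field_add:
  assumes "perturbation_field S \<epsilon> w" "perturbation_field S \<delta> x"
  shows "perturbation_field S (\<epsilon> + \<delta>) (\<lambda>z. w z + x z)"
proof -
  obtain y y' x1 x' where "perturbation S \<epsilon> y y'" "w = (\<lambda>z. field (y' z))"
    "perturbation S \<delta> x1 x'" "x = (\<lambda>z. field (x' z))"
    using assms unfolding perturbation_field_def by blast
  then show ?thesis unfolding perturbation_field_def
    by (intro exI[of _ "\<lambda>z. y z + x1 z"] exI[of _ "\<lambda>z v. y' z v + x' z v"])
       (simp add: perturbation_add field_add)
qed

lemma perturbation_field_mono:
  "perturbation_field S \<epsilon> w \<Longrightarrow> S \<subseteq> T \<Longrightarrow> \<epsilon> \<le> \<delta> \<Longrightarrow> perturbation_field T \<delta> w"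
  unfolding perturbation_field_def using perturbation_mono by blast

lemma perturbation_field_sum:
  fixes \<epsilon> :: real
  assumes "finite I" "\<And>i. i \<in> I \<Longrightarrow> perturbation_field S \<epsilon> (w i)" "0 \<le> \<epsilon>"
  shows "perturbation_field S (real (card I) * \<epsilon>) (\<lambda>z. \<Sum>i\<in>I. w i z)"
  using assms(1,2)
proof (induction I)
  case empty show ?case by (simp add: perturbation_field_zero)
next
  case (insert i I)
  then show ?case using perturbation_field_add[of S \<epsilon> "w i" "real (card I) * \<epsilon>" "\<lambda>z. \<Sum>i\<in>I. w i z"]
    by (simp add: algebra_simps)
qed

lemma perturbation_field_continuous:
  assumes "perturbation_field S \<epsilon> w" shows "continuous_on T w"
proof -
  obtain y y' where y: "C1_compact S y y'" "w = (\<lambda>z. field (y' z))"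
    using assms unfolding perturbation_field_def perturbation_def by blast
  note c = C1_compact_continuous_derivative[OF y(1), of T]
  have 1: "continuous_on T (\<lambda>z. \<chi> i k. fst (y' z (e_x k)) $ i)"
    by (rule continuous_on_vec_lambda, rule continuous_on_vec_lambda,
        rule continuous_on_component, rule continuous_on_fst, rule c)
  have 2: "continuous_on T (\<lambda>z. snd (y' z e_t))"
    by (rule continuous_on_snd, rule c)
  show ?thesis unfolding y(2) field_def by (rule continuous_on_Pair[OF 1 2])
qed

lemma perturbation_field_support:
  assumes "perturbation_field S \<epsilon> w"
  obtains K where "compact K" "K \<subseteq> S" "\<And>z. z \<notin> K \<Longrightarrow> w z = 0"
proof -
  obtain y y' where y: "C1_compact S y y'" "w = (\<lambda>z. field (y' z))"
    using assms unfolding perturbation_field_def perturbation_def by blast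
  obtain K where "compact K" "K \<subseteq> S" "\<And>z v. z \<notin> K \<Longrightarrow> y' z v = 0"
    using C1_compactE[OF y(1)] by metis
  moreover have "field (y' z) = 0" if "z \<notin> K" for z
  proof -
    have "y' z = (\<lambda>_. 0)" using \<open>\<And>z v. z \<notin> K \<Longrightarrow> y' z v = 0\<close> that by blast
    then show ?thesis by (simp add: field_zero)
  qed
  ultimately show ?thesis using that y(2) by blast
qed

section \<open>Laminates and the graph\<close>

lemma perturbation_field_outside:
  assumes "perturbation_field S \<epsilon> w" "z \<notin> S" shows "w z = 0"
  by (rule perturbation_field_support[OF assms(1)]) (use assms(2) in blast)

lemma integrable_continuous_bounded:
  fixes f :: "'a::euclidean_space \<Rightarrow> 'b::euclidean_space"
  assumes "open S" "bounded S" "continuous_on S f" "\<And>z. z \<in> S \<Longrightarrow> norm (f z) \<le> B"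
  shows "integrable (lebesgue_on S) f"
proof -
  have S: "S \<in> lmeasurable" using assms(1,2) by (simp add: lmeasurable_open)
  then interpret finite_measure "lebesgue_on S" by (rule finite_measure_lebesgue_on)
  show ?thesis
  proof (rule integrable_const_bound)
    show "AE z in lebesgue_on S. norm (f z) \<le> B" using assms(4) by (intro AE_I2) (simp add: space_restrict_space)
    show "f \<in> borel_measurable (lebesgue_on S)"
      by (rule continuous_imp_measurable_on_sets_lebesgue[OF assms(3)]) (use S in auto)
  qed
qed

lemma integral_const_lebesgue_on:
  assumes "S \<in> lmeasurable"
  shows "(LINT z|lebesgue_on S. (c::real)) = c * measure lebesgue S"
  using fmeasurableD[OF assms] by (simp add: measure_restrict_space space_restrict_space)

lemma integral_le_const_lebesgue_on:
  fixes f :: "'a::euclidean_space \<Rightarrow> real"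
  assumes "S \<in> lmeasurable" "integrable (lebesgue_on S) f" "\<And>z. z \<in> S \<Longrightarrow> f z \<le> c"
  shows "(LINT z|lebesgue_on S. f z) \<le> c * measure lebesgue S"
proof -
  interpret finite_measure "lebesgue_on S" using assms(1) by (rule finite_measure_lebesgue_on)
  have "(LINT z|lebesgue_on S. f z) \<le> (LINT z|lebesgue_on S. c)"
    by (rule integral_mono) (use assms in \<open>auto simp: space_restrict_space\<close>)
  then show ?thesis unfolding integral_const_lebesgue_on[OF assms(1)] .
qed

lemma integrable_lebesgue_on_subset:
  fixes f :: "'a::euclidean_space \<Rightarrow> 'b::euclidean_space"
  assumes "integrable (lebesgue_on S) f" "S \<in> sets lebesgue" "X \<in> sets lebesgue" "X \<subseteq> S"
  shows "integrable (lebesgue_on X) f"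
proof -
  have "integrable lebesgue (\<lambda>z. indicator S z *\<^sub>R f z)"
    using assms(1,2) by (subst (asm) integrable_restrict_space) auto
  then have "integrable lebesgue (\<lambda>z. indicator X z *\<^sub>R (indicator S z *\<^sub>R f z))"
    by (rule integrable_mult_indicator[OF assms(3)])
  moreover have "(\<lambda>z. indicator X z *\<^sub>R (indicator S z *\<^sub>R f z)) = (\<lambda>z. indicator X z *\<^sub>R f z)"
    using assms(4) by (auto simp: indicator_def fun_eq_iff)
  ultimately have "integrable lebesgue (\<lambda>z. indicator X z *\<^sub>R f z)" by (simp only:)
  then show ?thesis using assms(3) by (subst integrable_restrict_space) auto
qed

lemma integral_split3:
  fixes f :: "'a::euclidean_space \<Rightarrow> 'b::euclidean_space"
  assumes S: "S \<in> sets lebesgue" "A \<in> sets lebesgue" "B \<in> sets lebesgue" "A \<subseteq> S" "B \<subseteq> S" "A \<inter> B = {}"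
    and f: "integrable (lebesgue_on S) f"
  shows "(LINT z|lebesgue_on S. f z) = (LINT z|lebesgue_on A. f z) + (LINT z|lebesgue_on B. f z)
      + (LINT z|lebesgue_on (S - (A \<union> B)). f z)"
proof -
  define R where "R = S - (A \<union> B)"
  have R: "R \<in> sets lebesgue" using S by (auto simp: R_def)
  have i: "integrable lebesgue (\<lambda>z. indicator X z *\<^sub>R f z)" if "X \<in> sets lebesgue" "X \<subseteq> S" for X
    using integrable_lebesgue_on_subset[OF f S(1) that] that by (subst (asm) integrable_restrict_space) auto
  have "indicator S z *\<^sub>R f z = indicator A z *\<^sub>R f z + indicator B z *\<^sub>R f z + indicator R z *\<^sub>R f z" for z
    using S by (auto simp: R_def indicator_def)
  then have "(LINT z|lebesgue. indicator S z *\<^sub>R f z) =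
     (LINT z|lebesgue. indicator A z *\<^sub>R f z + indicator B z *\<^sub>R f z + indicator R z *\<^sub>R f z)"
    by simp
  also have "\<dots> = (LINT z|lebesgue. indicator A z *\<^sub>R f z) + (LINT z|lebesgue. indicator B z *\<^sub>R f z)
     + (LINT z|lebesgue. indicator R z *\<^sub>R f z)"
    using i[of A] i[of B] i[of R] S R by (simp add: R_def)
  finally show ?thesis using S R by (simp add: integral_restrict_space flip: R_def)
qed

text \<open>Arbitrarily small perturbations on \<open>S\<close> bring the mean distance of the field \<open>W\<close> from \<open>K\<close> down to \<open>c\<close>
without leaving \<open>\<Sigma>\<close>.\<close>

definition improvable ::
  "((real^'n^'m) \<times> (real^'n^'m)) set \<Rightarrow> ((real^'n^'m) \<times> (real^'n^'m)) set \<Rightarrow> real \<Rightarrow>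
    ((real^'n) \<times> real) set \<Rightarrow> ((real^'n) \<times> real \<Rightarrow> (real^'n^'m) \<times> (real^'n^'m)) \<Rightarrow> bool" where
  "improvable \<Sigma> K c S W \<longleftrightarrow> (\<forall>\<epsilon>>0. \<exists>w. perturbation_field S \<epsilon> w \<and> (\<forall>z\<in>S. W z + w z \<in> \<Sigma>) \<and>
        (LINT z|lebesgue_on S. infdist (W z + w z) K) \<le> c * measure lebesgue S)"

text \<open>The tolerance \<open>\<delta>\<close> makes the notion stable under small errors, so that one oscillation can be placed on top
of another although the oscillations are only approximately constant.\<close>

definition reachable ::
  "((real^'n^'m) \<times> (real^'n^'m)) set \<Rightarrow> ((real^'n^'m) \<times> (real^'n^'m)) set \<Rightarrow>
    (real^'n^'m) \<times> (real^'n^'m) \<Rightarrow> real \<Rightarrow> bool" where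
  "reachable \<Sigma> K \<eta> c \<longleftrightarrow> (\<exists>\<delta>>0. \<forall>S W. open S \<longrightarrow> bounded S \<longrightarrow> continuous_on S W \<longrightarrow>
     (\<forall>z\<in>S. norm (W z - \<eta>) < \<delta>) \<longrightarrow> improvable \<Sigma> K c S W)"

lemma reachableI:
  fixes \<Sigma> K :: "((real^'n^'m) \<times> (real^'n^'m)) set"
  assumes "\<delta> > 0" "\<And>S (W :: (real^'n) \<times> real \<Rightarrow> (real^'n^'m) \<times> (real^'n^'m)).
     \<lbrakk>open S; bounded S; continuous_on S W; \<forall>z\<in>S. norm (W z - \<eta>) < \<delta>\<rbrakk> \<Longrightarrow> improvable \<Sigma> K c S W"
  shows "reachable \<Sigma> K \<eta> c"
  unfolding reachable_def by (intro exI[of _ \<delta>] conjI allI impI assms)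

lemma improvable_mono:
  assumes "improvable \<Sigma> K c S W" "c \<le> c'" shows "improvable \<Sigma> K c' S W"
proof -
  have "c * measure lebesgue S \<le> c' * measure lebesgue S" using assms(2) by (intro mult_right_mono) auto
  then show ?thesis using assms(1) unfolding improvable_def by (meson order_trans)
qed

lemma reachable_mono:
  assumes "reachable \<Sigma> K \<eta> c" "c \<le> c'" shows "reachable \<Sigma> K \<eta> c'"
proof -
  from assms(1)[unfolded reachable_def] obtain \<delta> where d: "\<delta> > 0" and
    *: "\<forall>S W. open S \<longrightarrow> bounded S \<longrightarrow> continuous_on S W \<longrightarrow>
     (\<forall>z\<in>S. norm (W z - \<eta>) < \<delta>) \<longrightarrow> improvable \<Sigma> K c S W"
    by (elim exE conjE) (rule that)
  show ?thesis by (rule reachableI[OF d], rule improvable_mono[OF _ assms(2)], rule *[rule_format]) auto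
qed

lemma infdist_bounded_on:
  assumes "bounded \<Sigma>"
  obtains M where "M > 0" "\<And>x. x \<in> \<Sigma> \<Longrightarrow> infdist x K \<le> M"
proof (cases "\<Sigma> = {}")
  case False
  then obtain x0 where x0: "x0 \<in> \<Sigma>" by blast
  obtain B where B: "\<And>x y. x \<in> \<Sigma> \<Longrightarrow> y \<in> \<Sigma> \<Longrightarrow> dist x y \<le> B"
    using assms unfolding bounded_two_points by blast
  have "infdist x K \<le> \<bar>infdist x0 K + B\<bar> + 1" if "x \<in> \<Sigma>" for x
    using infdist_triangle[of x K x0] B[OF that x0] by linarith
  then show ?thesis by (intro that[of "\<bar>infdist x0 K + B\<bar> + 1"]) auto
qed (use that[of 1] in auto)

lemma reachable_base:
  fixes \<Sigma> K :: "((real^'n^'m) \<times> (real^'n^'m)) set"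
  assumes "open \<Sigma>" "bounded \<Sigma>" "\<eta> \<in> \<Sigma>" "infdist \<eta> K < c"
  shows "reachable \<Sigma> K \<eta> c"
proof -
  obtain e where e: "e > 0" "ball \<eta> e \<subseteq> \<Sigma>" using assms open_contains_ball by blast
  obtain M where M: "\<And>x. x \<in> \<Sigma> \<Longrightarrow> infdist x K \<le> M" using infdist_bounded_on[OF assms(2)] by blast
  define d where "d = min e (c - infdist \<eta> K)"
  show ?thesis
  proof (rule reachableI[of d])
    show "d > 0" using e assms by (simp add: d_def)
    fix S and W :: "(real^'n) \<times> real \<Rightarrow> (real^'n^'m) \<times> (real^'n^'m)"
    assume S: "open S" "bounded S" "continuous_on S W" "\<forall>z\<in>S. norm (W z - \<eta>) < d"
    have in\<Sigma>: "W z \<in> \<Sigma>" if "z \<in> S" for z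
      using S(4) that e(2) by (force simp: d_def dist_norm norm_minus_commute)
    have "infdist (W z) K \<le> c" if "z \<in> S" for z
      using S(4) that infdist_triangle[of "W z" K \<eta>] by (force simp: d_def dist_norm)
    moreover have "integrable (lebesgue_on S) (\<lambda>z. infdist (W z) K)"
      by (rule integrable_continuous_bounded[OF S(1,2), where B = M])
         (use S in\<Sigma> M in \<open>auto intro!: continuous_intros simp: infdist_nonneg\<close>)
    ultimately have "(LINT z|lebesgue_on S. infdist (W z) K) \<le> c * measure lebesgue S"
      using S by (intro integral_le_const_lebesgue_on lmeasurable_open)
    then show "improvable \<Sigma> K c S W" unfolding improvable_def using in\<Sigma>
      by (intro allI impI exI[of _ "\<lambda>_. 0"]) (auto simp: perturbation_field_zero)
  qed
qed

lemma wave_cone_scaleR: "\<gamma> \<in> wave_cone \<Longrightarrow> r *\<^sub>R \<gamma> \<in> wave_cone"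
proof -
  assume "\<gamma> \<in> wave_cone"
  then obtain p \<alpha> b where g: "\<gamma> = (outer p \<alpha>, b)" "\<alpha> \<noteq> 0" "\<forall>i. b $ i \<bullet> \<alpha> = 0"
    unfolding wave_cone_def by blast
  have "r *\<^sub>R \<gamma> = (outer (r *\<^sub>R p) \<alpha>, r *\<^sub>R b)" by (simp add: g(1) outer_def vec_eq_iff)
  then show ?thesis unfolding wave_cone_def using g(2,3) by auto
qed

text \<open>An oscillation in direction \<open>\<gamma>\<close> splits \<open>S\<close> into two open sets of at most half the measure, on which the
field is close to \<open>\<eta> + \<gamma>\<close> and to \<open>\<eta> - \<gamma>\<close>, and a small remainder. On the two sets the perturbations for the
end points are added; on the remainder the distance from \<open>K\<close> is merely bounded. The strict inequality
for \<open>c\<close> absorbs the remainder.\<close>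

proposition reachable_midpoint:
  fixes \<Sigma> K :: "((real^'n^'m) \<times> (real^'n^'m)) set"
  assumes \<Sigma>: "open \<Sigma>" "bounded \<Sigma>" and \<gamma>: "\<gamma> \<in> wave_cone"
    and seg: "\<And>t. \<bar>t\<bar> \<le> 1 \<Longrightarrow> \<eta> + t *\<^sub>R \<gamma> \<in> \<Sigma>"
    and r1: "reachable \<Sigma> K (\<eta> + \<gamma>) c1" and r2: "reachable \<Sigma> K (\<eta> - \<gamma>) c2"
    and c: "0 \<le> c1" "0 \<le> c2" "(c1 + c2) / 2 < c"
  shows "reachable \<Sigma> K \<eta> c"
proof -
  have "compact ((\<lambda>t. \<eta> + t *\<^sub>R \<gamma>) ` {-1..1})"
    by (intro compact_continuous_image continuous_intros) auto
  moreover have "(\<lambda>t. \<eta> + t *\<^sub>R \<gamma>) ` {-1..1} \<subseteq> \<Sigma>" using seg by (auto simp: abs_le_iff)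
  ultimately obtain e where e: "e > 0" "\<And>x w. x \<in> (\<lambda>t. \<eta> + t *\<^sub>R \<gamma>) ` {-1..1} \<Longrightarrow> norm w < e \<Longrightarrow> x + w \<in> \<Sigma>"
    using translate_into_open[OF _ \<Sigma>(1)] by blast
  obtain M where M: "M > 0" "\<And>x. x \<in> \<Sigma> \<Longrightarrow> infdist x K \<le> M" using infdist_bounded_on[OF \<Sigma>(2)] by blast
  from r1[unfolded reachable_def] obtain \<delta>1 where \<delta>1: "\<delta>1 > 0" and R1: "\<forall>S W. open S \<longrightarrow> bounded S \<longrightarrow> continuous_on S W \<longrightarrow>
     (\<forall>z\<in>S. norm (W z - (\<eta> + \<gamma>)) < \<delta>1) \<longrightarrow> improvable \<Sigma> K c1 S W"
    by (elim exE conjE) (rule that)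
  from r2[unfolded reachable_def] obtain \<delta>2 where \<delta>2: "\<delta>2 > 0" and R2: "\<forall>S W. open S \<longrightarrow> bounded S \<longrightarrow> continuous_on S W \<longrightarrow>
     (\<forall>z\<in>S. norm (W z - (\<eta> - \<gamma>)) < \<delta>2) \<longrightarrow> improvable \<Sigma> K c2 S W"
    by (elim exE conjE) (rule that)
  define d where "d = min e (min \<delta>1 \<delta>2) / 2"
  have d: "d > 0" "2 * d \<le> e" "2 * d \<le> \<delta>1" "2 * d \<le> \<delta>2" using e \<delta>1 \<delta>2 by (auto simp: d_def)
  show ?thesis
  proof (rule reachableI[OF d(1)], unfold improvable_def, intro allI impI)
    fix S and W :: "(real^'n) \<times> real \<Rightarrow> (real^'n^'m) \<times> (real^'n^'m)" and \<epsilon> :: real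
    assume S: "open S" "bounded S" "continuous_on S W" "\<forall>z\<in>S. norm (W z - \<eta>) < d" "\<epsilon> > 0"
    show "\<exists>w. perturbation_field S \<epsilon> w \<and> (\<forall>z\<in>S. W z + w z \<in> \<Sigma>) \<and>
        (LINT z|lebesgue_on S. infdist (W z + w z) K) \<le> c * measure lebesgue S"
  proof (cases "S = {}")
    case True
    have "(LINT z|lebesgue_on {}. infdist (W z + 0) K) = 0"
      by (subst integral_restrict_space) auto
    then show ?thesis using S(5) True
      by (intro exI[of _ "\<lambda>_. 0"]) (simp add: perturbation_field_zero)
  next
    case False
    have SL: "S \<in> lmeasurable" using S by (simp add: lmeasurable_open)
    have mS: "measure lebesgue S > 0"
      using open_not_negligible[OF S(1) False] SL negligible_iff_measure measure_nonneg
      by (metis order_le_less)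
    define gap where "gap = (c - (c1 + c2) / 2) * measure lebesgue S"
    have gap: "gap > 0" using mS c by (simp add: gap_def)
    define \<epsilon>' where "\<epsilon>' = min (\<epsilon> / 3) (min (gap / M) (d / (1 + norm \<gamma>)))"
    have n1: "1 + norm \<gamma> > 0" by (simp add: add_pos_nonneg)
    have \<epsilon>': "\<epsilon>' > 0" "\<epsilon>' \<le> \<epsilon> / 3"
      using S(5) gap M(1) d(1) n1 unfolding \<epsilon>'_def by (simp_all only: min_less_iff_conj divide_pos_pos min.cobounded1)
    have "\<epsilon>' \<le> gap / M" by (simp add: \<epsilon>'_def)
    then have M\<epsilon>: "M * \<epsilon>' \<le> gap" using M by (simp add: field_simps)
    have "\<epsilon>' \<le> d / (1 + norm \<gamma>)" by (simp add: \<epsilon>'_def)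
    then have d\<epsilon>: "\<epsilon>' + \<epsilon>' * norm \<gamma> \<le> d" using n1 by (simp add: field_simps)
    obtain y y' F S1 S2 where y: "perturbation S \<epsilon>' y y'" and cl: "\<And>z. norm (field (y' z) - F z *\<^sub>R \<gamma>) \<le> \<epsilon>'"
      and F: "\<And>z. \<bar>F z\<bar> \<le> 1" and S12: "open S1" "open S2" "S1 \<subseteq> S" "S2 \<subseteq> S" "S1 \<inter> S2 = {}"
      and m: "measure lebesgue S1 \<le> measure lebesgue S / 2" "measure lebesgue S2 \<le> measure lebesgue S / 2"
      "measure lebesgue (S - (S1 \<union> S2)) \<le> \<epsilon>'"
      and F12: "\<And>z. z \<in> S1 \<Longrightarrow> F z > 1 - \<epsilon>'" "\<And>z. z \<in> S2 \<Longrightarrow> F z < - 1 + \<epsilon>'"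
      using wave_cone_oscillation[OF \<gamma> S(1,2) \<epsilon>'(1)] by blast
    define w0 where "w0 z = field (y' z)" for z
    have w0: "perturbation_field S \<epsilon>' w0" unfolding perturbation_field_def w0_def using y by blast
    have cW: "continuous_on S (\<lambda>z. W z + w0 z)"
      by (intro continuous_on_add S perturbation_field_continuous[OF w0])
    have base: "W z + w0 z \<in> \<Sigma>" if "z \<in> S" for z
    proof -
      have "\<epsilon>' \<le> d" using d\<epsilon> mult_nonneg_nonneg[OF less_imp_le[OF \<epsilon>'(1)] norm_ge_zero[of \<gamma>]] by linarith
      then have "norm (W z - \<eta>) < d" "norm (w0 z - F z *\<^sub>R \<gamma>) \<le> d"
        using S(4) that cl[of z] unfolding w0_def by auto
      then have "norm ((W z - \<eta>) + (w0 z - F z *\<^sub>R \<gamma>)) < d + d"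
        by (intro norm_triangle_lt add_less_le_mono)
      then have "(\<eta> + F z *\<^sub>R \<gamma>) + ((W z - \<eta>) + (w0 z - F z *\<^sub>R \<gamma>)) \<in> \<Sigma>"
        using F[of z] d(2) by (intro e(2)) (auto simp: abs_le_iff)
      then show ?thesis by (simp add: algebra_simps)
    qed
    have near1: "norm (W z + w0 z - (\<eta> + \<gamma>)) < \<delta>1" if "z \<in> S1" for z
    proof -
      have "W z + w0 z - (\<eta> + \<gamma>) = (W z - \<eta>) + ((w0 z - F z *\<^sub>R \<gamma>) + (F z - 1) *\<^sub>R \<gamma>)"
        by (simp add: algebra_simps)
      also have "norm \<dots> \<le> norm (W z - \<eta>) + (norm (w0 z - F z *\<^sub>R \<gamma>) + norm ((F z - 1) *\<^sub>R \<gamma>))"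
        by (intro norm_triangle_le add_mono) auto
      also have "norm ((F z - 1) *\<^sub>R \<gamma>) \<le> \<epsilon>' * norm \<gamma>"
        using F12(1)[OF that] F[of z] by (auto intro!: mult_right_mono simp: abs_le_iff)
      finally show ?thesis using S(4) that S12(3) cl[of z] d\<epsilon> d(3) unfolding w0_def by fastforce
    qed
    have near2: "norm (W z + w0 z - (\<eta> - \<gamma>)) < \<delta>2" if "z \<in> S2" for z
    proof -
      have "W z + w0 z - (\<eta> - \<gamma>) = (W z - \<eta>) + ((w0 z - F z *\<^sub>R \<gamma>) + (F z + 1) *\<^sub>R \<gamma>)"
        by (simp add: algebra_simps)
      also have "norm \<dots> \<le> norm (W z - \<eta>) + (norm (w0 z - F z *\<^sub>R \<gamma>) + norm ((F z + 1) *\<^sub>R \<gamma>))"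
        by (intro norm_triangle_le add_mono) auto
      also have "norm ((F z + 1) *\<^sub>R \<gamma>) \<le> \<epsilon>' * norm \<gamma>"
        using F12(2)[OF that] F[of z] by (auto intro!: mult_right_mono simp: abs_le_iff)
      finally show ?thesis using S(4) that S12(4) cl[of z] d\<epsilon> d(4) unfolding w0_def by fastforce
    qed
    have bS: "bounded S1" "bounded S2" using S12 S(2) bounded_subset by blast+
    have I1: "improvable \<Sigma> K c1 S1 (\<lambda>z. W z + w0 z)"
      by (rule R1[rule_format, OF S12(1) bS(1) continuous_on_subset[OF cW S12(3)]]) (erule near1)
    obtain w1 where w1: "perturbation_field S1 (\<epsilon> / 3) w1" "\<And>z. z \<in> S1 \<Longrightarrow> W z + w0 z + w1 z \<in> \<Sigma>"
       "(LINT z|lebesgue_on S1. infdist (W z + w0 z + w1 z) K) \<le> c1 * measure lebesgue S1"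
      using I1[unfolded improvable_def, rule_format, of "\<epsilon> / 3"] S(5) by auto
    have I2: "improvable \<Sigma> K c2 S2 (\<lambda>z. W z + w0 z)"
      by (rule R2[rule_format, OF S12(2) bS(2) continuous_on_subset[OF cW S12(4)]]) (erule near2)
    obtain w2 where w2: "perturbation_field S2 (\<epsilon> / 3) w2" "\<And>z. z \<in> S2 \<Longrightarrow> W z + w0 z + w2 z \<in> \<Sigma>"
       "(LINT z|lebesgue_on S2. infdist (W z + w0 z + w2 z) K) \<le> c2 * measure lebesgue S2"
      using I2[unfolded improvable_def, rule_format, of "\<epsilon> / 3"] S(5) by auto
    have w1_0: "w1 z = 0" if "z \<notin> S1" for z by (rule perturbation_field_outside[OF w1(1) that])
    have w2_0: "w2 z = 0" if "z \<notin> S2" for z by (rule perturbation_field_outside[OF w2(1) that])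
    define w where "w z = w0 z + w1 z + w2 z" for z
    have "perturbation_field S (\<epsilon>' + \<epsilon> / 3 + \<epsilon> / 3) w"
      unfolding w_def
      by (rule perturbation_field_add[OF perturbation_field_add[OF w0
            perturbation_field_mono[OF w1(1) S12(3) order_refl]]
            perturbation_field_mono[OF w2(1) S12(4) order_refl]])
    then have w: "perturbation_field S \<epsilon> w" by (rule perturbation_field_mono) (use \<epsilon>' in auto)
    have W1: "W z + w z = W z + w0 z + w1 z" if "z \<in> S1" for z
      using w2_0[of z] that S12(5) by (auto simp: w_def algebra_simps)
    have W2: "W z + w z = W z + w0 z + w2 z" if "z \<in> S2" for z
      using w1_0[of z] that S12(5) by (auto simp: w_def algebra_simps)
    have in\<Sigma>: "W z + w z \<in> \<Sigma>" if "z \<in> S" for z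
      using base[OF that] W1[of z] W2[of z] w1(2)[of z] w2(2)[of z] w1_0[of z] w2_0[of z]
      by (cases "z \<in> S1"; cases "z \<in> S2") (auto simp: w_def add.assoc)
    have int: "integrable (lebesgue_on X) (\<lambda>z. infdist (W z + w z) K)"
      if "X \<subseteq> S" "X \<in> sets lebesgue" for X
    proof -
      have "continuous_on S (\<lambda>z. infdist (W z + w z) K)"
        by (intro continuous_on_infdist continuous_on_add S perturbation_field_continuous[OF w])
      then have "integrable (lebesgue_on S) (\<lambda>z. infdist (W z + w z) K)"
        by (rule integrable_continuous_bounded[OF S(1,2), where B = M])
           (simp add: infdist_nonneg M(2) in\<Sigma>)
      then show ?thesis
        by (rule integrable_lebesgue_on_subset[OF _ _ that(2,1)]) (use S(1) in simp)
    qed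
    have sets: "S \<in> sets lebesgue" "S1 \<in> sets lebesgue" "S2 \<in> sets lebesgue" using S S12 by auto
    define R where "R = S - (S1 \<union> S2)"
    have R: "R \<in> lmeasurable" unfolding R_def
      using SL sets by (intro fmeasurable_Diff) auto
    have "(LINT z|lebesgue_on S. infdist (W z + w z) K) =
       (LINT z|lebesgue_on S1. infdist (W z + w z) K) + (LINT z|lebesgue_on S2. infdist (W z + w z) K)
       + (LINT z|lebesgue_on R. infdist (W z + w z) K)"
      unfolding R_def by (rule integral_split3[OF sets S12(3-5) int[OF _ sets(1)]]) simp
    also have "(LINT z|lebesgue_on S1. infdist (W z + w z) K) = (LINT z|lebesgue_on S1. infdist (W z + w0 z + w1 z) K)"
      by (rule Bochner_Integration.integral_cong) (auto simp: W1 space_restrict_space)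
    also have "(LINT z|lebesgue_on S2. infdist (W z + w z) K) = (LINT z|lebesgue_on S2. infdist (W z + w0 z + w2 z) K)"
      by (rule Bochner_Integration.integral_cong) (auto simp: W2 space_restrict_space)
    also have "\<dots> \<le> c2 * (measure lebesgue S / 2)"
      using w2(3) m(2) c by (meson mult_left_mono order_trans)
    also have "(LINT z|lebesgue_on S1. infdist (W z + w0 z + w1 z) K) \<le> c1 * (measure lebesgue S / 2)"
      using w1(3) m(1) c by (meson mult_left_mono order_trans)
    also have "(LINT z|lebesgue_on R. infdist (W z + w z) K) \<le> M * measure lebesgue R"
      by (rule integral_le_const_lebesgue_on[OF R int]) (use R in\<Sigma> M in \<open>auto simp: R_def\<close>)
    also have "M * measure lebesgue R \<le> M * \<epsilon>'" using m(3) M by (simp add: R_def)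
    also have "M * \<epsilon>' \<le> gap" by fact
    also have "c1 * (measure lebesgue S / 2) + c2 * (measure lebesgue S / 2) + gap = c * measure lebesgue S"
      by (simp add: gap_def field_simps)
    finally show ?thesis using w in\<Sigma> by (intro exI[of _ w]) auto
  qed
  qed
qed

text \<open>The infimum of the mean distances from \<open>K\<close> that can be reached from fields close to \<open>\<eta>\<close>. Successive
oscillations generate laminates in \<open>\<Sigma>\<close> with barycentre \<open>\<eta>\<close>, so this plays the role of a convex envelope of
the distance along the directions of the wave cone.\<close>

definition cost where
  "cost \<Sigma> K \<eta> = Inf {c. 0 \<le> c \<and> reachable \<Sigma> K \<eta> c}"

context
  fixes \<Sigma> K :: "((real^'n^'m) \<times> (real^'n^'m)) set"
  assumes \<Sigma>: "open \<Sigma>" "bounded \<Sigma>"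
begin

lemma cost_nonempty: "\<eta> \<in> \<Sigma> \<Longrightarrow> {c. 0 \<le> c \<and> reachable \<Sigma> K \<eta> c} \<noteq> {}"
  using reachable_base[OF \<Sigma>, of \<eta> K "infdist \<eta> K + 1"] infdist_nonneg[of \<eta> K]
  by (auto intro!: exI[of _ "infdist \<eta> K + 1"])

lemma cost_bdd: "bdd_below {c. 0 \<le> c \<and> reachable \<Sigma> K \<eta> c}"
  by (rule bdd_belowI[of _ 0]) auto

lemma cost_nonneg: "\<eta> \<in> \<Sigma> \<Longrightarrow> 0 \<le> cost \<Sigma> K \<eta>"
  unfolding cost_def by (rule cInf_greatest[OF cost_nonempty]) auto

lemma cost_le: "0 \<le> c \<Longrightarrow> reachable \<Sigma> K \<eta> c \<Longrightarrow> cost \<Sigma> K \<eta> \<le> c"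
  unfolding cost_def by (rule cInf_lower[OF _ cost_bdd]) auto

lemma cost_le_infdist:
  assumes "\<eta> \<in> \<Sigma>" shows "cost \<Sigma> K \<eta> \<le> infdist \<eta> K"
proof (rule field_le_epsilon)
  fix e :: real assume "e > 0"
  then show "cost \<Sigma> K \<eta> \<le> infdist \<eta> K + e"
    using infdist_nonneg[of \<eta> K] assms by (intro cost_le reachable_base[OF \<Sigma>]) auto
qed

lemma reachable_if_cost_less:
  assumes "\<eta> \<in> \<Sigma>" "cost \<Sigma> K \<eta> < c" shows "reachable \<Sigma> K \<eta> c"
  using assms(2) cInf_lessD[OF cost_nonempty[OF assms(1)]] reachable_mono unfolding cost_def
  by (metis (no_types, lifting) less_imp_le mem_Collect_eq)

lemma cost_midpoint:
  assumes "\<gamma> \<in> wave_cone" and seg: "\<And>t. \<bar>t\<bar> \<le> 1 \<Longrightarrow> \<eta> + t *\<^sub>R \<gamma> \<in> \<Sigma>"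
  shows "cost \<Sigma> K \<eta> \<le> (cost \<Sigma> K (\<eta> + \<gamma>) + cost \<Sigma> K (\<eta> - \<gamma>)) / 2"
proof (rule field_le_epsilon)
  fix e :: real assume e: "e > 0"
  have in\<Sigma>: "\<eta> + \<gamma> \<in> \<Sigma>" "\<eta> - \<gamma> \<in> \<Sigma>" using seg[of 1] seg[of "-1"] by auto
  note nn = cost_nonneg[OF in\<Sigma>(1)] cost_nonneg[OF in\<Sigma>(2)]
  have "reachable \<Sigma> K \<eta> ((cost \<Sigma> K (\<eta> + \<gamma>) + cost \<Sigma> K (\<eta> - \<gamma>)) / 2 + e)"
    by (rule reachable_midpoint[OF \<Sigma> assms(1) seg, where ?c1.0 = "cost \<Sigma> K (\<eta> + \<gamma>) + e / 2"
          and ?c2.0 = "cost \<Sigma> K (\<eta> - \<gamma>) + e / 2"])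
      (use e nn in\<Sigma> in \<open>auto intro!: reachable_if_cost_less simp: field_simps\<close>)
  then show "cost \<Sigma> K \<eta> \<le> (cost \<Sigma> K (\<eta> + \<gamma>) + cost \<Sigma> K (\<eta> - \<gamma>)) / 2 + e"
    using nn e by (intro cost_le) auto
qed

end

lemma midpoint_convex_dyadic:
  fixes g :: "real \<Rightarrow> real"
  assumes mid: "\<And>a b. a \<in> {0..<\<kappa>} \<Longrightarrow> b \<in> {0..<\<kappa>} \<Longrightarrow> g ((a + b) / 2) \<le> (g a + g b) / 2"
    and s: "s \<in> {0..<\<kappa>}"
  shows "i \<le> 2 ^ k \<Longrightarrow> g (real i / 2 ^ k * s) \<le> (1 - real i / 2 ^ k) * g 0 + real i / 2 ^ k * g s"
proof (induction k arbitrary: i)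
  case 0
  then show ?case by (cases i) auto
next
  case (Suc k)
  show ?case
  proof (cases "even i")
    case True
    then obtain j where "i = 2 * j" by blast
    then show ?thesis using Suc.IH[of j] Suc.prems by simp
  next
    case False
    then obtain j where i: "i = 2 * j + 1" using oddE by blast
    define q where "q = real j / 2 ^ k"
    define q' where "q' = real (Suc j) / 2 ^ k"
    have j: "j \<le> 2 ^ k" "Suc j \<le> 2 ^ k" using Suc.prems i by auto
    then have "real j \<le> 2 ^ k" "real (Suc j) \<le> 2 ^ k"
      by (metis of_nat_le_iff of_nat_numeral of_nat_power)+
    then have q1: "0 \<le> q" "q \<le> 1" "0 \<le> q'" "q' \<le> 1" by (auto simp: q_def q'_def)
    have qs: "q * s \<in> {0..<\<kappa>}" "q' * s \<in> {0..<\<kappa>}"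
      using q1 s mult_left_le_one_le[of s q] mult_left_le_one_le[of s q'] by auto
    have iq: "real i / 2 ^ Suc k = (q + q') / 2" by (simp add: i q_def q'_def field_simps)
    have "real i / 2 ^ Suc k * s = (q + q') / 2 * s" by (simp only: iq)
    also have "\<dots> = (q * s + q' * s) / 2" by (simp add: field_simps)
    finally have "real i / 2 ^ Suc k * s = (q * s + q' * s) / 2" .
    then have "g (real i / 2 ^ Suc k * s) \<le> (g (q * s) + g (q' * s)) / 2" using mid[OF qs] by (simp only:)
    also have "\<dots> \<le> (((1 - q) * g 0 + q * g s) + ((1 - q') * g 0 + q' * g s)) / 2"
      using Suc.IH[OF j(1), folded q_def] Suc.IH[OF j(2), folded q'_def] by (intro divide_right_mono add_mono) auto
    also have "\<dots> = (1 - (q + q') / 2) * g 0 + (q + q') / 2 * g s" by (simp add: field_simps)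
    finally show ?thesis by (simp only: iq)
  qed
qed

text \<open>Along the segment the cost is midpoint convex, bounded, and it tends to \<open>0\<close> at the end point
\<open>\<rho> + \<kappa> \<gamma> \<in> K\<close>. A midpoint convex function satisfies the convexity inequality for dyadic weights. The
weight \<open>q\<close> is taken dyadic and slightly above \<open>t / \<kappa>\<close>, so that the point \<open>s = t / q\<close> lies just before the
end of the segment.\<close>

lemma cost_on_segment:
  fixes \<Sigma> K :: "((real^'n^'m) \<times> (real^'n^'m)) set"
  assumes \<Sigma>: "open \<Sigma>" "bounded \<Sigma>" and \<gamma>: "\<gamma> \<in> wave_cone" and "\<rho> + \<kappa> *\<^sub>R \<gamma> \<in> K"
    and seg: "\<And>t. t \<in> {0..<\<kappa>} \<Longrightarrow> \<rho> + t *\<^sub>R \<gamma> \<in> \<Sigma>" and t: "t \<in> {0<..<\<kappa>}"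
  shows "cost \<Sigma> K (\<rho> + t *\<^sub>R \<gamma>) \<le> (1 - t / \<kappa>) * cost \<Sigma> K \<rho>"
proof -
  define g where "g t = cost \<Sigma> K (\<rho> + t *\<^sub>R \<gamma>)" for t
  have mid: "g ((a + b) / 2) \<le> (g a + g b) / 2" if ab: "a \<in> {0..<\<kappa>}" "b \<in> {0..<\<kappa>}" for a b
  proof -
    define h where "h = (b - a) / 2"
    define m where "m = (a + b) / 2"
    have "cost \<Sigma> K (\<rho> + m *\<^sub>R \<gamma>) \<le> (cost \<Sigma> K (\<rho> + m *\<^sub>R \<gamma> + h *\<^sub>R \<gamma>) + cost \<Sigma> K (\<rho> + m *\<^sub>R \<gamma> - h *\<^sub>R \<gamma>)) / 2"
    proof (rule cost_midpoint[OF \<Sigma> wave_cone_scaleR[OF \<gamma>]])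
      fix r :: real assume r: "\<bar>r\<bar> \<le> 1"
      have "\<bar>r * h\<bar> \<le> \<bar>h\<bar>" using r by (simp add: abs_mult mult_left_le_one_le)
      moreover have "0 \<le> m - \<bar>h\<bar>" "m + \<bar>h\<bar> < \<kappa>" using ab by (auto simp: m_def h_def abs_if field_simps)
      ultimately have "m + r * h \<in> {0..<\<kappa>}" unfolding atLeastLessThan_iff by linarith
      from seg[OF this] show "\<rho> + m *\<^sub>R \<gamma> + r *\<^sub>R h *\<^sub>R \<gamma> \<in> \<Sigma>" by (simp add: algebra_simps)
    qed
    moreover have "\<rho> + m *\<^sub>R \<gamma> + h *\<^sub>R \<gamma> = \<rho> + (m + h) *\<^sub>R \<gamma>" "\<rho> + m *\<^sub>R \<gamma> - h *\<^sub>R \<gamma> = \<rho> + (m - h) *\<^sub>R \<gamma>"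
      by (simp_all add: scaleR_add_left scaleR_diff_left)
    moreover have "m + h = b" "m - h = a" by (simp_all add: m_def h_def field_simps)
    ultimately have "g m \<le> (g b + g a) / 2" by (simp add: g_def)
    then show ?thesis by (simp add: m_def add.commute)
  qed
  have \<kappa>: "\<kappa> > 0" using t by simp
  have g0: "g 0 \<ge> 0" using cost_nonneg[OF \<Sigma>] seg[of 0] \<kappa> by (simp add: g_def)
  have step: "g t \<le> (1 - t / \<kappa>) * g 0 + \<kappa> * norm \<gamma> / 2 ^ n" if n: "t / \<kappa> + 1 / 2 ^ n \<le> 1" for n
  proof -
    define i where "i = nat \<lfloor>2 ^ n * (t / \<kappa>)\<rfloor> + 1"
    define q where "q = real i / 2 ^ n"
    have "0 \<le> 2 ^ n * (t / \<kappa>)" using t by simp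
    then have "2 ^ n * (t / \<kappa>) < real i" "real i \<le> 2 ^ n * (t / \<kappa>) + 1" unfolding i_def by linarith+
    then have q: "t / \<kappa> < q" "q \<le> t / \<kappa> + 1 / 2 ^ n" by (auto simp: q_def field_simps)
    have q0: "q > 0" using q(1) t by (meson divide_pos_pos greaterThanLessThan_iff less_trans)
    have "q \<le> 1" using q n by linarith
    then have "real i \<le> 2 ^ n" by (simp add: q_def)
    then have i: "i \<le> 2 ^ n" by (metis of_nat_le_iff of_nat_numeral of_nat_power)
    define s where "s = t / q"
    have s: "s \<in> {0..<\<kappa>}" using q(1) q0 t \<kappa> by (auto simp: s_def field_simps)
    have "g t = g (q * s)" using q0 by (simp add: s_def)
    also have "\<dots> \<le> (1 - q) * g 0 + q * g s"
      using midpoint_convex_dyadic[OF mid s i] by (simp add: q_def)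
    also have "(1 - q) * g 0 \<le> (1 - t / \<kappa>) * g 0" using q g0 by (intro mult_right_mono) auto
    also have "g s \<le> infdist (\<rho> + s *\<^sub>R \<gamma>) K"
      unfolding g_def by (rule cost_le_infdist[OF \<Sigma> seg[OF s]])
    also have "\<dots> \<le> dist (\<rho> + s *\<^sub>R \<gamma>) (\<rho> + \<kappa> *\<^sub>R \<gamma>)" by (rule infdist_le) fact
    also have "\<dots> = (\<kappa> - s) * norm \<gamma>"
      using s by (simp add: dist_norm norm_minus_commute flip: scaleR_diff_left)
    also have "q * ((\<kappa> - s) * norm \<gamma>) = (q * \<kappa> - t) * norm \<gamma>" using q0 by (simp add: s_def field_simps)
    also have "\<dots> \<le> (\<kappa> / 2 ^ n) * norm \<gamma>"
      using q(2) \<kappa> by (intro mult_right_mono) (auto simp: field_simps)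
    finally show ?thesis using q0 by simp
  qed
  have lim2: "(\<lambda>n. 1 / 2 ^ n :: real) \<longlonglongrightarrow> 0"
    using LIMSEQ_inverse_realpow_zero[of 2] by (simp add: divide_inverse)
  then have "(\<lambda>n. (1 - t / \<kappa>) * g 0 + \<kappa> * norm \<gamma> * (1 / 2 ^ n)) \<longlonglongrightarrow> (1 - t / \<kappa>) * g 0 + \<kappa> * norm \<gamma> * 0"
    by (intro tendsto_intros)
  moreover have "eventually (\<lambda>n. 1 / 2 ^ n < 1 - t / \<kappa>) sequentially"
    by (rule order_tendstoD[OF lim2]) (use t \<kappa> in auto)
  then have "eventually (\<lambda>n. g t \<le> (1 - t / \<kappa>) * g 0 + \<kappa> * norm \<gamma> * (1 / 2 ^ n)) sequentially"
    by eventually_elim (use step in auto)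
  ultimately have "g t \<le> (1 - t / \<kappa>) * g 0 + \<kappa> * norm \<gamma> * 0"
    by (rule tendsto_lowerbound) auto
  then show ?thesis by (simp add: g_def)
qed

text \<open>Write \<open>b\<^sub>j\<close> for the base points. As \<open>b\<^sub>j\<^sub>+\<^sub>1 = b\<^sub>j + \<gamma>\<^sub>j\<close> lies on the segment from \<open>b\<^sub>j\<close> to \<open>\<xi>\<^sub>j \<in> K\<close> at the
fraction \<open>1 / \<kappa>\<^sub>j\<close>, its cost is at most \<open>(1 - 1 / \<kappa>\<^sub>j)\<close> times the cost of \<open>b\<^sub>j\<close>. The \<open>\<gamma>\<^sub>j\<close> add up to
zero, so after one round the base points return to \<open>b\<^sub>1\<close> while the cost has been multiplied by a factor less
than one. Hence it vanishes at all base points, and by convexity on the segments.\<close>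

proposition cost_zero_on_configuration:
  fixes \<Sigma> K :: "((real^'n^'m) \<times> (real^'n^'m)) set"
  assumes \<Sigma>: "open \<Sigma>" "bounded \<Sigma>" and N: "N \<ge> 2" and conf: "tau_configuration_with N \<xi> \<rho> \<gamma>"
    and K: "\<And>j. j \<in> {1..N} \<Longrightarrow> \<xi> j \<in> K" and sub: "tau_set N \<xi> \<rho> \<gamma> \<subseteq> \<Sigma>" and \<eta>: "\<eta> \<in> tau_set N \<xi> \<rho> \<gamma>"
  shows "cost \<Sigma> K \<eta> = 0"
proof -
  obtain \<kappa> s \<alpha> p \<beta> where
    \<kappa>: "\<And>j. j \<in> {1..N} \<Longrightarrow> \<kappa> j > 1" "\<And>j. j \<in> {1..N} \<Longrightarrow> \<xi> j = base_point \<rho> \<gamma> j + \<kappa> j *\<^sub>R \<gamma> j"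
    and \<gamma>: "\<And>j. j \<in> {1..N} \<Longrightarrow> \<alpha> j \<noteq> 0" "\<And>j. j \<in> {1..N} \<Longrightarrow> \<gamma> j = (outer (p j) (\<alpha> j), \<chi> i. s j *\<^sub>R \<beta> i j)"
    and s1: "\<And>i. (\<Sum>j\<in>{1..N}. s j *\<^sub>R \<beta> i j) = 0" and s2: "(\<Sum>j\<in>{1..N}. outer (p j) (\<alpha> j)) = 0"
    and orth: "\<And>i j. j \<in> {1..N} \<Longrightarrow> \<beta> i j \<bullet> \<alpha> j = 0"
    using conf unfolding tau_configuration_with_def by blast
  define b where "b j = base_point \<rho> \<gamma> j" for j
  have wc: "\<gamma> j \<in> wave_cone" if "j \<in> {1..N}" for j
    unfolding wave_cone_def \<gamma>(2)[OF that] using \<gamma>(1)[OF that] orth[OF that] by auto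
  have b_Suc: "b (Suc j) = b j + \<gamma> j" if "j \<ge> 1" for j
    using that by (simp add: b_def base_point_def)
  have sum0: "(\<Sum>j\<in>{1..N}. \<gamma> j) = 0"
  proof -
    have "(\<Sum>j\<in>{1..N}. \<gamma> j) = (\<Sum>j\<in>{1..N}. (outer (p j) (\<alpha> j), \<chi> i. s j *\<^sub>R \<beta> i j))"
      by (rule sum.cong) (auto simp: \<gamma>(2))
    also have "\<dots> = (\<Sum>j\<in>{1..N}. outer (p j) (\<alpha> j), \<Sum>j\<in>{1..N}. \<chi> i. s j *\<^sub>R \<beta> i j)"
      by (simp add: sum_prod)
    also have "(\<Sum>j\<in>{1..N}. \<chi> i. s j *\<^sub>R \<beta> i j) = 0"
      unfolding vec_eq_iff[of _ "0::real^'n^'m"] using s1 by (simp add: vec_eq_iff[of _ "0::real^'n"])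
    finally show ?thesis using s2 by (simp add: zero_prod_def)
  qed
  have cyc: "b (Suc N) = b 1"
    using sum0 by (simp add: b_def base_point_def atLeastLessThanSuc_atLeastAtMost)
  have tau: "b j + t *\<^sub>R \<gamma> j \<in> \<Sigma>" if "j \<in> {1..N}" "0 < t" "t < \<kappa> j" for j t
  proof -
    have "\<kappa> j > 0" using \<kappa>(1)[OF that(1)] by simp
    then have "b j + t *\<^sub>R \<gamma> j = (1 - (1 - t / \<kappa> j)) *\<^sub>R \<xi> j + (1 - t / \<kappa> j) *\<^sub>R b j"
      unfolding \<kappa>(2)[OF that(1)] b_def[symmetric] by (simp add: algebra_simps)
    moreover have "0 < 1 - t / \<kappa> j" "1 - t / \<kappa> j < 1" using \<open>\<kappa> j > 0\<close> that by auto
    ultimately have "b j + t *\<^sub>R \<gamma> j \<in> tau_set N \<xi> \<rho> \<gamma>"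
      unfolding tau_set_def b_def using that(1) by blast
    then show ?thesis using sub by blast
  qed
  have bS: "b (Suc j) \<in> \<Sigma>" if "j \<in> {1..N}" for j
    using tau[OF that, of 1] \<kappa>(1)[OF that] b_Suc that by simp
  \<comment> \<open>Base points are end points of their own segment, which is open, but interior points of the preceding one.\<close>
  have b\<Sigma>: "b j \<in> \<Sigma>" if "j \<in> {1..N}" for j
  proof (cases "j = 1")
    case True then show ?thesis using bS[of N] cyc N by simp
  next
    case False
    then show ?thesis using bS[of "j - 1"] that by (cases j) auto
  qed
  have seg: "b j + t *\<^sub>R \<gamma> j \<in> \<Sigma>" if "j \<in> {1..N}" "t \<in> {0..<\<kappa> j}" for j t
    using tau[OF that(1), of t] b\<Sigma>[OF that(1)] that(2) by (cases "t = 0") auto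
  have seg_cost: "cost \<Sigma> K (b j + t *\<^sub>R \<gamma> j) \<le> (1 - t / \<kappa> j) * cost \<Sigma> K (b j)"
    if "j \<in> {1..N}" "0 < t" "t < \<kappa> j" for j t
    by (rule cost_on_segment[OF \<Sigma> wc[OF that(1)] _ seg[OF that(1)]])
       (use K[OF that(1)] \<kappa>(2)[OF that(1)] that in \<open>auto simp: b_def\<close>)
  have step: "cost \<Sigma> K (b (Suc j)) \<le> (1 - 1 / \<kappa> j) * cost \<Sigma> K (b j)" if "j \<in> {1..N}" for j
    using seg_cost[OF that, of 1] \<kappa>(1)[OF that] b_Suc that by simp
  have nn: "0 \<le> cost \<Sigma> K (b j)" if "j \<in> {1..N}" for j
    by (rule cost_nonneg[OF \<Sigma> b\<Sigma>[OF that]])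
  have dec: "cost \<Sigma> K (b (Suc j)) \<le> cost \<Sigma> K (b j)" if "j \<in> {1..N}" for j
  proof -
    have "(1 - 1 / \<kappa> j) * cost \<Sigma> K (b j) \<le> 1 * cost \<Sigma> K (b j)"
      using \<kappa>(1)[OF that] nn[OF that] by (intro mult_right_mono) auto
    then show ?thesis using step[OF that] by simp
  qed
  have chain: "cost \<Sigma> K (b (Suc j)) \<le> (1 - 1 / \<kappa> 1) * cost \<Sigma> K (b 1)" if "1 \<le> j" "j \<le> N" for j
    using that
  proof (induction j rule: dec_induct)
    case base then show ?case using step[of 1] N by simp
  next
    case (step k) then show ?case using dec[of "Suc k"] by simp
  qed
  have "cost \<Sigma> K (b 1) \<le> (1 - 1 / \<kappa> 1) * cost \<Sigma> K (b 1)" using chain[of N] cyc N by simp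
  then have "1 / \<kappa> 1 * cost \<Sigma> K (b 1) \<le> 0" by (simp add: algebra_simps)
  then have b1: "cost \<Sigma> K (b 1) = 0"
    using \<kappa>(1)[of 1] nn[of 1] N by (simp add: mult_le_0_iff divide_le_0_iff)
  have b0: "cost \<Sigma> K (b j) = 0" if "j \<in> {1..N}" for j
  proof (cases "j = 1")
    case False
    then show ?thesis using chain[of "j - 1"] that b1 nn[OF that] by auto
  qed (use b1 in simp)
  obtain j \<mu> where j: "j \<in> {1..N}" "0 < \<mu>" "\<mu> < 1" "\<eta> = (1 - \<mu>) *\<^sub>R \<xi> j + \<mu> *\<^sub>R b j"
    using \<eta> unfolding tau_set_def b_def by blast
  have k0: "\<kappa> j > 0" using \<kappa>(1)[OF j(1)] by simp
  have "\<eta> = b j + ((1 - \<mu>) * \<kappa> j) *\<^sub>R \<gamma> j"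
    unfolding j(4) \<kappa>(2)[OF j(1)] b_def by (simp add: algebra_simps)
  then have "cost \<Sigma> K \<eta> \<le> 0"
    using seg_cost[OF j(1), of "(1 - \<mu>) * \<kappa> j"] b0[OF j(1)] j k0 by simp
  moreover have "0 \<le> cost \<Sigma> K \<eta>" using cost_nonneg[OF \<Sigma>] sub \<eta> by blast
  ultimately show ?thesis by simp
qed

corollary condition_OC_reachable:
  fixes \<sigma> :: "real^'n^'m \<Rightarrow> real^'n^'m"
  assumes "condition_OC \<sigma> \<Sigma>" "\<eta> \<in> \<Sigma>" "c > 0"
  shows "reachable \<Sigma> (graph_set \<sigma>) \<eta> c"
proof -
  obtain N \<xi> \<rho> \<gamma> where "N \<ge> 2" "tau_configuration_with N \<xi> \<rho> \<gamma>" "\<forall>j\<in>{1..N}. \<xi> j \<in> graph_set \<sigma>"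
     "\<eta> \<in> tau_set N \<xi> \<rho> \<gamma>" "tau_set N \<xi> \<rho> \<gamma> \<subseteq> \<Sigma>" and \<Sigma>: "open \<Sigma>" "bounded \<Sigma>"
    using assms unfolding condition_OC_def by metis
  then have "cost \<Sigma> (graph_set \<sigma>) \<eta> = 0" using cost_zero_on_configuration[OF \<Sigma>] by metis
  then show ?thesis using reachable_if_cost_less[OF \<Sigma> assms(2)] assms(3) by simp
qed

section \<open>Uniform smallness implies weak smallness\<close>

lemma integrable_mult_bounded:
  fixes F g :: "'a \<Rightarrow> real"
  assumes "integrable M F" "g \<in> borel_measurable M" "\<And>z. z \<in> space M \<Longrightarrow> \<bar>g z\<bar> \<le> B"
  shows "integrable M (\<lambda>z. F z * g z)"
proof (rule Bochner_Integration.integrable_bound)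
  show "integrable M (\<lambda>z. F z * B)" using assms(1) by simp
  show "(\<lambda>z. F z * g z) \<in> borel_measurable M" using assms by simp
  show "AE z in M. norm (F z * g z) \<le> norm (F z * B)"
  proof (rule AE_I2)
    fix z assume "z \<in> space M"
    then have "\<bar>g z\<bar> \<le> \<bar>B\<bar>" using assms(3) by fastforce
    then show "norm (F z * g z) \<le> norm (F z * B)" by (simp add: abs_mult mult_left_mono)
  qed
qed

text \<open>Weak smallness of derivatives: uniformly small functions whose derivatives in direction \<open>b\<close> are bounded
by \<open>M\<close> have a derivative that is almost orthogonal to \<open>F\<close>.\<close>

definition weakly_null_at ::
  "'a::euclidean_space set \<Rightarrow> 'a \<Rightarrow> ('a \<Rightarrow> real) \<Rightarrow> real \<Rightarrow> real \<Rightarrow> real \<Rightarrow> bool" where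
  "weakly_null_at S b F M e \<epsilon> \<longleftrightarrow> (\<forall>f f'. C1_compact UNIV f f' \<longrightarrow> (\<forall>z. \<bar>f z\<bar> \<le> \<epsilon>) \<longrightarrow>
     (\<forall>z\<in>S. \<bar>f' z b\<bar> \<le> M) \<longrightarrow> \<bar>LINT z|lebesgue_on S. F z * f' z b\<bar> \<le> e)"

definition weakly_null :: "'a::euclidean_space set \<Rightarrow> 'a \<Rightarrow> ('a \<Rightarrow> real) \<Rightarrow> bool" where
  "weakly_null S b F \<longleftrightarrow> (\<forall>M>0. \<forall>e>0. \<exists>\<epsilon>>0. weakly_null_at S b F M e \<epsilon>)"

lemma weakly_nullD:
  assumes "weakly_null S b F" "M > 0" "e > 0"
  obtains \<epsilon> where "\<epsilon> > 0" "weakly_null_at S b F M e \<epsilon>"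
  using assms(1)[unfolded weakly_null_def, THEN spec, THEN mp, OF assms(2), THEN spec, THEN mp, OF assms(3)]
  by (elim exE conjE) (rule that)

lemma C1_compact_measurable_derivative:
  assumes "C1_compact T f f'" "S \<in> sets lebesgue"
  shows "(\<lambda>z. f' z b) \<in> borel_measurable (lebesgue_on S)"
  by (rule continuous_imp_measurable_on_sets_lebesgue[OF C1_compact_continuous_derivative[OF assms(1)] assms(2)])

text \<open>Integration by parts moves the derivative to \<open>\<theta>\<close>.\<close>

lemma weakly_null_C1:
  assumes S: "open S" and \<theta>: "C1_compact S \<theta> \<theta>'"
  shows "weakly_null S b \<theta>"
  unfolding weakly_null_def
proof (intro allI impI)
  fix M e :: real assume "M > 0" "e > 0"
  have one: "C1_on S (\<lambda>_. 1::real) (\<lambda>_ _. 0)" unfolding C1_on_def by simp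
  have i\<theta>: "integrable (lebesgue_on S) (\<lambda>z. \<theta>' z b)"
    using integration_by_parts(2)[OF S \<theta> one, of b] by simp
  define A where "A = (LINT z|lebesgue_on S. \<bar>\<theta>' z b\<bar>)"
  have A: "A \<ge> 0" by (simp add: A_def)
  define \<epsilon> where "\<epsilon> = e / (A + 1)"
  have \<epsilon>: "\<epsilon> > 0" "\<epsilon> * A \<le> e" using \<open>e > 0\<close> A by (auto simp: \<epsilon>_def field_simps)
  have "\<bar>LINT z|lebesgue_on S. \<theta> z * f' z b\<bar> \<le> e"
    if f: "C1_compact UNIV f f'" "\<forall>z. \<bar>f z\<bar> \<le> \<epsilon>" for f f'
  proof -
    have w: "C1_on S f f'" using f(1) C1_on_subset unfolding C1_compact_def by blast
    have i: "integrable (lebesgue_on S) (\<lambda>z. \<theta>' z b * f z)"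
      using integration_by_parts(2)[OF S \<theta> w, of b] by simp
    have "\<bar>LINT z|lebesgue_on S. \<theta> z * f' z b\<bar> = \<bar>LINT z|lebesgue_on S. \<theta>' z b * f z\<bar>"
      using integration_by_parts(3)[OF S \<theta> w, of b] by simp
    also have "\<dots> \<le> (LINT z|lebesgue_on S. \<bar>\<theta>' z b * f z\<bar>)" by (rule integral_abs_bound)
    also have "\<dots> \<le> (LINT z|lebesgue_on S. \<bar>\<theta>' z b\<bar> * \<epsilon>)"
      by (rule integral_mono[OF integrable_abs[OF i] integrable_mult_left[OF integrable_abs[OF i\<theta>]]])
         (use f(2) in \<open>simp add: abs_mult mult_left_mono\<close>)
    also have "\<dots> = \<epsilon> * A" by (simp add: A_def)
    finally show ?thesis using \<epsilon> by linarith
  qed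
  with \<epsilon>(1) show "\<exists>\<epsilon>>0. weakly_null_at S b \<theta> M e \<epsilon>"
    unfolding weakly_null_at_def by blast
qed

lemma weakly_null_L1_closed:
  assumes S: "S \<in> sets lebesgue" and F: "integrable (lebesgue_on S) F"
    and approx: "\<And>e. e > 0 \<Longrightarrow> \<exists>G. integrable (lebesgue_on S) G \<and> weakly_null S b G \<and>
       (LINT z|lebesgue_on S. \<bar>F z - G z\<bar>) \<le> e"
  shows "weakly_null S b F"
  unfolding weakly_null_def
proof (intro allI impI)
  fix M e :: real assume Me: "M > 0" "e > 0"
  then have e2: "e / 2 > 0" by simp
  have "e / (2 * M) > 0" using Me by simp
  then obtain G where G: "integrable (lebesgue_on S) G" "weakly_null S b G"
    "(LINT z|lebesgue_on S. \<bar>F z - G z\<bar>) \<le> e / (2 * M)" using approx by blast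
  obtain \<epsilon> where \<epsilon>: "\<epsilon> > 0" "weakly_null_at S b G M (e / 2) \<epsilon>"
    by (rule weakly_nullD[OF G(2) Me(1) e2]) (rule that)
  have "\<bar>LINT z|lebesgue_on S. F z * f' z b\<bar> \<le> e"
    if f: "C1_compact UNIV f f'" "\<forall>z. \<bar>f z\<bar> \<le> \<epsilon>" "\<forall>z\<in>S. \<bar>f' z b\<bar> \<le> M" for f f'
  proof -
    note m = C1_compact_measurable_derivative[OF f(1) S, of b]
    have iG: "integrable (lebesgue_on S) (\<lambda>z. G z * f' z b)"
      by (rule integrable_mult_bounded[OF G(1) m, of M]) (use f(3) in \<open>auto simp: space_restrict_space\<close>)
    have iD: "integrable (lebesgue_on S) (\<lambda>z. (F z - G z) * f' z b)"
      by (rule integrable_mult_bounded[OF _ m, of _ M]) (use F G f(3) in \<open>auto simp: space_restrict_space\<close>)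
    have "(LINT z|lebesgue_on S. F z * f' z b) = (LINT z|lebesgue_on S. (F z - G z) * f' z b + G z * f' z b)"
      by (simp add: algebra_simps)
    also have "\<dots> = (LINT z|lebesgue_on S. (F z - G z) * f' z b) + (LINT z|lebesgue_on S. G z * f' z b)"
      by (rule Bochner_Integration.integral_add[OF iD iG])
    moreover have "\<bar>LINT z|lebesgue_on S. G z * f' z b\<bar> \<le> e / 2"
      by (rule \<epsilon>(2)[unfolded weakly_null_at_def, rule_format, OF f(1)]) (use f in auto)
    ultimately have "\<bar>LINT z|lebesgue_on S. F z * f' z b\<bar> \<le> \<bar>LINT z|lebesgue_on S. (F z - G z) * f' z b\<bar> + e / 2"
      by linarith
    also have "\<bar>LINT z|lebesgue_on S. (F z - G z) * f' z b\<bar> \<le> (LINT z|lebesgue_on S. \<bar>(F z - G z) * f' z b\<bar>)"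
      by (rule integral_abs_bound)
    also have "\<dots> \<le> (LINT z|lebesgue_on S. \<bar>F z - G z\<bar> * M)"
      by (rule integral_mono[OF integrable_abs[OF iD]
            integrable_mult_left[OF integrable_abs[OF Bochner_Integration.integrable_diff[OF F G(1)]]]])
         (use f(3) in \<open>auto simp: abs_mult space_restrict_space intro!: mult_left_mono\<close>)
    also have "\<dots> \<le> e / 2" using G(3) Me by (simp add: field_simps)
    finally show ?thesis by simp
  qed
  with \<epsilon>(1) show "\<exists>\<epsilon>>0. weakly_null_at S b F M e \<epsilon>"
    unfolding weakly_null_at_def by blast
qed

lemma weakly_null_scale:
  assumes "weakly_null S b F" shows "weakly_null S b (\<lambda>z. F z * c)"
  unfolding weakly_null_def
proof (intro allI impI)
  fix M e :: real assume Me: "M > 0" "e > 0"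
  have e2: "e / (\<bar>c\<bar> + 1) > 0" using Me by (simp add: add_nonneg_pos)
  obtain \<epsilon> where \<epsilon>: "\<epsilon> > 0" "weakly_null_at S b F M (e / (\<bar>c\<bar> + 1)) \<epsilon>"
    by (rule weakly_nullD[OF assms Me(1) e2]) (rule that)
  have "\<bar>LINT z|lebesgue_on S. F z * c * f' z b\<bar> \<le> e"
    if f: "C1_compact UNIV f f'" "\<forall>z. \<bar>f z\<bar> \<le> \<epsilon>" "\<forall>z\<in>S. \<bar>f' z b\<bar> \<le> M" for f f'
  proof -
    have "(LINT z|lebesgue_on S. F z * c * f' z b) = (LINT z|lebesgue_on S. c * (F z * f' z b))"
      by (simp add: mult_ac)
    then have "\<bar>LINT z|lebesgue_on S. F z * c * f' z b\<bar> = \<bar>c\<bar> * \<bar>LINT z|lebesgue_on S. F z * f' z b\<bar>"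
      by (simp add: abs_mult)
    also have "\<dots> \<le> (\<bar>c\<bar> + 1) * (e / (\<bar>c\<bar> + 1))"
      by (intro mult_mono \<epsilon>(2)[unfolded weakly_null_at_def, rule_format, OF f(1)]) (use f in auto)
    also have "\<dots> = e" by (simp add: add_nonneg_pos less_imp_neq[symmetric])
    finally show ?thesis .
  qed
  with \<epsilon>(1) show "\<exists>\<epsilon>>0. weakly_null_at S b (\<lambda>z. F z * c) M e \<epsilon>"
    unfolding weakly_null_at_def by blast
qed

lemma weakly_null_add:
  assumes S: "S \<in> sets lebesgue" and F: "integrable (lebesgue_on S) F" "integrable (lebesgue_on S) G"
    and wF: "weakly_null S b F" and wG: "weakly_null S b G"
  shows "weakly_null S b (\<lambda>z. F z + G z)"
  unfolding weakly_null_def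
proof (intro allI impI)
  fix M e :: real assume Me: "M > 0" "e > 0"
  then have e2: "e / 2 > 0" by simp
  obtain \<epsilon> where \<epsilon>: "\<epsilon> > 0" "weakly_null_at S b F M (e / 2) \<epsilon>"
    by (rule weakly_nullD[OF wF Me(1) e2]) (rule that)
  obtain \<delta> where \<delta>: "\<delta> > 0" "weakly_null_at S b G M (e / 2) \<delta>"
    by (rule weakly_nullD[OF wG Me(1) e2]) (rule that)
  have "\<bar>LINT z|lebesgue_on S. (F z + G z) * f' z b\<bar> \<le> e"
    if f: "C1_compact UNIV f f'" "\<forall>z. \<bar>f z\<bar> \<le> min \<epsilon> \<delta>" "\<forall>z\<in>S. \<bar>f' z b\<bar> \<le> M" for f f'
  proof -
    note m = C1_compact_measurable_derivative[OF f(1) S, of b]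
    have i: "integrable (lebesgue_on S) (\<lambda>z. H z * f' z b)" if "integrable (lebesgue_on S) H" for H
      by (rule integrable_mult_bounded[OF that m, of M]) (use f(3) in \<open>auto simp: space_restrict_space\<close>)
    have "(LINT z|lebesgue_on S. (F z + G z) * f' z b) =
       (LINT z|lebesgue_on S. F z * f' z b) + (LINT z|lebesgue_on S. G z * f' z b)"
      by (simp add: distrib_right Bochner_Integration.integral_add[OF i[OF F(1)] i[OF F(2)]])
    moreover have "\<bar>LINT z|lebesgue_on S. F z * f' z b\<bar> \<le> e / 2"
      by (rule \<epsilon>(2)[unfolded weakly_null_at_def, rule_format, OF f(1)]) (use f in auto)
    moreover have "\<bar>LINT z|lebesgue_on S. G z * f' z b\<bar> \<le> e / 2"
      by (rule \<delta>(2)[unfolded weakly_null_at_def, rule_format, OF f(1)]) (use f in auto)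
    ultimately show ?thesis by linarith
  qed
  moreover have "min \<epsilon> \<delta> > 0" using \<epsilon> \<delta> by simp
  ultimately show "\<exists>\<epsilon>>0. weakly_null_at S b (\<lambda>z. F z + G z) M e \<epsilon>"
    unfolding weakly_null_at_def by blast
qed

text \<open>A cutoff that is \<open>1\<close> on a compact subset of \<open>A\<close> and \<open>0\<close> outside an open superset approximates the indicator
function of \<open>A\<close> in mean.\<close>

lemma weakly_null_indicator:
  fixes S :: "'a::euclidean_space set"
  assumes S: "open S" "bounded S" and A: "A \<in> sets lebesgue" "A \<subseteq> S"
  shows "weakly_null S b (indicator A)"
proof (rule weakly_null_L1_closed)
  have SL: "S \<in> lmeasurable" using S by (simp add: lmeasurable_open)
  show "S \<in> sets lebesgue" using S by auto
  interpret finite_measure "lebesgue_on S" using SL by (rule finite_measure_lebesgue_on)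
  have AS: "A \<in> sets (lebesgue_on S)" using A SL by (simp add: sets_restrict_space_iff fmeasurableD)
  have ind: "integrable (lebesgue_on S) (indicator B :: 'a \<Rightarrow> real)" if "B \<in> sets (lebesgue_on S)" for B
    by (rule integrable_real_indicator[OF that]) (simp add: less_top[symmetric])
  show iA: "integrable (lebesgue_on S) (indicator A :: 'a \<Rightarrow> real)" by (rule ind[OF AS])
  have AL: "A \<in> lmeasurable" using A SL by (metis fmeasurableI2)
  fix e :: real assume e: "e > 0"
  obtain C where C: "compact C" "C \<subseteq> A" "A - C \<in> lmeasurable" "measure lebesgue (A - C) < e / 2"
    using compact_inner_approximation[OF bounded_subset[OF S(2) A(2)] AL, of "e / 2"] e by auto
  obtain U0 where U0: "open U0" "A \<subseteq> U0" "U0 - A \<in> lmeasurable" "emeasure lebesgue (U0 - A) < ennreal (e / 2)"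
    using sets_lebesgue_outer_open[OF A(1), of "e / 2"] e by auto
  have mU0: "measure lebesgue (U0 - A) < e / 2"
    using U0(3,4) e by (simp add: emeasure_eq_measure2 ennreal_less_iff)
  define U where "U = U0 \<inter> S"
  have U: "open U" "C \<subseteq> U" "U \<subseteq> S" "A \<subseteq> U" using U0 S C A by (auto simp: U_def)
  obtain \<theta> G H K where \<theta>: "C2 \<theta> G H" "\<And>z. 0 \<le> \<theta> z" "\<And>z. \<theta> z \<le> 1" "\<And>z. z \<in> C \<Longrightarrow> \<theta> z = 1"
    and K: "compact K" "K \<subseteq> U" "\<And>z. z \<notin> K \<Longrightarrow> \<theta> z = 0"
    using C2_cutoff[OF C(1) U(1,2)] by metis
  have C1: "C1_compact S \<theta> (\<lambda>z v. G z \<bullet> v)"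
    unfolding C1_compact_def C1_on_def using C2_D(1,4)[OF \<theta>(1)] K U(3)
    by (auto intro!: continuous_intros exI[of _ K])
  have i\<theta>: "integrable (lebesgue_on S) \<theta>"
    by (rule integrable_continuous_bounded[OF S C2_D(5)[OF \<theta>(1)], where B = 1]) (use \<theta> in auto)
  define D where "D = (A - C) \<union> (U0 - A)"
  have D: "D \<in> lmeasurable" unfolding D_def using C U0 by (intro fmeasurable.Un)
  have mD: "measure lebesgue D \<le> e"
    using measure_Un_le[of "A - C" lebesgue "U0 - A"] C(3,4) U0(3) mU0 by (simp add: D_def fmeasurableD)
  have DS: "D \<inter> S \<in> sets (lebesgue_on S)" using D SL by (simp add: sets_restrict_space_iff fmeasurableD sets.Int)
  have pt: "\<bar>indicator A z - \<theta> z\<bar> \<le> indicator (D \<inter> S) z" if "z \<in> S" for z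
    using that \<theta>(2)[of z] \<theta>(3)[of z] \<theta>(4)[of z] K(3)[of z] K(2) U(2,4) C(2)
    by (auto simp: indicator_def D_def U_def abs_le_iff)
  have "(LINT z|lebesgue_on S. \<bar>indicator A z - \<theta> z\<bar>) \<le> (LINT z|lebesgue_on S. indicator (D \<inter> S) z)"
    by (rule integral_mono[OF integrable_abs[OF Bochner_Integration.integrable_diff[OF iA i\<theta>]] ind[OF DS]])
       (use pt in \<open>simp add: space_restrict_space\<close>)
  also have "\<dots> = measure lebesgue (D \<inter> S)"
    using SL by (simp add: Bochner_Integration.integral_indicator space_restrict_space
        measure_restrict_space fmeasurableD Int_assoc)
  also have "\<dots> \<le> measure lebesgue D" using D SL by (intro measure_mono_fmeasurable) (auto simp: fmeasurableD)
  finally have "(LINT z|lebesgue_on S. \<bar>indicator A z - \<theta> z\<bar>) \<le> e" using mD by simp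
  then show "\<exists>G. integrable (lebesgue_on S) G \<and> weakly_null S b G \<and>
       (LINT z|lebesgue_on S. \<bar>indicator A z - G z\<bar>) \<le> e"
    using i\<theta> weakly_null_C1[OF S(1) C1] by blast
qed

text \<open>The functions with this property contain the indicator functions, are closed under linear combinations,
and are closed in \<open>L\<^sup>1\<close> because the derivatives are bounded by \<open>M\<close>.\<close>

proposition weakly_null_integrable:
  fixes S :: "'a::euclidean_space set"
  assumes S: "open S" "bounded S" and F: "integrable (lebesgue_on S) F"
  shows "weakly_null S b F"
  using F
proof (induction rule: integrable_induct)
  case (base A c)
  have "A \<in> sets lebesgue" "A \<subseteq> S" using base(1) S(1) by (auto simp: sets_restrict_space_iff sets.sets_into_space dest: sets.sets_into_space)
  then show ?case using weakly_null_scale[OF weakly_null_indicator[OF S]] by simp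
next
  case (add f g)
  then show ?case using S by (intro weakly_null_add) auto
next
  case (lim f s)
  show ?case
  proof (rule weakly_null_L1_closed[OF _ lim.hyps(4)])
    show "S \<in> sets lebesgue" using S by auto
    fix e :: real assume e: "e > 0"
    have [measurable]: "f \<in> borel_measurable (lebesgue_on S)" "\<And>i. s i \<in> borel_measurable (lebesgue_on S)"
      using lim.hyps by auto
    have "(\<lambda>i. LINT z|lebesgue_on S. \<bar>f z - s i z\<bar>) \<longlonglongrightarrow> (LINT z|lebesgue_on S. 0)"
    proof (rule integral_dominated_convergence[where w = "\<lambda>z. 3 * norm (f z)"])
      show "integrable (lebesgue_on S) (\<lambda>z. 3 * norm (f z))" using lim.hyps(4) by auto
      show "AE z in lebesgue_on S. (\<lambda>i. \<bar>f z - s i z\<bar>) \<longlonglongrightarrow> 0"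
      proof (rule AE_I2)
        fix z assume "z \<in> space (lebesgue_on S)"
        from tendsto_rabs[OF tendsto_diff[OF tendsto_const lim.hyps(2)[OF this]], of "f z"]
        show "(\<lambda>i. \<bar>f z - s i z\<bar>) \<longlonglongrightarrow> 0" by simp
      qed
      show "AE z in lebesgue_on S. norm \<bar>f z - s i z\<bar> \<le> 3 * norm (f z)" for i
      proof (rule AE_I2)
        fix z assume "z \<in> space (lebesgue_on S)"
        from lim.hyps(3)[OF this, of i] show "norm \<bar>f z - s i z\<bar> \<le> 3 * norm (f z)" by simp
      qed
    qed auto
    then have "\<forall>\<^sub>F i in sequentially. (LINT z|lebesgue_on S. \<bar>f z - s i z\<bar>) < e"
      using e by (intro order_tendstoD) auto
    then obtain i where "(LINT z|lebesgue_on S. \<bar>f z - s i z\<bar>) < e"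
      by (auto simp: eventually_sequentially)
    then show "\<exists>G. integrable (lebesgue_on S) G \<and> weakly_null S b G \<and> (LINT z|lebesgue_on S. \<bar>f z - G z\<bar>) \<le> e"
      using lim.hyps(1) lim.IH less_imp_le by blast
  qed
qed

section \<open>Patching perturbations and extracting limits\<close>

text \<open>The accuracy on each piece is divided by the number of pieces because the smallness parameters add up.\<close>

lemma improvable_patching:
  fixes S :: "((real^'n) \<times> real) set" and W :: "(real^'n) \<times> real \<Rightarrow> (real^'n^'m) \<times> (real^'n^'m)"
  assumes "finite I" "open S" "bounded S" "continuous_on S W" and \<Sigma>: "bounded \<Sigma>" "\<And>z. z \<in> S \<Longrightarrow> W z \<in> \<Sigma>"
    and T: "\<And>i. i \<in> I \<Longrightarrow> open (T i)" "\<And>i. i \<in> I \<Longrightarrow> T i \<subseteq> S" "disjoint_family_on T I"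
    and null: "negligible (S - (\<Union>i\<in>I. T i))"
    and imp: "\<And>i. i \<in> I \<Longrightarrow> improvable \<Sigma> K c (T i) W"
  shows "improvable \<Sigma> K c S W"
  unfolding improvable_def
proof (intro allI impI)
  fix \<epsilon> :: real assume \<epsilon>: "\<epsilon> > 0"
  define \<epsilon>' where "\<epsilon>' = \<epsilon> / (real (card I) + 1)"
  have \<epsilon>': "\<epsilon>' > 0" using \<epsilon> by (simp add: \<epsilon>'_def add_nonneg_pos)
  have "\<forall>i\<in>I. \<exists>w. perturbation_field (T i) \<epsilon>' w \<and> (\<forall>z\<in>T i. W z + w z \<in> \<Sigma>) \<and>
        (LINT z|lebesgue_on (T i). infdist (W z + w z) K) \<le> c * measure lebesgue (T i)"
    using imp \<epsilon>' unfolding improvable_def by blast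
  then obtain w where w: "\<And>i. i \<in> I \<Longrightarrow> perturbation_field (T i) \<epsilon>' (w i)"
    "\<And>i z. i \<in> I \<Longrightarrow> z \<in> T i \<Longrightarrow> W z + w i z \<in> \<Sigma>"
    "\<And>i. i \<in> I \<Longrightarrow> (LINT z|lebesgue_on (T i). infdist (W z + w i z) K) \<le> c * measure lebesgue (T i)"
    by (elim bchoice[elim_format]) blast
  define v where "v z = (\<Sum>i\<in>I. w i z)" for z
  have "perturbation_field S (real (card I) * \<epsilon>') v" unfolding v_def
    by (rule perturbation_field_sum[OF assms(1)])
       (use w(1) T(2) \<epsilon>' in \<open>auto intro: perturbation_field_mono\<close>)
  moreover have "real (card I) * \<epsilon>' \<le> \<epsilon>" using \<epsilon> by (simp add: \<epsilon>'_def field_simps)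
  ultimately have v: "perturbation_field S \<epsilon> v" by (rule perturbation_field_mono[OF _ order_refl])
  have v_on: "v z = w i z" if "i \<in> I" "z \<in> T i" for i z
  proof -
    have "w j z = 0" if "j \<in> I - {i}" for j
      by (rule perturbation_field_outside[OF w(1)]) (use that \<open>i \<in> I\<close> \<open>z \<in> T i\<close> T(3) in \<open>auto simp: disjoint_family_on_def\<close>)
    then show ?thesis unfolding v_def using sum.remove[OF assms(1) \<open>i \<in> I\<close>, of "\<lambda>i. w i z"] by simp
  qed
  have v_off: "v z = 0" if "z \<notin> (\<Union>i\<in>I. T i)" for z
    unfolding v_def by (rule sum.neutral) (use that perturbation_field_outside[OF w(1)] in blast)
  have in\<Sigma>: "W z + v z \<in> \<Sigma>" if "z \<in> S" for z
  proof (cases "z \<in> (\<Union>i\<in>I. T i)")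
    case True
    then obtain i where "i \<in> I" "z \<in> T i" by blast
    then show ?thesis using w(2) v_on by simp
  next
    case False then show ?thesis using v_off \<Sigma>(2)[OF that] by simp
  qed
  obtain M where M: "M > 0" "\<And>x. x \<in> \<Sigma> \<Longrightarrow> infdist x K \<le> M" using infdist_bounded_on[OF \<Sigma>(1)] by blast
  define f where "f z = infdist (W z + v z) K" for z
  have "continuous_on S f" unfolding f_def
    by (intro continuous_on_infdist continuous_on_add assms perturbation_field_continuous[OF v])
  then have int: "integrable (lebesgue_on S) f"
    by (rule integrable_continuous_bounded[OF assms(2,3), where B = M])
       (simp add: f_def infdist_nonneg M(2) in\<Sigma>)
  have SL: "S \<in> sets lebesgue" and TL: "\<And>i. i \<in> I \<Longrightarrow> T i \<in> sets lebesgue" using assms(2) T(1) by auto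
  have iT: "integrable lebesgue (\<lambda>z. indicator (T i) z *\<^sub>R f z)" if "i \<in> I" for i
    using integrable_lebesgue_on_subset[OF int SL TL[OF that] T(2)[OF that]] TL[OF that]
    by (subst (asm) integrable_restrict_space) auto
  have iS: "integrable lebesgue (\<lambda>z. indicator S z *\<^sub>R f z)"
    using int SL by (subst (asm) integrable_restrict_space) auto
  have "(LINT z|lebesgue_on S. f z) = (LINT z|lebesgue. indicator S z *\<^sub>R f z)"
    using SL by (subst integral_restrict_space) auto
  also have "\<dots> = (LINT z|lebesgue. (\<Sum>i\<in>I. indicator (T i) z *\<^sub>R f z))"
  proof (rule integral_cong_AE)
    have pt: "indicator S z *\<^sub>R f z = (\<Sum>i\<in>I. indicator (T i) z *\<^sub>R f z)" if "z \<notin> S - (\<Union>i\<in>I. T i)" for z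
    proof (cases "z \<in> (\<Union>i\<in>I. T i)")
      case True
      then obtain i where i: "i \<in> I" "z \<in> T i" by blast
      then have "indicator (T j) z *\<^sub>R f z = 0" if "j \<in> I - {i}" for j
        using that T(3) by (auto simp: disjoint_family_on_def indicator_def)
      then have "(\<Sum>j\<in>I - {i}. indicator (T j) z *\<^sub>R f z) = 0" by (rule sum.neutral[rule_format])
      then have "(\<Sum>i\<in>I. indicator (T i) z *\<^sub>R f z) = indicator (T i) z *\<^sub>R f z"
        using sum.remove[OF assms(1) i(1), of "\<lambda>i. indicator (T i) z *\<^sub>R f z"] by simp
      then show ?thesis using i T(2)[OF i(1)] by (auto simp: indicator_def)
    next
      case False
      then have "z \<notin> S" using that by blast
      moreover have "(\<Sum>i\<in>I. indicator (T i) z *\<^sub>R f z) = 0"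
        by (rule sum.neutral) (use False in auto)
      ultimately show ?thesis by simp
    qed
    have "S - (\<Union>i\<in>I. T i) \<in> null_sets lebesgue" using null by (simp add: negligible_iff_null_sets)
    then show "AE z in lebesgue. indicator S z *\<^sub>R f z = (\<Sum>i\<in>I. indicator (T i) z *\<^sub>R f z)"
      by (rule AE_I') (use pt in auto)
    show "(\<lambda>z. indicator S z *\<^sub>R f z) \<in> borel_measurable lebesgue" using iS by (rule borel_measurable_integrable)
    show "(\<lambda>z. \<Sum>i\<in>I. indicator (T i) z *\<^sub>R f z) \<in> borel_measurable lebesgue"
      by (rule borel_measurable_sum) (use iT in auto)
  qed
  also have "\<dots> = (\<Sum>i\<in>I. LINT z|lebesgue. indicator (T i) z *\<^sub>R f z)"
    by (rule Bochner_Integration.integral_sum[OF iT])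
  also have "\<dots> = (\<Sum>i\<in>I. LINT z|lebesgue_on (T i). f z)"
    by (rule sum.cong[OF refl]) (use TL in \<open>subst integral_restrict_space, auto\<close>)
  also have "\<dots> \<le> (\<Sum>i\<in>I. c * measure lebesgue (T i))"
  proof (rule sum_mono)
    fix i assume i: "i \<in> I"
    have "(LINT z|lebesgue_on (T i). f z) = (LINT z|lebesgue_on (T i). infdist (W z + w i z) K)"
      by (rule Bochner_Integration.integral_cong) (use v_on[OF i] in \<open>auto simp: f_def space_restrict_space\<close>)
    then show "(LINT z|lebesgue_on (T i). f z) \<le> c * measure lebesgue (T i)" using w(3)[OF i] by simp
  qed
  also have "\<dots> = c * measure lebesgue (\<Union>i\<in>I. T i)"
  proof -
    have tl: "T i \<in> lmeasurable" if "i \<in> I" for i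
      using T(1,2)[OF that] assms(3) by (intro lmeasurable_open) (auto intro: bounded_subset)
    have "measure lebesgue (\<Union>i\<in>I. T i) = (\<Sum>i\<in>I. measure lebesgue (T i))"
      by (intro measure_finite_Union assms(1) T(3))
         (use TL fmeasurableD2[OF tl] in \<open>auto simp del: emeasure_completion\<close>)
    then show ?thesis by (simp add: sum_distrib_left)
  qed
  also have "measure lebesgue (\<Union>i\<in>I. T i) = measure lebesgue S"
    by (rule measure_negligible_symdiff)
       (use null T(2) assms(2,3) in \<open>auto intro: negligible_subset lmeasurable_open\<close>)
  finally show "\<exists>w. perturbation_field S \<epsilon> w \<and> (\<forall>z\<in>S. W z + w z \<in> \<Sigma>) \<and>
        (LINT z|lebesgue_on S. infdist (W z + w z) K) \<le> c * measure lebesgue S"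
    using v in\<Sigma> unfolding f_def by blast
qed

text \<open>Every point \<open>x\<close> has a ball on which \<open>W\<close> stays within the tolerance belonging to the value \<open>W x\<close>. By Cousin's
lemma a box containing \<open>S\<close> has a finite division whose members lie in such balls or are disjoint from the
closure of \<open>S\<close>; the interiors of its members cover \<open>S\<close> up to a null set.\<close>

proposition improvable_of_reachable:
  fixes S :: "((real^'n) \<times> real) set" and W :: "(real^'n) \<times> real \<Rightarrow> (real^'n^'m) \<times> (real^'n^'m)"
  assumes S: "open S" "bounded S" and W: "continuous_on (closure S) W" "\<And>z. z \<in> closure S \<Longrightarrow> W z \<in> \<Sigma>"
    and \<Sigma>: "bounded \<Sigma>" and reach: "\<And>\<eta>. \<eta> \<in> \<Sigma> \<Longrightarrow> reachable \<Sigma> K \<eta> c"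
  shows "improvable \<Sigma> K c S W"
proof -
  have "\<forall>x\<in>closure S. \<exists>r>0. \<forall>T. open T \<longrightarrow> T \<subseteq> S \<longrightarrow> T \<subseteq> ball x r \<longrightarrow> improvable \<Sigma> K c T W"
  proof
    fix x assume x: "x \<in> closure S"
    from reach[OF W(2)[OF x], unfolded reachable_def] obtain \<delta> where d: "\<delta> > 0" and
    *: "\<forall>S Wa. open S \<longrightarrow> bounded S \<longrightarrow> continuous_on S Wa \<longrightarrow>
     (\<forall>z\<in>S. norm (Wa z - W x) < \<delta>) \<longrightarrow> improvable \<Sigma> K c S Wa"
      by (elim exE conjE) (rule that)
    obtain r where r: "r > 0" "\<And>z. z \<in> closure S \<Longrightarrow> dist z x < r \<Longrightarrow> dist (W z) (W x) < \<delta>"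
      using W(1) x d unfolding continuous_on_iff by blast
    have "improvable \<Sigma> K c T W" if T: "open T" "T \<subseteq> S" "T \<subseteq> ball x r" for T
    proof (rule *[rule_format, OF T(1)])
      show "bounded T" using S(2) T(2) bounded_subset by blast
      show "continuous_on T W"
        by (rule continuous_on_subset[OF W(1)]) (use T(2) closure_subset[of S] in auto)
      show "norm (W z - W x) < \<delta>" if "z \<in> T" for z
      proof -
        have "z \<in> closure S" "dist z x < r" using that T(2,3) closure_subset[of S] by (auto simp: dist_commute)
        then show ?thesis using r(2) by (simp add: dist_norm)
      qed
    qed
    with r(1) show "\<exists>r>0. \<forall>T. open T \<longrightarrow> T \<subseteq> S \<longrightarrow> T \<subseteq> ball x r \<longrightarrow> improvable \<Sigma> K c T W" by blast
  qed
  from bchoice[OF this] obtain r where r: "\<forall>x\<in>closure S. r x > 0 \<and>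
    (\<forall>T. open T \<longrightarrow> T \<subseteq> S \<longrightarrow> T \<subseteq> ball x (r x) \<longrightarrow> improvable \<Sigma> K c T W)"
    by (elim exE) (rule that)
  obtain a where a: "S \<subseteq> cbox (- a) a" using bounded_subset_cbox_symmetric[OF S(2)] by blast
  define \<gamma> where "\<gamma> x = (if x \<in> closure S then ball x (r x) else - closure S)" for x
  have "gauge \<gamma>" unfolding gauge_def \<gamma>_def using r by auto
  then obtain p where p: "p tagged_division_of cbox (- a) a" "\<gamma> fine p"
    using fine_division_exists by blast
  have fin: "finite p" using p(1) by (rule tagged_division_of_finite)
  define T where "T q = interior (snd q) \<inter> S" for q :: "((real^'n) \<times> real) \<times> ((real^'n) \<times> real) set"
  show ?thesis
  proof (rule improvable_patching[OF fin S, of _ _ T])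
    show "continuous_on S W" by (rule continuous_on_subset[OF W(1) closure_subset])
    show "bounded \<Sigma>" by fact
    show "W z \<in> \<Sigma>" if "z \<in> S" for z by (rule W(2)) (use that closure_subset[of S] in auto)
    show "open (T i)" "T i \<subseteq> S" for i using S(1) by (auto simp: T_def)
    show "disjoint_family_on T p"
      unfolding disjoint_family_on_def T_def using tagged_division_ofD(5)[OF p(1)] by fastforce
    show "negligible (S - \<Union> (T ` p))"
    proof (rule negligible_subset)
      have "negligible (snd q - interior (snd q))" if q: "q \<in> p" for q
      proof -
        obtain b c where "snd q = cbox b c"
          using tagged_division_ofD(4)[OF p(1), of "fst q" "snd q"] q by auto
        then show ?thesis by (simp add: negligible_frontier_interval interior_cbox)
      qed
      then show "negligible (\<Union>q\<in>p. snd q - interior (snd q))"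
        using fin by (intro negligible_Union) auto
      show "S - \<Union> (T ` p) \<subseteq> (\<Union>q\<in>p. snd q - interior (snd q))"
      proof
        fix z assume z: "z \<in> S - \<Union> (T ` p)"
        then have "z \<in> \<Union> {k. \<exists>x. (x, k) \<in> p}" using a tagged_division_ofD(6)[OF p(1)] by auto
        then obtain x k where xk: "(x, k) \<in> p" "z \<in> k" by blast
        then have "z \<notin> interior k" using z by (force simp: T_def)
        then show "z \<in> (\<Union>q\<in>p. snd q - interior (snd q))" using xk by force
      qed
    qed
    show "improvable \<Sigma> K c (T q) W" if q: "q \<in> p" for q
    proof (cases "fst q \<in> closure S")
      case True
      have "snd q \<subseteq> \<gamma> (fst q)" using fineD[OF p(2), of "fst q" "snd q"] q by simp
      then have "T q \<subseteq> ball (fst q) (r (fst q))" using interior_subset[of "snd q"] True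
        by (auto simp: T_def \<gamma>_def)
      moreover have "open (T q)" "T q \<subseteq> S" using S(1) by (auto simp: T_def)
      ultimately show ?thesis using r True by blast
    next
      case False
      have "snd q \<subseteq> \<gamma> (fst q)" using fineD[OF p(2), of "fst q" "snd q"] q by simp
      then have "T q = {}" using False interior_subset[of "snd q"] closure_subset[of S] by (auto simp: T_def \<gamma>_def)
      moreover have "(LINT z|lebesgue_on {}. f z) = 0" for f :: "(real^'n) \<times> real \<Rightarrow> real"
        by (subst integral_restrict_space) auto
      ultimately show ?thesis unfolding improvable_def
        by (intro allI impI exI[of _ "\<lambda>_. 0"]) (simp add: perturbation_field_zero)
    qed
  qed
qed

text \<open>Along a subsequence with squared increments of integral at most \<open>4\<^sup>-\<^sup>n\<close>, the series with terms \<open>2\<^sup>n d\<^sub>n\<^sup>2\<close>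
converges almost everywhere, and \<open>2 d\<^sub>n \<le> 2\<^sup>-\<^sup>n + 2\<^sup>n d\<^sub>n\<^sup>2\<close>.\<close>

lemma L2_Cauchy_AE_subsequence:
  fixes f :: "nat \<Rightarrow> 'a \<Rightarrow> 'b::euclidean_space"
  assumes int: "\<And>k l. integrable M (\<lambda>z. (norm (f l z - f k z))\<^sup>2)"
    and Cauchy: "\<And>\<eta>. \<eta> > 0 \<Longrightarrow> \<exists>N. \<forall>k\<ge>N. \<forall>l\<ge>k. (LINT z|M. (norm (f l z - f k z))\<^sup>2) \<le> \<eta>"
  obtains r :: "nat \<Rightarrow> nat" where "strict_mono r" "AE z in M. convergent (\<lambda>n. f (r n) z)"
proof -
  have "\<forall>n. \<exists>N. \<forall>k\<ge>N. \<forall>l\<ge>k. (LINT z|M. (norm (f l z - f k z))\<^sup>2) \<le> 1 / 4 ^ n"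
    using Cauchy by simp
  then obtain N where N: "\<And>n k l. k \<ge> N n \<Longrightarrow> l \<ge> k \<Longrightarrow> (LINT z|M. (norm (f l z - f k z))\<^sup>2) \<le> 1 / 4 ^ n"
    by metis
  define r where "r = rec_nat (N 0) (\<lambda>n p. max (Suc p) (N (Suc n)))"
  have r_Suc: "r (Suc n) = max (Suc (r n)) (N (Suc n))" for n by (simp add: r_def)
  have r: "strict_mono r" unfolding strict_mono_Suc_iff r_Suc by (auto simp: less_max_iff_disj)
  have rN: "r n \<ge> N n" for n by (cases n) (simp_all add: r_Suc, simp add: r_def)
  define d where "d n z = norm (f (r (Suc n)) z - f (r n) z)" for n z
  have id: "integrable M (\<lambda>z. 2 ^ n * (d n z)\<^sup>2)" for n using int unfolding d_def by simp
  have Id: "(LINT z|M. 2 ^ n * (d n z)\<^sup>2) \<le> (1 / 2) ^ n" for n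
  proof -
    have "(LINT z|M. (d n z)\<^sup>2) \<le> 1 / 4 ^ n" unfolding d_def
      by (rule N[OF rN]) (simp add: r_Suc)
    then have "2 ^ n * (LINT z|M. (d n z)\<^sup>2) \<le> 2 ^ n * (1 / 4 ^ n)" by (intro mult_left_mono) auto
    also have "\<dots> = (1 / 2) ^ n" by (simp add: power_one_over field_simps flip: power_mult_distrib)
    finally show ?thesis by simp
  qed
  have [measurable]: "(\<lambda>z. 2 ^ n * (d n z)\<^sup>2) \<in> borel_measurable M" for n using id by (rule borel_measurable_integrable)
  have "(\<integral>\<^sup>+z. (\<Sum>n. ennreal (2 ^ n * (d n z)\<^sup>2)) \<partial>M) = (\<Sum>n. \<integral>\<^sup>+z. ennreal (2 ^ n * (d n z)\<^sup>2) \<partial>M)"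
    by (rule nn_integral_suminf) simp
  also have "\<dots> \<le> (\<Sum>n. ennreal ((1 / 2) ^ n))"
  proof (rule suminf_le)
    show "(\<integral>\<^sup>+z. ennreal (2 ^ n * (d n z)\<^sup>2) \<partial>M) \<le> ennreal ((1 / 2) ^ n)" for n
    proof -
      have "(\<integral>\<^sup>+z. ennreal (2 ^ n * (d n z)\<^sup>2) \<partial>M) = ennreal (LINT z|M. 2 ^ n * (d n z)\<^sup>2)"
        by (rule nn_integral_eq_integral[OF id]) simp
      then show ?thesis using ennreal_leI[OF Id] by (simp only:)
    qed
  qed auto
  also have "\<dots> = ennreal (\<Sum>n. (1 / 2) ^ n)"
    by (rule suminf_ennreal2) (auto intro!: summable_geometric)
  also have "\<dots> < \<infinity>" by simp
  finally have "AE z in M. (\<Sum>n. ennreal (2 ^ n * (d n z)\<^sup>2)) \<noteq> \<infinity>"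
    by (intro nn_integral_noteq_infinite) auto
  then have "AE z in M. convergent (\<lambda>n. f (r n) z)"
  proof (rule AE_mp, intro AE_I2 impI)
    fix z assume fin: "(\<Sum>n. ennreal (2 ^ n * (d n z)\<^sup>2)) \<noteq> \<infinity>"
    have s1: "summable (\<lambda>n. 2 ^ n * (d n z)\<^sup>2)"
      by (rule summable_suminf_not_top) (use fin in auto)
    have "summable (\<lambda>n. (1 / 2) ^ n + 2 ^ n * (d n z)\<^sup>2)"
      by (intro summable_add s1 summable_geometric) auto
    then have "summable (\<lambda>n. f (r (Suc n)) z - f (r n) z)"
    proof (rule summable_comparison_test'[where N = 0])
      fix n
      have "0 \<le> (1 - 2 ^ n * d n z)\<^sup>2" by simp
      then have "2 ^ n * (2 * d n z) \<le> 2 ^ n * ((1 / 2) ^ n + 2 ^ n * (d n z)\<^sup>2)"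
        by (simp add: power2_eq_square algebra_simps power_one_over)
      then have "2 * d n z \<le> (1 / 2) ^ n + 2 ^ n * (d n z)\<^sup>2" by (rule mult_left_le_imp_le) simp
      moreover have "d n z \<ge> 0" by (simp add: d_def)
      ultimately have "d n z \<le> (1 / 2) ^ n + 2 ^ n * (d n z)\<^sup>2" by linarith
      then show "norm (f (r (Suc n)) z - f (r n) z) \<le> (1 / 2) ^ n + 2 ^ n * (d n z)\<^sup>2"
        unfolding d_def .
    qed
    then have "convergent (\<lambda>n. \<Sum>i<n. f (r (Suc i)) z - f (r i) z)" by (simp add: summable_iff_convergent)
    then have "convergent (\<lambda>n. f (r n) z - f (r 0) z)"
      using sum_lessThan_telescope[of "\<lambda>n. f (r n) z"] by simp
    then show "convergent (\<lambda>n. f (r n) z)" by (simp add: convergent_diff_const_right_iff)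
  qed
  with r show ?thesis by (rule that)
qed

lemma field_component_le:
  fixes x :: "'a::real_normed_vector \<times> (real^'n^'m)" and y :: "(real^'n^'m) \<times> 'b::real_normed_vector"
  shows "\<bar>snd x $ i $ k\<bar> \<le> norm x" "\<bar>fst y $ i $ k\<bar> \<le> norm y"
proof -
  have c: "\<bar>A $ i $ k\<bar> \<le> norm A" for A :: "real^'n^'m"
    using component_le_norm_cart[of "A $ i" k] Finite_Cartesian_Product.norm_nth_le[of A i] by linarith
  show "\<bar>snd x $ i $ k\<bar> \<le> norm x" using c[of "snd x"] norm_snd_le[of "snd x" "fst x"] by simp
  show "\<bar>fst y $ i $ k\<bar> \<le> norm y" using c[of "fst y"] norm_fst_le[of "fst y" "snd y"] by simp
qed

lemma perturbation_weakly_small: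
  fixes S :: "((real^'n) \<times> real) set" and F :: "(real^'n) \<times> real \<Rightarrow> (real^'n^'m) \<times> (real^'n^'m)"
  assumes S: "open S" "bounded S" and F: "integrable (lebesgue_on S) F" and "M > 0" "e > 0"
  obtains \<epsilon> where "\<epsilon> > 0" "\<And>w. perturbation_field S \<epsilon> w \<Longrightarrow> (\<And>z. z \<in> S \<Longrightarrow> norm (w z) \<le> M) \<Longrightarrow>
    \<bar>LINT z|lebesgue_on S. F z \<bullet> w z\<bar> \<le> e"
proof -
  define e' where "e' = e / (2 * real CARD('m) * real CARD('n))"
  have e': "e' > 0" using assms(5) by (simp add: e'_def)
  have iF: "integrable (lebesgue_on S) (\<lambda>z. fst (F z) $ i $ k)" "integrable (lebesgue_on S) (\<lambda>z. snd (F z) $ i $ k)" for i k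
    using F by (auto intro!: integrable_bounded_linear[of "\<lambda>x. fst x $ i $ k"] integrable_bounded_linear[of "\<lambda>x. snd x $ i $ k"]
      bounded_linear_intros bounded_linear_compose[OF bounded_linear_vec_nth] bounded_linear_fst bounded_linear_snd)
  let ?T = "\<lambda>G b. weakly_null_at S b G M e'"
  have ex: "\<exists>\<epsilon>>0. ?T G b \<epsilon>" if "integrable (lebesgue_on S) G" for G b
    using weakly_null_integrable[OF S that, of b, unfolded weakly_null_def] assms(4) e' by blast
  have "\<forall>i k. \<exists>\<epsilon>>0. ?T (\<lambda>z. fst (F z) $ i $ k) (e_x k) \<epsilon>" using ex iF(1) by blast
  then obtain \<epsilon>1 where \<epsilon>1: "\<And>i k. \<epsilon>1 i k > 0" "\<And>i k. ?T (\<lambda>z. fst (F z) $ i $ k) (e_x k) (\<epsilon>1 i k)"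
    by metis
  have "\<forall>i k. \<exists>\<epsilon>>0. ?T (\<lambda>z. snd (F z) $ i $ k) e_t \<epsilon>" using ex iF(2) by blast
  then obtain \<epsilon>2 where \<epsilon>2: "\<And>i k. \<epsilon>2 i k > 0" "\<And>i k. ?T (\<lambda>z. snd (F z) $ i $ k) e_t (\<epsilon>2 i k)"
    by metis
  define \<epsilon> where "\<epsilon> = Min (range (\<lambda>(i, k). min (\<epsilon>1 i k) (\<epsilon>2 i k)))"
  have "\<epsilon> \<in> range (\<lambda>(i, k). min (\<epsilon>1 i k) (\<epsilon>2 i k))" unfolding \<epsilon>_def by (rule Min_in) auto
  then have "\<epsilon> > 0" using \<epsilon>1(1) \<epsilon>2(1) by auto
  have \<epsilon>le: "\<epsilon> \<le> \<epsilon>1 i k" "\<epsilon> \<le> \<epsilon>2 i k" for i k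
    using Min_le[of "range (\<lambda>(i, k). min (\<epsilon>1 i k) (\<epsilon>2 i k))" "min (\<epsilon>1 i k) (\<epsilon>2 i k)"]
    unfolding \<epsilon>_def by (auto simp: image_iff)
  have "\<bar>LINT z|lebesgue_on S. F z \<bullet> w z\<bar> \<le> e"
    if w: "perturbation_field S \<epsilon> w" "\<And>z. z \<in> S \<Longrightarrow> norm (w z) \<le> M" for w
  proof -
    obtain y y' where y: "perturbation S \<epsilon> y y'" and wy: "w = (\<lambda>z. field (y' z))"
      using w(1) unfolding perturbation_field_def by blast
    have C1: "C1_compact UNIV y y'" using y C1_compact_mono unfolding perturbation_def by blast
    have ny: "norm (y z) \<le> \<epsilon>" for z using y unfolding perturbation_def by blast
    have SL: "S \<in> sets lebesgue" using S by auto
    have w1: "fst (w z) $ i $ k = fst (y' z (e_x k)) $ i" and w2: "snd (w z) $ i $ k = snd (y' z e_t) $ i $ k" for z i k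
      by (simp_all add: wy field_def)
    have cw: "\<bar>fst (w z) $ i $ k\<bar> \<le> norm (w z)" "\<bar>snd (w z) $ i $ k\<bar> \<le> norm (w z)" for z i k
      by (rule field_component_le)+
    have bw: "\<bar>fst (y' z (e_x k)) $ i\<bar> \<le> M" "\<bar>snd (y' z e_t) $ i $ k\<bar> \<le> M" if "z \<in> S" for z i k
      unfolding w1[symmetric] w2[symmetric] by (rule order_trans[OF cw(1) w(2)[OF that]], rule order_trans[OF cw(2) w(2)[OF that]])
    have b1: "C1_compact UNIV (\<lambda>z. fst (y z) $ i) (\<lambda>z v. fst (y' z v) $ i)" for i
      by (rule C1_compact_bounded_linear[OF C1]) (auto intro!: bounded_linear_compose[OF bounded_linear_vec_nth] bounded_linear_fst)
    have b2: "C1_compact UNIV (\<lambda>z. snd (y z) $ i $ k) (\<lambda>z v. snd (y' z v) $ i $ k)" for i k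
      by (rule C1_compact_bounded_linear[OF C1]) (auto intro!: bounded_linear_compose[OF bounded_linear_vec_nth] bounded_linear_snd)
    have I1: "\<bar>LINT z|lebesgue_on S. fst (F z) $ i $ k * fst (w z) $ i $ k\<bar> \<le> e'" for i k
      unfolding w1
    proof (rule \<epsilon>1(2)[unfolded weakly_null_at_def, THEN spec, THEN spec, THEN mp, OF b1, THEN mp, THEN mp])
      show "\<forall>z. \<bar>fst (y z) $ i\<bar> \<le> \<epsilon>1 i k"
      proof
        fix z
        have "\<bar>fst (y z) $ i\<bar> \<le> norm (y z)"
          using component_le_norm_cart[of "fst (y z)" i] norm_fst_le[of "fst (y z)" "snd (y z)"] by simp
        then show "\<bar>fst (y z) $ i\<bar> \<le> \<epsilon>1 i k" using ny[of z] \<epsilon>le(1)[of i k] by linarith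
      qed
      show "\<forall>z\<in>S. \<bar>fst (y' z (e_x k)) $ i\<bar> \<le> M"
        using bw by blast
    qed
    have I2: "\<bar>LINT z|lebesgue_on S. snd (F z) $ i $ k * snd (w z) $ i $ k\<bar> \<le> e'" for i k
      unfolding w2
    proof (rule \<epsilon>2(2)[unfolded weakly_null_at_def, THEN spec, THEN spec, THEN mp, OF b2, THEN mp, THEN mp])
      show "\<forall>z. \<bar>snd (y z) $ i $ k\<bar> \<le> \<epsilon>2 i k"
        using field_component_le(1)[of "y _" i k] ny \<epsilon>le(2)[of i k] by (meson order_trans)
      show "\<forall>z\<in>S. \<bar>snd (y' z e_t) $ i $ k\<bar> \<le> M"
        using bw by blast
    qed
    have i1: "integrable (lebesgue_on S) (\<lambda>z. fst (F z) $ i $ k * fst (w z) $ i $ k)" for i k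
      unfolding w1 by (rule integrable_mult_bounded[OF iF(1) C1_compact_measurable_derivative[OF b1 SL], where B = M])
        (simp add: bw space_restrict_space)
    have i2: "integrable (lebesgue_on S) (\<lambda>z. snd (F z) $ i $ k * snd (w z) $ i $ k)" for i k
      unfolding w2 by (rule integrable_mult_bounded[OF iF(2) C1_compact_measurable_derivative[OF b2 SL], where B = M])
        (simp add: bw space_restrict_space)
    have "(LINT z|lebesgue_on S. F z \<bullet> w z) = (LINT z|lebesgue_on S. (\<Sum>i\<in>UNIV. \<Sum>k\<in>UNIV. fst (F z) $ i $ k * fst (w z) $ i $ k)
       + (\<Sum>i\<in>UNIV. \<Sum>k\<in>UNIV. snd (F z) $ i $ k * snd (w z) $ i $ k))"
      by (simp add: inner_prod_def inner_vec_def)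
    also have "\<dots> = (\<Sum>i\<in>UNIV. \<Sum>k\<in>UNIV. LINT z|lebesgue_on S. fst (F z) $ i $ k * fst (w z) $ i $ k)
       + (\<Sum>i\<in>UNIV. \<Sum>k\<in>UNIV. LINT z|lebesgue_on S. snd (F z) $ i $ k * snd (w z) $ i $ k)"
      using i1 i2 by simp
    also have "\<bar>\<dots>\<bar> \<le> (\<Sum>i\<in>(UNIV::'m set). \<Sum>k\<in>(UNIV::'n set). e') + (\<Sum>i\<in>(UNIV::'m set). \<Sum>k\<in>(UNIV::'n set). e')"
      by (intro order_trans[OF abs_triangle_ineq] add_mono order_trans[OF sum_abs] sum_mono I1 I2)
    also have "\<dots> = e" by (simp add: e'_def)
    finally show ?thesis .
  qed
  with \<open>\<epsilon> > 0\<close> show ?thesis by (rule that)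
qed

section \<open>The iteration\<close>

text \<open>The state of the iteration is the current field \<open>W\<^sub>k\<close> together with a number \<open>e\<^sub>k > 0\<close> such that all
later perturbations of size at most \<open>e\<^sub>k\<close> are nearly orthogonal to \<open>W\<^sub>k\<close> in \<open>L\<^sup>2\<close>. The step from \<open>k\<close> to \<open>k + 1\<close>
uses size \<open>e\<^sub>k / 2\<close> and the next number is at most \<open>e\<^sub>k / 2\<close>, so that \<open>W\<^sub>l - W\<^sub>k\<close> has size at most \<open>e\<^sub>k\<close> for all
\<open>l \<ge> k\<close>. With \<open>J\<^sub>k\<close> the squared norm of \<open>W\<^sub>k\<close> this gives
\<open>\<bar>W\<^sub>l - W\<^sub>k\<bar>\<^sup>2 \<le> J\<^sub>l - J\<^sub>k + 2 / 2\<^sup>k\<close>. Up to a summable error the \<open>J\<^sub>k\<close> increase, and they are bounded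
because \<open>\<Sigma>\<close> is; so the fields form a Cauchy sequence. The mean distance from \<open>K\<close> tends to zero, hence the
limit takes its values in \<open>K\<close>.\<close>

proposition convex_integration_of_fields:
  fixes S :: "((real^'n) \<times> real) set" and W0 :: "(real^'n) \<times> real \<Rightarrow> (real^'n^'m) \<times> (real^'n^'m)"
  assumes S: "open S" "bounded S" and \<Sigma>: "bounded \<Sigma>" and K: "closed K" "K \<noteq> {}"
    and reach: "\<And>\<eta> c. \<eta> \<in> \<Sigma> \<Longrightarrow> c > 0 \<Longrightarrow> reachable \<Sigma> K \<eta> c"
    and W0: "continuous_on (closure S) W0" "\<And>z. z \<in> closure S \<Longrightarrow> W0 z \<in> \<Sigma>" and \<epsilon>: "\<epsilon> > 0"
  obtains Y Y' and r :: "nat \<Rightarrow> nat" and Winf where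
    "\<forall>k. perturbation S (\<epsilon> / 2 ^ Suc k) (Y k) (Y' k)"
    "\<forall>k. \<forall>z\<in>closure S. W0 z + (\<Sum>j<k. field (Y' j z)) \<in> \<Sigma>"
    "strict_mono r" "Winf \<in> borel_measurable (lebesgue_on S)"
    "AE z in lebesgue_on S. (\<lambda>n. W0 z + (\<Sum>j<r n. field (Y' j z))) \<longlonglongrightarrow> Winf z \<and> Winf z \<in> K"
proof -
  have SL: "S \<in> lmeasurable" using S by (simp add: lmeasurable_open)
  interpret finite_measure "lebesgue_on S" using SL by (rule finite_measure_lebesgue_on)
  obtain B where B: "B > 0" "\<And>x. x \<in> \<Sigma> \<Longrightarrow> norm x \<le> B" using \<Sigma> unfolding bounded_pos by blast
  obtain M where M: "M > 0" "\<And>x. x \<in> \<Sigma> \<Longrightarrow> infdist x K \<le> M" using infdist_bounded_on[OF \<Sigma>] by blast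
  \<comment> \<open>\<open>insens k W e\<close>: the field \<open>W\<close> hardly notices perturbations of size \<open>e\<close>.\<close>
  define insens where "insens k W e \<longleftrightarrow> (\<forall>w. perturbation_field S e w \<longrightarrow> (\<forall>z\<in>S. W z + w z \<in> \<Sigma>) \<longrightarrow>
      \<bar>LINT z|lebesgue_on S. W z \<bullet> w z\<bar> \<le> 1 / 2 ^ k)" for k :: nat and W and e :: real
  have contS: "continuous_on S W" if "continuous_on (closure S) W" for W :: "(real^'n) \<times> real \<Rightarrow> (real^'n^'m) \<times> (real^'n^'m)"
    by (rule continuous_on_subset[OF that closure_subset])
  have inS: "z \<in> S \<Longrightarrow> z \<in> closure S" for z using closure_subset by auto
  have threshold: "\<exists>e0>0. \<forall>e\<le>e0. insens k W e"
    if W: "continuous_on (closure S) W" "\<forall>z\<in>closure S. W z \<in> \<Sigma>" for k W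
  proof -
    have iW: "integrable (lebesgue_on S) W"
      by (rule integrable_continuous_bounded[OF S contS[OF W(1)], where B = B]) (use B(2) W(2) inS in auto)
    obtain e0 where e0: "e0 > 0" "\<And>w. perturbation_field S e0 w \<Longrightarrow> (\<And>z. z \<in> S \<Longrightarrow> norm (w z) \<le> 2 * B) \<Longrightarrow>
      \<bar>LINT z|lebesgue_on S. W z \<bullet> w z\<bar> \<le> 1 / 2 ^ k"
      using perturbation_weakly_small[OF S iW, of "2 * B" "1 / 2 ^ k"] B(1) by auto
    have "insens k W e" if e: "e \<le> e0" for e
      unfolding insens_def
    proof (intro allI impI)
      fix w assume w: "perturbation_field S e w" "\<forall>z\<in>S. W z + w z \<in> \<Sigma>"
      show "\<bar>LINT z|lebesgue_on S. W z \<bullet> w z\<bar> \<le> 1 / 2 ^ k"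
      proof (rule e0(2)[OF perturbation_field_mono[OF w(1) order_refl e]])
        fix z assume z: "z \<in> S"
        have "norm ((W z + w z) - W z) \<le> norm (W z + w z) + norm (W z)" by (rule norm_triangle_ineq4)
        also have "\<dots> \<le> B + B" using B(2) w(2) W(2) z inS by (intro add_mono) auto
        finally show "norm (w z) \<le> 2 * B" by simp
      qed
    qed
    with e0(1) show ?thesis by blast
  qed
  define good where "good k x \<longleftrightarrow> (k = 0 \<longrightarrow> fst x = W0) \<and> continuous_on (closure S) (fst x) \<and> (\<forall>z\<in>closure S. fst x z \<in> \<Sigma>) \<and>
     0 < snd x \<and> snd x \<le> \<epsilon> / 2 ^ k \<and> insens k (fst x) (snd x) \<and>
     (k > 0 \<longrightarrow> (LINT z|lebesgue_on S. infdist (fst x z) K) \<le> 1 / 2 ^ k)" for k :: nat and x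
  define step where "step x x' \<longleftrightarrow> snd x' \<le> snd x / 2 \<and>
     (\<exists>y y'. perturbation S (snd x / 2) y y' \<and> fst x' = (\<lambda>z. fst x z + field (y' z)))"
    for x x' :: "((real^'n) \<times> real \<Rightarrow> (real^'n^'m) \<times> (real^'n^'m)) \<times> real"
  have start: "\<exists>x. good 0 x"
  proof -
    obtain e0 where "e0 > 0" "\<forall>e\<le>e0. insens 0 W0 e" using threshold[OF W0(1)] W0(2) by blast
    then show ?thesis using W0 \<epsilon> by (intro exI[of _ "(W0, min e0 \<epsilon>)"]) (auto simp: good_def)
  qed
  have next_step: "\<exists>x'. good (Suc k) x' \<and> step x x'" if "good k x" for k x
  proof -
    have x: "continuous_on (closure S) (fst x)" "\<forall>z\<in>closure S. fst x z \<in> \<Sigma>" "snd x > 0" "snd x \<le> \<epsilon> / 2 ^ k"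
      using that unfolding good_def by auto
    define c where "c = 1 / 2 ^ Suc k / (measure lebesgue S + 1)"
    have m1: "measure lebesgue S + 1 > 0" by (simp add: add_nonneg_pos)
    then have c: "c > 0" by (simp add: c_def)
    have "measure lebesgue S / (measure lebesgue S + 1) \<le> 1" using m1 by simp
    then have "1 / 2 ^ Suc k * (measure lebesgue S / (measure lebesgue S + 1)) \<le> 1 / 2 ^ Suc k * 1"
      by (rule mult_left_mono) simp
    then have cm: "c * measure lebesgue S \<le> 1 / 2 ^ Suc k" by (simp add: c_def)
    have "improvable \<Sigma> K c S (fst x)"
      by (rule improvable_of_reachable[OF S x(1) _ \<Sigma> reach[OF _ c]]) (use x(2) in auto)
    then obtain w where w: "perturbation_field S (snd x / 2) w" "\<forall>z\<in>S. fst x z + w z \<in> \<Sigma>"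
      "(LINT z|lebesgue_on S. infdist (fst x z + w z) K) \<le> c * measure lebesgue S"
      using x(3) unfolding improvable_def by (meson half_gt_zero)
    obtain y y' where y: "perturbation S (snd x / 2) y y'" "w = (\<lambda>z. field (y' z))"
      using w(1) unfolding perturbation_field_def by blast
    define W' where "W' z = fst x z + w z" for z
    have W': "continuous_on (closure S) W'" unfolding W'_def
      by (rule continuous_on_add[OF x(1) perturbation_field_continuous[OF w(1)]])
    have W'\<Sigma>: "\<forall>z\<in>closure S. W' z \<in> \<Sigma>"
    proof
      fix z assume "z \<in> closure S"
      then show "W' z \<in> \<Sigma>" using w(2) x(2) perturbation_field_outside[OF w(1), of z]
        by (cases "z \<in> S") (auto simp: W'_def)
    qed
    obtain e0 where e0: "e0 > 0" "\<forall>e\<le>e0. insens (Suc k) W' e" using threshold[OF W' W'\<Sigma>] by blast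
    have "good (Suc k) (W', min e0 (snd x / 2))"
      unfolding good_def using W' W'\<Sigma> e0 x(3,4) w(3) cm by (auto simp: W'_def)
    moreover have "step x (W', min e0 (snd x / 2))"
    proof -
      have "W' = (\<lambda>z. fst x z + field (y' z))" by (simp add: fun_eq_iff W'_def y(2))
      then show ?thesis unfolding step_def using y(1) by auto
    qed
    ultimately show ?thesis by blast
  qed
  obtain X where X: "\<And>k. good k (X k)" "\<And>k. step (X k) (X (Suc k))"
    using dependent_nat_choice[of good "\<lambda>_. step", OF start next_step] by blast
  define W where "W k = fst (X k)" for k
  define e where "e k = snd (X k)" for k
  have e: "0 < e k" "e k \<le> \<epsilon> / 2 ^ k" "e (Suc k) \<le> e k / 2" for k
    using X(1)[of k] X(2)[of k] by (auto simp: good_def step_def e_def)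
  have W: "W 0 = W0" "continuous_on (closure S) (W k)" "\<And>z. z \<in> closure S \<Longrightarrow> W k z \<in> \<Sigma>" "insens k (W k) (e k)"
    "k > 0 \<Longrightarrow> (LINT z|lebesgue_on S. infdist (W k z) K) \<le> 1 / 2 ^ k" for k
    using X(1)[of k] X(1)[of 0] by (auto simp: good_def W_def e_def)
  have "\<forall>k. \<exists>y y'. perturbation S (e k / 2) y y' \<and> W (Suc k) = (\<lambda>z. W k z + field (y' z))"
    using X(2) by (auto simp: step_def W_def e_def)
  then obtain Y Y' where Y: "\<And>k. perturbation S (e k / 2) (Y k) (Y' k)" "\<And>k. W (Suc k) = (\<lambda>z. W k z + field (Y' k z))"
    by metis
  have W_sum: "W k z = W0 z + (\<Sum>j<k. field (Y' j z))" for k z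
    by (induction k) (auto simp: W(1) Y(2))
  have diff: "perturbation_field S (e k - e l) (\<lambda>z. W l z - W k z)" if "k \<le> l" for k l
    using that
  proof (induction l rule: dec_induct)
    case base show ?case by (simp add: perturbation_field_zero)
  next
    case (step l)
    have "perturbation_field S (e l / 2) (\<lambda>z. field (Y' l z))"
      unfolding perturbation_field_def using Y(1) by blast
    from perturbation_field_add[OF step.IH this]
    have "perturbation_field S (e k - e l + e l / 2) (\<lambda>z. W (Suc l) z - W k z)"
      by (simp add: Y(2) algebra_simps)
    then show ?case by (rule perturbation_field_mono[OF _ order_refl]) (use e(3)[of l] in linarith)
  qed
  have orth: "\<bar>LINT z|lebesgue_on S. W k z \<bullet> (W l z - W k z)\<bar> \<le> 1 / 2 ^ k" if "k \<le> l" for k l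
  proof -
    have "perturbation_field S (e k) (\<lambda>z. W l z - W k z)"
      by (rule perturbation_field_mono[OF diff[OF that] order_refl]) (use e(1)[of l] in simp)
    then show ?thesis using W(4)[of k] W(3)[of _ l] inS unfolding insens_def by simp
  qed
  have nW: "norm (W k z) \<le> B" if "z \<in> S" for k z using B(2) W(3) inS[OF that] by blast
  note cW = contS[OF W(2)]
  have iWW: "integrable (lebesgue_on S) (\<lambda>z. W k z \<bullet> W l z)" for k l
    by (rule integrable_continuous_bounded[OF S continuous_on_inner[OF cW cW], where B = "B * B"])
       (use nW B(1) Cauchy_Schwarz_ineq2 in \<open>auto intro!: order_trans[OF Cauchy_Schwarz_ineq2] mult_mono\<close>)
  define J where "J k = (LINT z|lebesgue_on S. W k z \<bullet> W k z)" for k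
  have expand: "(norm (W l z - W k z))\<^sup>2 = W l z \<bullet> W l z - W k z \<bullet> W k z - 2 * (W k z \<bullet> W l z - W k z \<bullet> W k z)" for k l z
    by (simp add: power2_norm_eq_inner inner_diff_left inner_diff_right inner_commute)
  have iN: "integrable (lebesgue_on S) (\<lambda>z. (norm (W l z - W k z))\<^sup>2)" for k l
    unfolding expand using iWW by auto
  have energy: "(LINT z|lebesgue_on S. (norm (W l z - W k z))\<^sup>2) \<le> J l - J k + 2 / 2 ^ k" if "k \<le> l" for k l
  proof -
    have "(LINT z|lebesgue_on S. (norm (W l z - W k z))\<^sup>2) =
       J l - J k - 2 * ((LINT z|lebesgue_on S. W k z \<bullet> W l z) - (LINT z|lebesgue_on S. W k z \<bullet> W k z))"
      unfolding expand J_def using iWW by simp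
    also have "(LINT z|lebesgue_on S. W k z \<bullet> W l z) - (LINT z|lebesgue_on S. W k z \<bullet> W k z) =
       (LINT z|lebesgue_on S. W k z \<bullet> (W l z - W k z))"
      using iWW by (simp add: inner_diff_right)
    finally show ?thesis using orth[OF that] by (simp add: abs_le_iff)
  qed
  define J' where "J' k = J k - 4 / 2 ^ k" for k
  have "incseq J'"
  proof (rule incseq_SucI)
    fix k
    have "0 \<le> (LINT z|lebesgue_on S. (norm (W (Suc k) z - W k z))\<^sup>2)" by simp
    moreover have "4 / (2::real) ^ Suc k = 4 / 2 ^ k - 2 / 2 ^ k" by (simp add: field_simps)
    ultimately show "J' k \<le> J' (Suc k)" using energy[of k "Suc k"] unfolding J'_def by linarith
  qed
  moreover have "J' k \<le> B * B * measure lebesgue S" for k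
  proof -
    have "J k \<le> B * B * measure lebesgue S" unfolding J_def
      by (rule integral_le_const_lebesgue_on[OF SL iWW])
         (use nW B(1) in \<open>auto intro!: mult_mono simp: norm_eq_sqrt_inner[symmetric] power2_norm_eq_inner[symmetric] power2_eq_square\<close>)
    moreover have "0 \<le> 4 / (2::real) ^ k" by simp
    ultimately show ?thesis unfolding J'_def by linarith
  qed
  ultimately obtain L where L: "J' \<longlonglongrightarrow> L" using incseq_convergent by blast
  have "(\<lambda>k. 1 / 2 ^ k :: real) \<longlonglongrightarrow> 0"
    using LIMSEQ_inverse_realpow_zero[of 2] by (simp add: divide_inverse)
  note lim2 = this
  have "(\<lambda>k. J' k + 4 * (1 / 2 ^ k)) \<longlonglongrightarrow> L + 4 * 0" by (intro tendsto_intros L lim2)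
  then have JL: "J \<longlonglongrightarrow> L" by (simp add: J'_def)
  have cauchy: "\<exists>N. \<forall>k\<ge>N. \<forall>l\<ge>k. (LINT z|lebesgue_on S. (norm (W l z - W k z))\<^sup>2) \<le> \<eta>" if \<eta>: "\<eta> > 0" for \<eta>
  proof -
    have "\<eta> / 3 > 0" using \<eta> by simp
    from metric_CauchyD[OF LIMSEQ_imp_Cauchy[OF JL] this] obtain N1 where
      N1: "\<And>k l. k \<ge> N1 \<Longrightarrow> l \<ge> N1 \<Longrightarrow> dist (J k) (J l) < \<eta> / 3" by blast
    have "\<forall>\<^sub>F k in sequentially. 1 / 2 ^ k < \<eta> / 3" by (rule order_tendstoD[OF lim2]) (use \<eta> in simp)
    then obtain N2 where N2: "\<And>k. k \<ge> N2 \<Longrightarrow> 1 / 2 ^ k < \<eta> / 3" by (auto simp: eventually_sequentially)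
    have "(LINT z|lebesgue_on S. (norm (W l z - W k z))\<^sup>2) \<le> \<eta>" if "k \<ge> max N1 N2" "l \<ge> k" for k l
    proof -
      have "\<bar>J l - J k\<bar> < \<eta> / 3" using N1[of l k] that by (simp add: dist_real_def)
      then have "J l - J k < \<eta> / 3" by linarith
      moreover have "2 / 2 ^ k = 2 * (1 / 2 ^ k :: real)" by simp
      ultimately show ?thesis using energy[OF that(2)] N2[of k] that by simp
    qed
    then show ?thesis by blast
  qed
  obtain r :: "nat \<Rightarrow> nat" where r: "strict_mono r" "AE z in lebesgue_on S. convergent (\<lambda>n. W (r n) z)"
    using L2_Cauchy_AE_subsequence[OF iN cauchy] by blast
  define Winf where "Winf z = lim (\<lambda>n. W (r n) z)" for z
  have mW: "W k \<in> borel_measurable (lebesgue_on S)" for k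
    by (rule continuous_imp_measurable_on_sets_lebesgue[OF cW]) (use S in auto)
  have mWinf: "Winf \<in> borel_measurable (lebesgue_on S)"
    unfolding Winf_def by (rule borel_measurable_lim_metric) (rule mW)
  have conv: "AE z in lebesgue_on S. (\<lambda>n. W (r n) z) \<longlonglongrightarrow> Winf z"
    using r(2) by eventually_elim (simp add: Winf_def convergent_LIMSEQ_iff)
  have mi: "(\<lambda>z. infdist (f z) K) \<in> borel_measurable (lebesgue_on S)"
    if "f \<in> borel_measurable (lebesgue_on S)" for f :: "(real^'n) \<times> real \<Rightarrow> (real^'n^'m) \<times> (real^'n^'m)"
    using measurable_compose[OF that borel_measurable_continuous_onI[of "\<lambda>x. infdist x K"]]
    by (simp add: continuous_on_infdist[OF continuous_on_id])
  have dc: "integrable (lebesgue_on S) (\<lambda>z. infdist (Winf z) K)"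
    "(\<lambda>n. LINT z|lebesgue_on S. infdist (W (r n) z) K) \<longlonglongrightarrow> (LINT z|lebesgue_on S. infdist (Winf z) K)"
  proof -
    have 1: "AE z in lebesgue_on S. (\<lambda>n. infdist (W (r n) z) K) \<longlonglongrightarrow> infdist (Winf z) K"
      using conv by eventually_elim (rule tendsto_infdist)
    have 2: "AE z in lebesgue_on S. norm (infdist (W (r n) z) K) \<le> M" for n
      by (rule AE_I2) (use M(2) W(3) inS in \<open>auto simp: infdist_nonneg space_restrict_space\<close>)
    have 3: "integrable (lebesgue_on S) (\<lambda>_. M)" by simp
    show "integrable (lebesgue_on S) (\<lambda>z. infdist (Winf z) K)"
      by (rule integrable_dominated_convergence[OF mi[OF mWinf] mi[OF mW] 3 1 2])
    show "(\<lambda>n. LINT z|lebesgue_on S. infdist (W (r n) z) K) \<longlonglongrightarrow> (LINT z|lebesgue_on S. infdist (Winf z) K)"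
      by (rule integral_dominated_convergence[OF mi[OF mWinf] mi[OF mW] 3 1 2])
  qed
  have "(LINT z|lebesgue_on S. infdist (Winf z) K) \<le> 0"
  proof (rule LIMSEQ_le[OF dc(2) lim2], intro exI allI impI)
    fix n :: nat assume n: "n \<ge> 1"
    have rn: "r n \<ge> n" using r(1) by (rule seq_suble)
    have "(LINT z|lebesgue_on S. infdist (W (r n) z) K) \<le> 1 / 2 ^ r n" using W(5)[of "r n"] rn n by simp
    also have "\<dots> \<le> 1 / 2 ^ n" using rn by (simp add: frac_le)
    finally show "(LINT z|lebesgue_on S. infdist (W (r n) z) K) \<le> 1 / 2 ^ n" .
  qed
  moreover have "0 \<le> (LINT z|lebesgue_on S. infdist (Winf z) K)" by (simp add: infdist_nonneg)
  ultimately have "(LINT z|lebesgue_on S. infdist (Winf z) K) = 0" by simp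
  then have "AE z in lebesgue_on S. infdist (Winf z) K = 0"
    using integral_nonneg_eq_0_iff_AE[OF dc(1)] by (simp add: infdist_nonneg)
  with conv have fin: "AE z in lebesgue_on S. (\<lambda>n. W0 z + (\<Sum>j<r n. field (Y' j z))) \<longlonglongrightarrow> Winf z \<and> Winf z \<in> K"
    by eventually_elim (simp add: W_sum in_closed_iff_infdist_zero[OF K])
  have pY: "perturbation S (\<epsilon> / 2 ^ Suc k) (Y k) (Y' k)" for k
    by (rule perturbation_mono[OF Y(1) order_refl]) (use e(2)[of k] in simp)
  have WS: "W0 z + (\<Sum>j<k. field (Y' j z)) \<in> \<Sigma>" if "z \<in> closure S" for k z
    using W(3)[OF that, of k] by (simp add: W_sum)
  have "\<forall>k. perturbation S (\<epsilon> / 2 ^ Suc k) (Y k) (Y' k)" using pY by blast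
  moreover have "\<forall>k. \<forall>z\<in>closure S. W0 z + (\<Sum>j<k. field (Y' j z)) \<in> \<Sigma>" using WS by blast
  ultimately show ?thesis by (rule that[OF _ _ r(1) mWinf fin])
qed

section \<open>Passage to the limit in weak formulations\<close>

lemma partial_eq: "(f has_derivative f') (at z) \<Longrightarrow> partial v f z = f' v"
  unfolding partial_def by (metis frechet_derivative_at)

lemma linear_expand_Basis:
  assumes "linear L" shows "L v = (\<Sum>b\<in>Basis. (v \<bullet> b) *\<^sub>R L b)"
proof -
  have "L v = L (\<Sum>b\<in>Basis. (v \<bullet> b) *\<^sub>R b)" by (simp add: euclidean_representation)
  also have "\<dots> = (\<Sum>b\<in>Basis. (v \<bullet> b) *\<^sub>R L b)"
    by (simp add: linear_sum[OF assms] linear_scale[OF assms])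
  finally show ?thesis .
qed

lemma test_function_C1_compact:
  assumes "\<phi> \<in> test_functions S"
  shows "C1_compact S \<phi> (\<lambda>z v. partial v \<phi> z)"
proof -
  have Ck: "Ck k \<phi>" for k using assms unfolding test_functions_def by blast
  from Ck[of 1] have diff: "\<phi> differentiable (at z)" and c: "b \<in> Basis \<Longrightarrow> continuous_on UNIV (partial b \<phi>)" for z b
    by auto
  have d: "(\<phi> has_derivative (\<lambda>v. partial v \<phi> z)) (at z)" for z
    unfolding partial_def using diff frechet_derivative_works by blast
  have "continuous_on UNIV (\<lambda>z. partial v \<phi> z)" for v
  proof -
    have "partial v \<phi> z = (\<Sum>b\<in>Basis. (v \<bullet> b) *\<^sub>R partial b \<phi> z)" for z
      by (rule linear_expand_Basis[OF has_derivative_linear[OF d]])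
    then have "(\<lambda>z. partial v \<phi> z) = (\<lambda>z. \<Sum>b\<in>Basis. (v \<bullet> b) *\<^sub>R partial b \<phi> z)" by blast
    moreover have "continuous_on UNIV (\<lambda>z. \<Sum>b\<in>Basis. (v \<bullet> b) *\<^sub>R partial b \<phi> z)"
      by (intro continuous_on_sum continuous_on_scaleR continuous_on_const c)
    ultimately show ?thesis by simp
  qed
  then show ?thesis unfolding C1_compact_def C1_on_def
    using d assms closure_subset[of "{z. \<phi> z \<noteq> 0}"] unfolding test_functions_def
    by (auto intro!: exI[of _ "closure {z. \<phi> z \<noteq> 0}"])
qed

lemma test_function_partial:
  assumes \<phi>: "\<phi> \<in> test_functions S" and b: "b \<in> Basis"
  shows "partial b \<phi> \<in> test_functions S"
proof -
  have Ck: "Ck (Suc k) \<phi>" for k using \<phi> unfolding test_functions_def by blast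
  have K: "compact (closure {z. \<phi> z \<noteq> 0})" "closure {z. \<phi> z \<noteq> 0} \<subseteq> S"
    using \<phi> unfolding test_functions_def by blast+
  have "partial b \<phi> z = 0" if z: "z \<notin> closure {z. \<phi> z \<noteq> 0}" for z
  proof -
    have "((\<lambda>_. 0) has_derivative (\<lambda>_. 0)) (at z)" by simp
    then have "(\<phi> has_derivative (\<lambda>_. 0)) (at z)"
      by (rule has_derivative_transform_within_open[of _ _ _ _ "- closure {z. \<phi> z \<noteq> 0}"])
         (use z closure_subset[of "{z. \<phi> z \<noteq> 0}"] in auto)
    then show ?thesis by (simp add: partial_eq)
  qed
  then have "{z. partial b \<phi> z \<noteq> 0} \<subseteq> closure {z. \<phi> z \<noteq> 0}" by blast
  then have sub: "closure {z. partial b \<phi> z \<noteq> 0} \<subseteq> closure {z. \<phi> z \<noteq> 0}"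
    by (simp add: closure_minimal)
  then have "compact (closure {z. partial b \<phi> z \<noteq> 0})"
    using closed_Int_compact[OF closed_closure K(1)] by (metis Int_absorb2)
  then show ?thesis unfolding test_functions_def using Ck b sub K(2) by auto
qed

lemma e_in_Basis: "e_x k \<in> Basis" "e_t \<in> Basis"
  unfolding e_x_def e_t_def by (auto simp: Basis_prod_def Basis_vec_def)

lemma Basis_cases:
  assumes "b \<in> (Basis :: ((real^'n) \<times> real) set)"
  obtains k where "b = e_x k" | "b = e_t"
  using assms unfolding e_x_def e_t_def by (auto simp: Basis_prod_def Basis_vec_def)

text \<open>Integrating by parts on both sides leaves the mixed second derivatives of \<open>\<phi>\<close>, which agree.\<close>

lemma mixed_derivative_identity:
  fixes w :: "(real^'n) \<times> real \<Rightarrow> real"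
  assumes "open S" and w: "C1_on S w w'" and \<phi>: "\<phi> \<in> test_functions S" and a: "a \<in> Basis" and b: "b \<in> Basis"
  shows "integrable (lebesgue_on S) (\<lambda>z. w' z a * partial b \<phi> z)"
    and "(LINT z|lebesgue_on S. w' z a * partial b \<phi> z) = (LINT z|lebesgue_on S. w' z b * partial a \<phi> z)"
proof -
  note t = test_function_C1_compact
  have "partial a (partial b \<phi>) z = partial b (partial a \<phi>) z" for z
    by (rule second_derivative_symmetric[of \<phi> "\<lambda>z v. partial v \<phi> z" b "\<lambda>z v. partial v (partial b \<phi>) z" a
          "\<lambda>z v. partial v (partial a \<phi>) z"])
       (use C1_compact_derivative[OF t[OF \<phi>]] C1_compact_derivative[OF t[OF test_function_partial[OF \<phi>]]]
          C1_compact_continuous_derivative[OF t[OF test_function_partial[OF \<phi>]]] a b in auto)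
  then have "(LINT z|lebesgue_on S. partial a (partial b \<phi>) z * w z) = (LINT z|lebesgue_on S. partial b (partial a \<phi>) z * w z)"
    by simp
  moreover have "(LINT z|lebesgue_on S. partial c (partial d \<phi>) z * w z) = - (LINT z|lebesgue_on S. w' z c * partial d \<phi> z)"
    if "d \<in> Basis" for c d
    using integration_by_parts(3)[OF assms(1) t[OF test_function_partial[OF \<phi> that]] w, of c]
    by (simp add: mult.commute)
  ultimately show "(LINT z|lebesgue_on S. w' z a * partial b \<phi> z) = (LINT z|lebesgue_on S. w' z b * partial a \<phi> z)"
    using a b by simp
  show "integrable (lebesgue_on S) (\<lambda>z. w' z a * partial b \<phi> z)"
    using integration_by_parts(1)[OF assms(1) t[OF test_function_partial[OF \<phi> b]] w, of a]
    by (simp add: mult.commute)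
qed

lemma dominated_convergence_lebesgue_on:
  fixes f :: "nat \<Rightarrow> 'a::euclidean_space \<Rightarrow> 'b::euclidean_space"
  assumes "S \<in> lmeasurable" and m: "\<And>n. f n \<in> borel_measurable (lebesgue_on S)" "g \<in> borel_measurable (lebesgue_on S)"
    and B: "\<And>n z. z \<in> S \<Longrightarrow> norm (f n z) \<le> B" and lim: "AE z in lebesgue_on S. (\<lambda>n. f n z) \<longlonglongrightarrow> g z"
  shows "integrable (lebesgue_on S) g"
    and "(\<lambda>n. LINT z|lebesgue_on S. f n z) \<longlonglongrightarrow> (LINT z|lebesgue_on S. g z)"
proof -
  interpret finite_measure "lebesgue_on S" using assms(1) by (rule finite_measure_lebesgue_on)
  have 1: "integrable (lebesgue_on S) (\<lambda>_. B)" by simp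
  have 2: "AE z in lebesgue_on S. norm (f n z) \<le> B" for n
    by (rule AE_I2) (use B in \<open>simp add: space_restrict_space\<close>)
  show "integrable (lebesgue_on S) g" by (rule integrable_dominated_convergence[OF m(2,1) 1 lim 2])
  show "(\<lambda>n. LINT z|lebesgue_on S. f n z) \<longlonglongrightarrow> (LINT z|lebesgue_on S. g z)"
    by (rule integral_dominated_convergence[OF m(2,1) 1 lim 2])
qed

lemma C1_compact_bounded:
  assumes "C1_compact S f f'"
  obtains B where "B > 0" "\<And>z. norm (f z) \<le> B" "\<And>z. norm (f' z b) \<le> B"
proof -
  obtain K where K: "compact K" "\<And>z. z \<notin> K \<Longrightarrow> f z = 0" "\<And>z v. z \<notin> K \<Longrightarrow> f' z v = 0"
    using C1_compactE[OF assms] by metis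
  have "bounded (f ` K)" "bounded ((\<lambda>z. f' z b) ` K)"
    by (intro compact_imp_bounded compact_continuous_image K C1_compact_continuous[OF assms]
        C1_compact_continuous_derivative[OF assms])+
  then obtain B1 B2 where "B1 > 0" "\<And>z. z \<in> K \<Longrightarrow> norm (f z) \<le> B1" "B2 > 0" "\<And>z. z \<in> K \<Longrightarrow> norm (f' z b) \<le> B2"
    unfolding bounded_pos by auto
  then show ?thesis using K(2,3)
    by (intro that[of "max B1 B2"]) (force simp: less_max_iff_disj le_max_iff_disj)+
qed

lemma weak_partial_of_limit:
  fixes w :: "nat \<Rightarrow> 'a::euclidean_space \<Rightarrow> 'b::euclidean_space"
  assumes S: "open S" "bounded S" and w: "\<And>n. C1_on S (w n) (w' n)"
    and B: "\<And>n z. z \<in> S \<Longrightarrow> norm (w n z) \<le> B" "\<And>n z. z \<in> S \<Longrightarrow> norm (w' n z b) \<le> B"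
    and m: "U \<in> borel_measurable (lebesgue_on S)" "g \<in> borel_measurable (lebesgue_on S)"
    and lim: "AE z in lebesgue_on S. (\<lambda>n. w n z) \<longlonglongrightarrow> U z" "AE z in lebesgue_on S. (\<lambda>n. w' n z b) \<longlonglongrightarrow> g z"
  shows "has_weak_partial S b U g"
proof -
  have SL: "S \<in> lmeasurable" using S by (simp add: lmeasurable_open)
  have SS: "S \<in> sets lebesgue" using SL by (rule fmeasurableD)
  have mw: "w n \<in> borel_measurable (lebesgue_on S)" "(\<lambda>z. w' n z b) \<in> borel_measurable (lebesgue_on S)" for n
    using C1_on_continuous[OF w] w SS unfolding C1_on_def
    by (auto intro!: continuous_imp_measurable_on_sets_lebesgue)
  have loc: "locally_integrable S f" if "integrable (lebesgue_on S) f" for f :: "'a \<Rightarrow> 'b"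
    unfolding locally_integrable_def
    using integrable_lebesgue_on_subset[OF that SS] lmeasurable_compact fmeasurableD by blast
  have "(LINT z|lebesgue_on S. partial b \<phi> z *\<^sub>R U z) = - (LINT z|lebesgue_on S. \<phi> z *\<^sub>R g z)"
    if "\<phi> \<in> test_functions S" for \<phi>
  proof -
    note \<phi> = test_function_C1_compact[OF that]
    obtain C where C: "C > 0" "\<And>z. norm (\<phi> z) \<le> C" "\<And>z. norm (partial b \<phi> z) \<le> C"
      using C1_compact_bounded[OF \<phi>] by metis
    have m\<phi>: "\<phi> \<in> borel_measurable (lebesgue_on S)" "(\<lambda>z. partial b \<phi> z) \<in> borel_measurable (lebesgue_on S)"
      using C1_compact_continuous[OF \<phi>] C1_compact_continuous_derivative[OF \<phi>] SS
      by (auto intro!: continuous_imp_measurable_on_sets_lebesgue)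
    have bb: "norm (c *\<^sub>R x) \<le> C * B" if "norm c \<le> C" "norm x \<le> B" for c :: real and x :: 'b
      using that C(1) by (auto intro!: mult_mono)
    have 1: "(\<lambda>n. LINT z|lebesgue_on S. partial b \<phi> z *\<^sub>R w n z) \<longlonglongrightarrow> (LINT z|lebesgue_on S. partial b \<phi> z *\<^sub>R U z)"
    proof (rule dominated_convergence_lebesgue_on(2)[OF SL, where B = "C * B"])
      show "AE z in lebesgue_on S. (\<lambda>n. partial b \<phi> z *\<^sub>R w n z) \<longlonglongrightarrow> partial b \<phi> z *\<^sub>R U z"
        using lim(1) by eventually_elim (intro tendsto_intros)
    qed (use m\<phi> mw m bb C B in auto)
    have 2: "(\<lambda>n. LINT z|lebesgue_on S. \<phi> z *\<^sub>R w' n z b) \<longlonglongrightarrow> (LINT z|lebesgue_on S. \<phi> z *\<^sub>R g z)"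
    proof (rule dominated_convergence_lebesgue_on(2)[OF SL, where B = "C * B"])
      show "AE z in lebesgue_on S. (\<lambda>n. \<phi> z *\<^sub>R w' n z b) \<longlonglongrightarrow> \<phi> z *\<^sub>R g z"
        using lim(2) by eventually_elim (intro tendsto_intros)
    qed (use m\<phi> mw m bb C B in auto)
    have "(LINT z|lebesgue_on S. partial b \<phi> z *\<^sub>R w n z) = - (LINT z|lebesgue_on S. \<phi> z *\<^sub>R w' n z b)" for n
      by (rule integration_by_parts(3)[OF S(1) \<phi> w])
    with 1 have "(\<lambda>n. - (LINT z|lebesgue_on S. \<phi> z *\<^sub>R w' n z b)) \<longlonglongrightarrow> (LINT z|lebesgue_on S. partial b \<phi> z *\<^sub>R U z)"
      by simp
    then show ?thesis using LIMSEQ_unique tendsto_minus[OF 2] by blast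
  qed
  then show ?thesis unfolding has_weak_partial_def
    using loc[OF dominated_convergence_lebesgue_on(1)[OF SL mw(1) m(1) B(1) lim(1)]]
      loc[OF dominated_convergence_lebesgue_on(1)[OF SL mw(2) m(2) B(2) lim(2)]] by blast
qed

text \<open>For a \<open>C\<^sup>1\<close> pair with \<open>w = div V\<close> the distributional identity \<open>w\<^sub>t = div V\<^sub>t\<close> follows from the exchange of
derivatives between \<open>V\<close> and the test function. It passes to limits in which only \<open>w\<close> and \<open>V\<^sub>t\<close> converge; the spatial
derivatives of \<open>V\<close> are not controlled along the iteration.\<close>

lemma divergence_identity_limit:
  fixes w :: "nat \<Rightarrow> (real^'n) \<times> real \<Rightarrow> real" and V :: "nat \<Rightarrow> (real^'n) \<times> real \<Rightarrow> real^'n"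
  assumes S: "open S" "bounded S" and V: "\<And>n. C1_on S (V n) (V' n)"
    and w: "\<And>n. continuous_on S (w n)" and div: "\<And>n z. z \<in> S \<Longrightarrow> w n z = (\<Sum>k\<in>UNIV. V' n z (e_x k) $ k)"
    and B: "\<And>n z. z \<in> S \<Longrightarrow> \<bar>w n z\<bar> \<le> B" "\<And>n z. z \<in> S \<Longrightarrow> norm (V' n z e_t) \<le> B"
    and m: "U \<in> borel_measurable (lebesgue_on S)" "g \<in> borel_measurable (lebesgue_on S)"
    and lim: "AE z in lebesgue_on S. (\<lambda>n. w n z) \<longlonglongrightarrow> U z" "AE z in lebesgue_on S. (\<lambda>n. V' n z e_t) \<longlonglongrightarrow> g z"
    and \<phi>: "\<phi> \<in> test_functions S"
  shows "has_bochner_integral (lebesgue_on S) (\<lambda>z. U z * partial e_t \<phi> z - (\<Sum>k\<in>UNIV. g z $ k * partial (e_x k) \<phi> z)) 0"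
proof -
  have SL: "S \<in> lmeasurable" using S by (simp add: lmeasurable_open)
  have SS: "S \<in> sets lebesgue" using SL by (rule fmeasurableD)
  note \<phi>1 = test_function_C1_compact[OF \<phi>]
  define F where "F n z = w n z * partial e_t \<phi> z - (\<Sum>k\<in>UNIV. V' n z e_t $ k * partial (e_x k) \<phi> z)" for n z
  have cV: "continuous_on S (\<lambda>z. V' n z v)" for n v using V unfolding C1_on_def by blast
  have c\<phi>: "continuous_on S (\<lambda>z. partial v \<phi> z)" for v by (rule C1_compact_continuous_derivative[OF \<phi>1])
  have mF: "F n \<in> borel_measurable (lebesgue_on S)" for n
  proof (rule continuous_imp_measurable_on_sets_lebesgue[OF _ SS])
    show "continuous_on S (F n)" unfolding F_def
      by (intro continuous_on_diff continuous_on_mult continuous_on_sum w c\<phi> continuous_on_component cV)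
  qed
  have "\<forall>v. \<exists>C. C > 0 \<and> (\<forall>z. \<bar>partial v \<phi> z\<bar> \<le> C)"
    using C1_compact_bounded[OF \<phi>1] by (metis real_norm_def)
  then obtain C where C: "\<And>v. C v > 0" "\<And>v z. \<bar>partial v \<phi> z\<bar> \<le> C v" by metis
  have bF: "norm (F n z) \<le> B * C e_t + (\<Sum>k\<in>(UNIV::'n set). B * C (e_x k))" if z: "z \<in> S" for n z
  proof -
    have "B \<ge> 0" using B(1)[OF z] abs_ge_zero order_trans by blast
    have "\<bar>F n z\<bar> \<le> \<bar>w n z\<bar> * \<bar>partial e_t \<phi> z\<bar> + (\<Sum>k\<in>UNIV. \<bar>V' n z e_t $ k\<bar> * \<bar>partial (e_x k) \<phi> z\<bar>)"
      unfolding F_def by (intro order_trans[OF abs_triangle_ineq4] add_mono order_trans[OF sum_abs]) (auto simp: abs_mult)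
    also have "\<dots> \<le> B * C e_t + (\<Sum>k\<in>UNIV. B * C (e_x k))"
    proof (intro add_mono sum_mono mult_mono)
      show "\<bar>V' n z e_t $ k\<bar> \<le> B" for k using component_le_norm_cart[of "V' n z e_t" k] B(2)[OF z, of n] by linarith
    qed (use B(1)[OF z] C \<open>B \<ge> 0\<close> in auto)
    finally show ?thesis by simp
  qed
  have int0: "(LINT z|lebesgue_on S. F n z) = 0" for n
  proof -
    have Vk: "C1_on S (\<lambda>z. V n z $ k) (\<lambda>z v. V' n z v $ k)" for k
      by (rule C1_on_bounded_linear[OF V bounded_linear_vec_nth])
    note i = mixed_derivative_identity[OF S(1) Vk \<phi> e_in_Basis(1) e_in_Basis(2)]
    note i' = mixed_derivative_identity(1)[OF S(1) Vk \<phi> e_in_Basis(2) e_in_Basis(1)]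
    have "(LINT z|lebesgue_on S. F n z) = (LINT z|lebesgue_on S. (\<Sum>k\<in>UNIV. V' n z (e_x k) $ k * partial e_t \<phi> z)
        - (\<Sum>k\<in>UNIV. V' n z e_t $ k * partial (e_x k) \<phi> z))"
      by (rule Bochner_Integration.integral_cong) (auto simp: F_def div sum_distrib_right space_restrict_space)
    also have "\<dots> = (\<Sum>k\<in>UNIV. LINT z|lebesgue_on S. V' n z (e_x k) $ k * partial e_t \<phi> z)
        - (\<Sum>k\<in>UNIV. LINT z|lebesgue_on S. V' n z e_t $ k * partial (e_x k) \<phi> z)"
      using i(1) i' by simp
    finally show ?thesis using i(2) by simp
  qed
  define G where "G z = U z * partial e_t \<phi> z - (\<Sum>k\<in>UNIV. g z $ k * partial (e_x k) \<phi> z)" for z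
  have m\<phi>: "(\<lambda>z. partial v \<phi> z) \<in> borel_measurable (lebesgue_on S)" for v
    by (rule continuous_imp_measurable_on_sets_lebesgue[OF c\<phi> SS])
  have mg: "(\<lambda>z. g z $ k) \<in> borel_measurable (lebesgue_on S)" for k
    using measurable_compose[OF m(2) borel_measurable_continuous_onI[of "\<lambda>x. x $ k"]]
    by (simp add: continuous_on_component)
  have mG: "G \<in> borel_measurable (lebesgue_on S)" unfolding G_def
    using m(1) m\<phi> mg by (intro borel_measurable_diff borel_measurable_times borel_measurable_sum)
  have limF: "AE z in lebesgue_on S. (\<lambda>n. F n z) \<longlonglongrightarrow> G z"
    using lim(1) lim(2) unfolding F_def G_def by eventually_elim (intro tendsto_intros)
  note dc = dominated_convergence_lebesgue_on[OF SL mF mG bF limF]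
  have "(LINT z|lebesgue_on S. G z) = 0"
    using dc(2) by (simp add: int0 LIMSEQ_const_iff)
  then have "has_bochner_integral (lebesgue_on S) G 0"
    using has_bochner_integral_integrable[OF dc(1)] by simp
  then show ?thesis unfolding G_def .
qed

section \<open>Weak* convergence\<close>

lemma L_inf_inner_integrable:
  assumes "L_inf S f" "integrable (lebesgue_on S) \<psi>"
  shows "integrable (lebesgue_on S) (\<lambda>z. f z \<bullet> \<psi> z)"
proof -
  obtain C where f: "f \<in> borel_measurable (lebesgue_on S)" and C: "AE z in lebesgue_on S. norm (f z) \<le> C"
    using assms(1) unfolding L_inf_def by blast
  show ?thesis
  proof (rule Bochner_Integration.integrable_bound)
    show "integrable (lebesgue_on S) (\<lambda>z. C * norm (\<psi> z))" using assms(2) by simp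
    show "(\<lambda>z. f z \<bullet> \<psi> z) \<in> borel_measurable (lebesgue_on S)"
      using f assms(2) by (intro borel_measurable_inner) auto
    show "AE z in lebesgue_on S. norm (f z \<bullet> \<psi> z) \<le> norm (C * norm (\<psi> z))"
      using C
    proof eventually_elim
      case (elim z)
      have "\<bar>f z \<bullet> \<psi> z\<bar> \<le> norm (f z) * norm (\<psi> z)" by (rule Cauchy_Schwarz_ineq2)
      also have "\<dots> \<le> C * norm (\<psi> z)" using elim by (rule mult_right_mono) simp
      finally show ?case by simp
    qed
  qed
qed

lemma weak_star_of_uniform:
  fixes F :: "nat \<Rightarrow> 'a::euclidean_space \<Rightarrow> 'b::euclidean_space"
  assumes F: "\<And>j. L_inf S (F j)" and f: "L_inf S f"
    and close: "\<And>j z. z \<in> S \<Longrightarrow> norm (F j z - f z) \<le> \<epsilon> j" and \<epsilon>: "\<epsilon> \<longlonglongrightarrow> 0" and S: "S \<in> sets lebesgue"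
  shows "weak_star_L_inf S F f"
  unfolding weak_star_L_inf_def
proof (intro conjI allI impI F f)
  fix \<psi> :: "'a \<Rightarrow> 'b" assume \<psi>: "integrable (lebesgue_on S) \<psi>"
  note i = L_inf_inner_integrable[OF F \<psi>] and i' = L_inf_inner_integrable[OF f \<psi>]
  show "(\<lambda>j. LINT z|lebesgue_on S. F j z \<bullet> \<psi> z) \<longlonglongrightarrow> (LINT z|lebesgue_on S. f z \<bullet> \<psi> z)"
  proof (rule LIM_zero_cancel, rule Lim_null_comparison, rule always_eventually, rule allI)
    show "(\<lambda>j. \<epsilon> j * (LINT z|lebesgue_on S. norm (\<psi> z))) \<longlonglongrightarrow> 0"
      using tendsto_mult_left_zero[OF \<epsilon>] by simp
    fix j
    have "(LINT z|lebesgue_on S. F j z \<bullet> \<psi> z) - (LINT z|lebesgue_on S. f z \<bullet> \<psi> z) = (LINT z|lebesgue_on S. (F j z - f z) \<bullet> \<psi> z)"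
      using i i' by (simp add: inner_diff_left)
    also have "norm \<dots> \<le> (LINT z|lebesgue_on S. norm ((F j z - f z) \<bullet> \<psi> z))" by (rule integral_norm_bound)
    also have "\<dots> \<le> (LINT z|lebesgue_on S. \<epsilon> j * norm (\<psi> z))"
    proof (rule integral_mono)
      show "integrable (lebesgue_on S) (\<lambda>z. norm ((F j z - f z) \<bullet> \<psi> z))"
        using Bochner_Integration.integrable_diff[OF i i'] by (simp add: inner_diff_left)
      show "integrable (lebesgue_on S) (\<lambda>z. \<epsilon> j * norm (\<psi> z))" using \<psi> by simp
      fix z assume "z \<in> space (lebesgue_on S)"
      then have z: "z \<in> S" by (simp add: space_restrict_space)
      have "\<bar>(F j z - f z) \<bullet> \<psi> z\<bar> \<le> norm (F j z - f z) * norm (\<psi> z)" by (rule Cauchy_Schwarz_ineq2)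
      also have "\<dots> \<le> \<epsilon> j * norm (\<psi> z)" by (rule mult_right_mono[OF close[OF z]]) simp
      finally show "norm ((F j z - f z) \<bullet> \<psi> z) \<le> \<epsilon> j * norm (\<psi> z)" by simp
    qed
    finally show "norm ((LINT z|lebesgue_on S. F j z \<bullet> \<psi> z) - (LINT z|lebesgue_on S. f z \<bullet> \<psi> z))
       \<le> \<epsilon> j * (LINT z|lebesgue_on S. norm (\<psi> z))" by simp
  qed
qed

text \<open>The functions \<open>F j - f\<close> need not be derivatives of \<open>C\<^sup>1\<close> functions, but they are bounded limits of such
derivatives \<open>h' j n\<close>, where all the \<open>h j n\<close> are uniformly small. So the bounds for the integrals against
\<open>\<psi>\<close> are proved for \<open>h' j n\<close> with a threshold on \<open>j\<close> that does not depend on \<open>n\<close>.\<close>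

lemma weak_star_of_small_primitives:
  fixes F :: "nat \<Rightarrow> 'a::euclidean_space \<Rightarrow> 'b::euclidean_space"
  assumes S: "open S" "bounded S" and F: "\<And>j. L_inf S (F j)" and f: "L_inf S f"
    and h: "\<And>j n. C1_compact UNIV (h j n) (h' j n)" "\<And>j n z. norm (h j n z) \<le> \<epsilon> j"
      "\<And>j n z. z \<in> S \<Longrightarrow> norm (h' j n z b) \<le> M"
    and lim: "\<And>j. AE z in lebesgue_on S. (\<lambda>n. h' j n z b) \<longlonglongrightarrow> F j z - f z"
    and \<epsilon>: "\<epsilon> \<longlonglongrightarrow> 0" and M: "M > 0"
  shows "weak_star_L_inf S F f"
  unfolding weak_star_L_inf_def
proof (intro conjI allI impI F f)
  fix \<psi> :: "'a \<Rightarrow> 'b" assume \<psi>: "integrable (lebesgue_on S) \<psi>"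
  note i = L_inf_inner_integrable[OF F \<psi>] and i' = L_inf_inner_integrable[OF f \<psi>]
  have SS: "S \<in> sets lebesgue" using S(1) by auto
  have lim_n: "(\<lambda>n. LINT z|lebesgue_on S. h' j n z b \<bullet> \<psi> z) \<longlonglongrightarrow>
      (LINT z|lebesgue_on S. F j z \<bullet> \<psi> z) - (LINT z|lebesgue_on S. f z \<bullet> \<psi> z)" for j
  proof -
    have m: "(\<lambda>z. h' j n z b) \<in> borel_measurable (lebesgue_on S)" for n
      by (rule C1_compact_measurable_derivative[OF h(1) SS])
    have "(\<lambda>n. LINT z|lebesgue_on S. h' j n z b \<bullet> \<psi> z) \<longlonglongrightarrow> (LINT z|lebesgue_on S. F j z \<bullet> \<psi> z - f z \<bullet> \<psi> z)"
    proof (rule integral_dominated_convergence[where w = "\<lambda>z. M * norm (\<psi> z)"])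
      show "(\<lambda>z. F j z \<bullet> \<psi> z - f z \<bullet> \<psi> z) \<in> borel_measurable (lebesgue_on S)"
        using Bochner_Integration.integrable_diff[OF i i'] by (rule borel_measurable_integrable)
      show "(\<lambda>z. h' j n z b \<bullet> \<psi> z) \<in> borel_measurable (lebesgue_on S)" for n
        using m \<psi> by (intro borel_measurable_inner) auto
      show "integrable (lebesgue_on S) (\<lambda>z. M * norm (\<psi> z))" using \<psi> by simp
      show "AE z in lebesgue_on S. (\<lambda>n. h' j n z b \<bullet> \<psi> z) \<longlonglongrightarrow> F j z \<bullet> \<psi> z - f z \<bullet> \<psi> z"
        using lim[of j]
      proof eventually_elim
        case (elim z)
        from tendsto_inner[OF this tendsto_const[of "\<psi> z"]] show ?case by (simp add: inner_diff_left)
      qed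
      show "AE z in lebesgue_on S. norm (h' j n z b \<bullet> \<psi> z) \<le> M * norm (\<psi> z)" for n
      proof (rule AE_I2)
        fix z assume "z \<in> space (lebesgue_on S)"
        then have z: "z \<in> S" by (simp add: space_restrict_space)
        have "\<bar>h' j n z b \<bullet> \<psi> z\<bar> \<le> norm (h' j n z b) * norm (\<psi> z)" by (rule Cauchy_Schwarz_ineq2)
        also have "\<dots> \<le> M * norm (\<psi> z)" by (rule mult_right_mono[OF h(3)[OF z]]) simp
        finally show "norm (h' j n z b \<bullet> \<psi> z) \<le> M * norm (\<psi> z)" by simp
      qed
    qed
    then show ?thesis using i i' by simp
  qed
  show "(\<lambda>j. LINT z|lebesgue_on S. F j z \<bullet> \<psi> z) \<longlonglongrightarrow> (LINT z|lebesgue_on S. f z \<bullet> \<psi> z)"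
  proof (rule LIMSEQ_I)
    fix e :: real assume e: "e > 0"
    define e' where "e' = e / (2 * real DIM('b))"
    have e': "e' > 0" using e by (simp add: e'_def DIM_positive)
    have ic: "integrable (lebesgue_on S) (\<lambda>z. \<psi> z \<bullet> c)" for c using \<psi> by simp
    let ?P = "\<lambda>c. weakly_null_at S b (\<lambda>z. \<psi> z \<bullet> c) M e'"
    have "\<forall>c. \<exists>d>0. ?P c d"
      using weakly_null_integrable[OF S ic, of b, unfolded weakly_null_def] M e' by blast
    then obtain d where d: "\<And>c. d c > 0" "\<And>c. ?P c (d c)" by metis
    define d0 where "d0 = Min (d ` (Basis :: 'b set))"
    have "d0 \<in> d ` (Basis :: 'b set)" unfolding d0_def by (rule Min_in) auto
    then have d0: "d0 > 0" using d(1) by auto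
    have d0le: "d0 \<le> d c" if "c \<in> Basis" for c unfolding d0_def using that by (intro Min_le) auto
    obtain N where N: "\<And>j. j \<ge> N \<Longrightarrow> \<epsilon> j < d0"
      using order_tendstoD(2)[OF \<epsilon> d0] by (auto simp: eventually_sequentially)
    have "norm ((LINT z|lebesgue_on S. F j z \<bullet> \<psi> z) - (LINT z|lebesgue_on S. f z \<bullet> \<psi> z)) < e" if j: "j \<ge> N" for j
    proof -
      have comp: "\<bar>LINT z|lebesgue_on S. (\<psi> z \<bullet> c) * (h' j n z b \<bullet> c)\<bar> \<le> e'"
        "integrable (lebesgue_on S) (\<lambda>z. (\<psi> z \<bullet> c) * (h' j n z b \<bullet> c))" if c: "c \<in> Basis" for c n
      proof -
        have C1: "C1_compact UNIV (\<lambda>z. h j n z \<bullet> c) (\<lambda>z v. h' j n z v \<bullet> c)"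
          by (rule C1_compact_bounded_linear[OF h(1) bounded_linear_inner_left])
        have "\<bar>h j n z \<bullet> c\<bar> \<le> d c" for z
          using Basis_le_norm[OF c, of "h j n z"] h(2)[of j n z] N[OF j] d0le[OF c] by linarith
        moreover have M': "\<bar>h' j n z b \<bullet> c\<bar> \<le> M" if "z \<in> S" for z
          using Basis_le_norm[OF c, of "h' j n z b"] h(3)[OF that, of j n] by linarith
        ultimately show "\<bar>LINT z|lebesgue_on S. (\<psi> z \<bullet> c) * (h' j n z b \<bullet> c)\<bar> \<le> e'"
          using d(2)[of c, unfolded weakly_null_at_def, THEN spec, THEN spec, THEN mp, OF C1] by blast
        show "integrable (lebesgue_on S) (\<lambda>z. (\<psi> z \<bullet> c) * (h' j n z b \<bullet> c))"
          by (rule integrable_mult_bounded[OF ic C1_compact_measurable_derivative[OF C1 SS], where B = M])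
             (simp add: M' space_restrict_space)
      qed
      have "\<bar>LINT z|lebesgue_on S. h' j n z b \<bullet> \<psi> z\<bar> \<le> e / 2" for n
      proof -
        have "x \<bullet> y = (\<Sum>c\<in>Basis. (y \<bullet> c) * (x \<bullet> c))" for x y :: 'b
          by (subst euclidean_inner) (simp add: mult.commute)
        then have "(LINT z|lebesgue_on S. h' j n z b \<bullet> \<psi> z) = (LINT z|lebesgue_on S. (\<Sum>c\<in>Basis. (\<psi> z \<bullet> c) * (h' j n z b \<bullet> c)))"
          by (intro Bochner_Integration.integral_cong refl)
        also have "\<dots> = (\<Sum>c\<in>Basis. LINT z|lebesgue_on S. (\<psi> z \<bullet> c) * (h' j n z b \<bullet> c))"
          by (rule Bochner_Integration.integral_sum) (rule comp(2))
        also have "\<bar>\<dots>\<bar> \<le> (\<Sum>c\<in>(Basis::'b set). e')"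
          by (intro order_trans[OF sum_abs] sum_mono comp(1))
        also have "\<dots> = e / 2" by (simp add: e'_def DIM_positive)
        finally show ?thesis .
      qed
      then have "\<bar>(LINT z|lebesgue_on S. F j z \<bullet> \<psi> z) - (LINT z|lebesgue_on S. f z \<bullet> \<psi> z)\<bar> \<le> e / 2"
        using tendsto_rabs[OF lim_n[of j]] by (intro LIMSEQ_le_const2) auto
      then show ?thesis using e by simp
    qed
    then show "\<exists>N. \<forall>j\<ge>N. norm ((LINT z|lebesgue_on S. F j z \<bullet> \<psi> z) - (LINT z|lebesgue_on S. f z \<bullet> \<psi> z)) < e" by blast
  qed
qed

section \<open>Weak solutions near the given function\<close>

lemma C1_closure_deriv_C1_on:
  assumes "C1_closure_deriv S f f'"
  shows "C1_on S f (\<lambda>z. blinfun_apply (f' z))" "continuous_on (closure S) f"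
    "continuous_on (closure S) (\<lambda>z. blinfun_apply (f' z) v)"
proof -
  have d: "continuous_on (closure S) f" "continuous_on (closure S) f'" "\<And>z. z \<in> S \<Longrightarrow> (f has_derivative blinfun_apply (f' z)) (at z)"
    using assms unfolding C1_closure_deriv_def by auto
  show c: "continuous_on (closure S) (\<lambda>z. blinfun_apply (f' z) v)" for v
    by (intro bounded_bilinear.continuous_on[OF bounded_bilinear_blinfun_apply] d continuous_on_const)
  show "C1_on S f (\<lambda>z. blinfun_apply (f' z))"
    unfolding C1_on_def using d(3) continuous_on_subset[OF c closure_subset] by blast
  show "continuous_on (closure S) f" by (rule d(1))
qed

lemma closed_graph_set:
  assumes "continuous_on UNIV \<sigma>" shows "closed (graph_set \<sigma>)" "graph_set \<sigma> \<noteq> {}"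
proof -
  have "graph_set \<sigma> = {x. snd x = \<sigma> (fst x)}" unfolding graph_set_def by auto
  moreover have "closed {x. snd x = \<sigma> (fst x)}"
    by (intro closed_Collect_eq continuous_on_snd continuous_on_id continuous_on_compose2[OF assms] continuous_on_fst) auto
  ultimately show "closed (graph_set \<sigma>)" by simp
  show "graph_set \<sigma> \<noteq> {}" unfolding graph_set_def by auto
qed

lemma perturbation_partial_sums:
  assumes "\<And>k. perturbation S (\<epsilon> / 2 ^ Suc k) (Y k) (Y' k)"
  shows "perturbation S (\<epsilon> - \<epsilon> / 2 ^ n) (\<lambda>z. \<Sum>j<n. Y j z) (\<lambda>z v. \<Sum>j<n. Y' j z v)"
proof (induction n)
  case 0 show ?case by (simp add: perturbation_zero)
next
  case (Suc n)
  have "\<epsilon> - \<epsilon> / 2 ^ n + \<epsilon> / 2 ^ Suc n = \<epsilon> - \<epsilon> / 2 ^ Suc n" by (simp add: field_simps)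
  then show ?case using perturbation_add[OF Suc assms[of n]] by simp
qed

lemma field_sum:
  fixes n :: nat
  shows "field (\<lambda>v. \<Sum>j<n. L j v) = (\<Sum>j<n. field (L j))"
  by (induction n) (simp_all add: field_zero field_add)

lemma limit_of_geometric_series:
  fixes f :: "nat \<Rightarrow> 'a::topological_space \<Rightarrow> 'b::banach"
  assumes "\<And>j z. norm (f j z) \<le> \<epsilon> / 2 ^ Suc j"
  obtains F where "\<And>z. (\<lambda>n. \<Sum>j<n. f j z) \<longlonglongrightarrow> F z"
    "\<And>S. (\<And>j. continuous_on S (f j)) \<Longrightarrow> continuous_on S F"
proof -
  have "summable (\<lambda>j. \<epsilon> / 2 * (1 / 2) ^ j)" by (intro summable_mult summable_geometric) auto
  then have s: "summable (\<lambda>j. \<epsilon> / 2 ^ Suc j)" by (simp add: power_one_over)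
  have u: "uniform_limit UNIV (\<lambda>n z. \<Sum>j<n. f j z) (\<lambda>z. \<Sum>j. f j z) sequentially"
    by (rule Weierstrass_m_test[OF _ s]) (use assms in simp)
  show ?thesis
  proof (rule that)
    show "(\<lambda>n. \<Sum>j<n. f j z) \<longlonglongrightarrow> (\<Sum>j. f j z)" for z
      using tendsto_uniform_limitI[OF u] by simp
    show "continuous_on S (\<lambda>z. \<Sum>j. f j z)" if "\<And>j. continuous_on S (f j)" for S
      by (rule uniform_limit_theorem[OF _ uniform_limit_on_subset[OF u subset_UNIV]])
         (use that in \<open>auto intro!: always_eventually continuous_on_sum\<close>)
  qed
qed

text \<open>\<open>U\<close> is an exact weak solution with spatial gradient \<open>A\<close> and time derivative \<open>Gt\<close>; \<open>\<epsilon>\<close> measures its distance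
from \<open>u\<close>. The functions \<open>h n\<close> are the partial sums of the perturbations. They are kept because the weak*
convergence of the gradients is derived from them, with a bound \<open>M\<close> that does not depend on \<open>\<epsilon>\<close>.\<close>

definition nearby_solution where
  "nearby_solution \<sigma> S u u' M \<epsilon> U A Gt h h' \<longleftrightarrow>
     continuous_on (closure S) U \<and> (\<forall>z\<in>closure S. norm (U z - u z) \<le> \<epsilon>) \<and> (\<forall>z\<in>frontier S. U z = u z) \<and>
     (\<forall>k. has_weak_partial S (e_x k) U (\<lambda>z. column k (A z))) \<and> has_weak_partial S e_t U Gt \<and>
     Gt \<in> borel_measurable (lebesgue_on S) \<and> (\<forall>z\<in>S. norm (Gt z - blinfun_apply (u' z) e_t) \<le> \<epsilon>) \<and>
     (\<forall>k. L_inf S (\<lambda>z. column k (A z))) \<and>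
     (\<forall>\<phi>\<in>test_functions S. \<forall>i. has_bochner_integral (lebesgue_on S)
        (\<lambda>z. U z $ i * partial e_t \<phi> z - (\<Sum>k\<in>UNIV. \<sigma> (A z) $ i $ k * partial (e_x k) \<phi> z)) 0) \<and>
     (\<forall>n. C1_compact UNIV (h n) (h' n) \<and> (\<forall>z. norm (h n z) \<le> \<epsilon>) \<and>
        (\<forall>z\<in>S. \<forall>k. norm (h' n z (e_x k)) \<le> M)) \<and>
     (AE z in lebesgue_on S. \<forall>k. (\<lambda>n. h' n z (e_x k)) \<longlonglongrightarrow> column k (A z) - blinfun_apply (u' z) (e_x k))"
  for \<sigma> :: "real^'n^'m \<Rightarrow> real^'n^'m" and U :: "(real^'n) \<times> real \<Rightarrow> real^'m"

text \<open>The perturbations are added to \<open>(u, v)\<close>. The series for \<open>u\<close> and for its time derivative converge uniformly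
by the size of the perturbations. The spatial gradients of \<open>u\<close> and the time derivatives of \<open>v\<close>
converge almost everywhere along a subsequence, and the pair of the limits lies on the graph of \<open>\<sigma>\<close>.\<close>

proposition nearby_solution_exists:
  fixes S :: "((real^'n) \<times> real) set" and \<sigma> :: "real^'n^'m \<Rightarrow> real^'n^'m"
    and u :: "(real^'n) \<times> real \<Rightarrow> real^'m" and v :: "'m \<Rightarrow> (real^'n) \<times> real \<Rightarrow> real^'n"
  assumes S: "open S" "bounded S" and \<sigma>: "continuous_on UNIV \<sigma>" "condition_OC \<sigma> \<Sigma>"
    and u: "C1_closure_deriv S u u'" and v: "\<And>i. C1_closure_deriv S (v i) (v' i)"
    and div: "\<And>i z. z \<in> closure S \<Longrightarrow> u z $ i = (\<Sum>k\<in>UNIV. blinfun_apply (v' i z) (e_x k) $ k)"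
    and inc: "\<And>z. z \<in> closure S \<Longrightarrow>
           ((\<chi> i k. blinfun_apply (u' z) (e_x k) $ i), (\<chi> i. blinfun_apply (v' i z) e_t)) \<in> \<Sigma>"
    and B: "\<And>x. x \<in> \<Sigma> \<Longrightarrow> norm x \<le> B" and \<epsilon>: "0 < \<epsilon>"
  shows "\<exists>U A Gt h h'. nearby_solution \<sigma> S u u' (2 * (real CARD('m) * B)) \<epsilon> U A Gt h h'"
proof -
  have SL: "S \<in> lmeasurable" using S by (simp add: lmeasurable_open)
  have SS: "S \<in> sets lebesgue" using SL by (rule fmeasurableD)
  have inS: "z \<in> S \<Longrightarrow> z \<in> closure S" for z using closure_subset by auto
  note cu' = C1_closure_deriv_C1_on(3)[OF u] and cv' = C1_closure_deriv_C1_on(3)[OF v]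
  define W0 where "W0 z = ((\<chi> i k. blinfun_apply (u' z) (e_x k) $ i), (\<chi> i. blinfun_apply (v' i z) e_t))" for z
  have cW0: "continuous_on (closure S) W0"
    unfolding W0_def
  proof (rule continuous_on_Pair)
    show "continuous_on (closure S) (\<lambda>z. \<chi> i k. blinfun_apply (u' z) (e_x k) $ i)"
      by (rule continuous_on_vec_lambda, rule continuous_on_vec_lambda, rule continuous_on_component, rule cu')
    show "continuous_on (closure S) (\<lambda>z. \<chi> i. blinfun_apply (v' i z) e_t)"
      by (rule continuous_on_vec_lambda, rule cv')
  qed
  have \<Sigma>: "bounded \<Sigma>" using \<sigma>(2) unfolding condition_OC_def by blast
  have W0\<Sigma>: "z \<in> closure S \<Longrightarrow> W0 z \<in> \<Sigma>" for z unfolding W0_def by (rule inc)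
  obtain Y Y' and r :: "nat \<Rightarrow> nat" and Winf where
    allY: "\<forall>k. perturbation S (\<epsilon> / 2 ^ Suc k) (Y k) (Y' k)"
    and W: "\<forall>k. \<forall>z\<in>closure S. W0 z + (\<Sum>j<k. field (Y' j z)) \<in> \<Sigma>"
    and r: "strict_mono r" and mW: "Winf \<in> borel_measurable (lebesgue_on S)"
    and lim: "AE z in lebesgue_on S. (\<lambda>n. W0 z + (\<Sum>j<r n. field (Y' j z))) \<longlonglongrightarrow> Winf z \<and> Winf z \<in> graph_set \<sigma>"
    by (rule convex_integration_of_fields[OF S \<Sigma> closed_graph_set[OF \<sigma>(1)] _ cW0 _ \<epsilon>])
       (rule condition_OC_reachable[OF \<sigma>(2)], assumption, assumption, rule W0\<Sigma>, assumption, rule that)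
  note Y = allY[rule_format]
  define y where "y n z = (\<Sum>j<n. Y j z)" for n z
  define y' where "y' n z w = (\<Sum>j<n. Y' j z w)" for n z w
  have p: "perturbation S (\<epsilon> - \<epsilon> / 2 ^ n) (y n) (y' n)" for n
    unfolding y_def[abs_def] y'_def[abs_def] by (rule perturbation_partial_sums[OF Y])
  have pn: "perturbation S \<epsilon> (y n) (y' n)" for n
    by (rule perturbation_mono[OF p order_refl]) (use \<epsilon> in simp)
  have y: "C1_compact S (y n) (y' n)" "fst (y n z) $ i = (\<Sum>k\<in>UNIV. snd (y' n z (e_x k)) $ i $ k)"
     "norm (y n z) \<le> \<epsilon>" "norm (fst (y' n z e_t)) \<le> \<epsilon>" for n z i
    using pn[of n] unfolding perturbation_def by blast+
  define Wn where "Wn n z = W0 z + field (y' n z)" for n z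
  have Wn: "Wn n z \<in> \<Sigma>" if "z \<in> S" for n z
    using W[rule_format, OF inS[OF that], of n] unfolding Wn_def y'_def[abs_def] field_sum .
  have limW: "AE z in lebesgue_on S. (\<lambda>n. Wn (r n) z) \<longlonglongrightarrow> Winf z" "AE z in lebesgue_on S. Winf z \<in> graph_set \<sigma>"
    using lim unfolding Wn_def y'_def[abs_def] field_sum by (eventually_elim, simp)+
  define h where "h n z = fst (y n z)" for n z
  define h' where "h' n z w = fst (y' n z w)" for n z w
  have h: "C1_compact S (h n) (h' n)" for n unfolding h_def[abs_def] h'_def[abs_def]
    by (rule C1_compact_bounded_linear[OF y(1) bounded_linear_fst])
  have hb: "norm (h n z) \<le> \<epsilon>" "norm (h' n z e_t) \<le> \<epsilon>" for n z
    using y(3,4)[where n = n and z = z] norm_fst_le[of "fst (y n z)" "snd (y n z)"] by (auto simp: h_def h'_def)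
  define q where "q n i z = snd (y n z) $ i" for n i z
  define q' where "q' n i z w = snd (y' n z w) $ i" for n i z w
  have q: "C1_compact S (q n i) (q' n i)" for n i unfolding q_def[abs_def] q'_def[abs_def]
    by (rule C1_compact_bounded_linear[OF y(1)]) (intro bounded_linear_compose[OF bounded_linear_vec_nth] bounded_linear_snd)
  have C1S: "C1_on S f f'" if "C1_compact S f f'" for f :: "(real^'n) \<times> real \<Rightarrow> 'c::euclidean_space" and f'
    using that C1_on_subset[OF _ subset_UNIV] unfolding C1_compact_def by blast
  define un where "un n z = u z + h n z" for n z
  define un' where "un' n z w = blinfun_apply (u' z) w + h' n z w" for n z w
  define vn where "vn n i z = v i z + q n i z" for n i z
  define vn' where "vn' n i z w = blinfun_apply (v' i z) w + q' n i z w" for n i z w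
  have un: "C1_on S (un n) (un' n)" for n unfolding un_def[abs_def] un'_def[abs_def]
    by (rule C1_on_add[OF C1_closure_deriv_C1_on(1)[OF u] C1S[OF h]])
  have vn: "C1_on S (vn n i) (vn' n i)" for n i unfolding vn_def[abs_def] vn'_def[abs_def]
    by (rule C1_on_add[OF C1_closure_deriv_C1_on(1)[OF v] C1S[OF q]])
  have divn: "un n z $ i = (\<Sum>k\<in>UNIV. vn' n i z (e_x k) $ k)" if "z \<in> S" for n i z
    by (simp add: un_def vn'_def h_def q'_def div[OF inS[OF that]] y(2) sum.distrib)
  have colW: "un' n z (e_x k) = column k (fst (Wn n z))" and sndW: "vn' n i z e_t = snd (Wn n z) $ i" for n z k i
    by (simp_all add: un'_def vn'_def h'_def q'_def Wn_def W0_def field_def column_def vec_eq_iff)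
  obtain F where F: "\<And>z. (\<lambda>n. \<Sum>j<n. fst (Y j z)) \<longlonglongrightarrow> F z"
    "\<And>S. (\<And>j. continuous_on S (\<lambda>z. fst (Y j z))) \<Longrightarrow> continuous_on S F"
  proof (rule limit_of_geometric_series[of "\<lambda>j z. fst (Y j z)" \<epsilon>])
    show "norm (fst (Y j z)) \<le> \<epsilon> / 2 ^ Suc j" for j z
      using Y[of j] norm_fst_le[of "fst (Y j z)" "snd (Y j z)"] unfolding perturbation_def
      by (metis order_trans prod.collapse)
  qed blast
  obtain Ft where Ft: "\<And>z. (\<lambda>n. \<Sum>j<n. fst (Y' j z e_t)) \<longlonglongrightarrow> Ft z"
  proof (rule limit_of_geometric_series[of "\<lambda>j z. fst (Y' j z e_t)" \<epsilon>])
    show "norm (fst (Y' j z e_t)) \<le> \<epsilon> / 2 ^ Suc j" for j z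
      using Y[of j] unfolding perturbation_def by blast
  qed blast
  have hF: "(\<lambda>n. h n z) \<longlonglongrightarrow> F z" and hFt: "(\<lambda>n. h' n z e_t) \<longlonglongrightarrow> Ft z" for z
    using F(1)[of z] Ft[of z] by (simp_all add: h_def h'_def y_def y'_def fst_sum)
  have Fb: "norm (F z) \<le> \<epsilon>" "norm (Ft z) \<le> \<epsilon>" for z
    using LIMSEQ_le_const2[OF tendsto_norm[OF hF]] LIMSEQ_le_const2[OF tendsto_norm[OF hFt]] hb by blast+
  have cF: "continuous_on T F" for T
  proof (rule F(2), rule continuous_on_fst)
    fix j
    have "C1_compact S (Y j) (Y' j)" using Y unfolding perturbation_def by blast
    then show "continuous_on T (Y j)" by (rule C1_compact_continuous)
  qed
  have F0: "F z = 0" if "z \<notin> S" for z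
  proof -
    have "h n z = 0" for n
      by (rule C1_compactE[OF h[of n]]) (use that in blast)
    then show ?thesis using hF[of z] by (simp add: LIMSEQ_const_iff)
  qed
  define U where "U z = u z + F z" for z
  define Gt where "Gt z = blinfun_apply (u' z) e_t + Ft z" for z
  define A where "A z = fst (Winf z)" for z
  have cU: "continuous_on (closure S) U" unfolding U_def
    by (rule continuous_on_add[OF C1_closure_deriv_C1_on(2)[OF u] cF])
  have mU: "U \<in> borel_measurable (lebesgue_on S)"
    by (rule continuous_imp_measurable_on_sets_lebesgue[OF continuous_on_subset[OF cU closure_subset] SS])
  have m_un': "(\<lambda>z. un' n z b) \<in> borel_measurable (lebesgue_on S)" for n b
    by (rule continuous_imp_measurable_on_sets_lebesgue[OF _ SS]) (use un in \<open>simp add: C1_on_def del: split_paired_All\<close>)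
  have lim_un: "(\<lambda>n. un n z) \<longlonglongrightarrow> U z" "(\<lambda>n. un' n z e_t) \<longlonglongrightarrow> Gt z" for z
    unfolding un_def un'_def U_def Gt_def by (intro tendsto_add tendsto_const hF hFt)+
  have mGt: "Gt \<in> borel_measurable (lebesgue_on S)"
    by (rule borel_measurable_LIMSEQ_metric[OF m_un' lim_un(2)])
  have compact_cl: "compact (closure S)" using S(2) by simp
  obtain Cu where Cu: "\<And>z. z \<in> closure S \<Longrightarrow> norm (u z) \<le> Cu"
    using compact_imp_bounded[OF compact_continuous_image[OF C1_closure_deriv_C1_on(2)[OF u] compact_cl]]
    unfolding bounded_iff by blast
  obtain Ct where Ct: "\<And>z. z \<in> closure S \<Longrightarrow> norm (blinfun_apply (u' z) e_t) \<le> Ct"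
    using compact_imp_bounded[OF compact_continuous_image[OF cu' compact_cl, of e_t]]
    unfolding bounded_iff by blast
  define B1 where "B1 = real CARD('m) * B"
  have col: "norm (column k (fst x)) \<le> B1" if "norm x \<le> B" for x :: "(real^'n^'m) \<times> (real^'n^'m)" and k
  proof -
    have "norm (column k (fst x)) \<le> (\<Sum>i\<in>(UNIV::'m set). B)"
      by (rule norm_vec_leI) (use field_component_le(2)[of x] that in \<open>auto simp: column_def intro: order_trans\<close>)
    then show ?thesis by (simp add: B1_def)
  qed
  have un_b: "norm (un n z) \<le> Cu + \<epsilon>" and unt_b: "norm (un' n z e_t) \<le> Ct + \<epsilon>" and unx_b: "norm (un' n z (e_x k)) \<le> B1"
    if "z \<in> S" for n z k
    unfolding un_def using Cu[OF inS[OF that]] Ct[OF inS[OF that]] hb[of n z] norm_triangle_mono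
    by (auto simp: un'_def[of n z e_t] colW intro: norm_triangle_mono col[OF B[OF Wn[OF that]]])
  have lim_col: "AE z in lebesgue_on S. \<forall>k. (\<lambda>n. un' (r n) z (e_x k)) \<longlonglongrightarrow> column k (A z)"
    using limW(1) unfolding colW A_def column_def
    by eventually_elim (intro allI tendsto_vec_lambda tendsto_vec_nth tendsto_fst)
  have mA: "(\<lambda>z. column k (A z)) \<in> borel_measurable (lebesgue_on S)" for k
  proof -
    have "continuous_on UNIV (\<lambda>x :: (real^'n^'m) \<times> (real^'n^'m). column k (fst x))" unfolding column_def
      by (rule continuous_on_vec_lambda, rule continuous_on_component, rule continuous_on_component, rule continuous_on_fst, rule continuous_on_id)
    then show ?thesis using measurable_compose[OF mW borel_measurable_continuous_onI] unfolding A_def by blast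
  qed
  have wx: "has_weak_partial S (e_x k) U (\<lambda>z. column k (A z))" for k
  proof (rule weak_partial_of_limit[OF S, where w = "\<lambda>n. un (r n)" and w' = "\<lambda>n. un' (r n)" and B = "max (Cu + \<epsilon>) B1"])
    show "AE z in lebesgue_on S. (\<lambda>n. un (r n) z) \<longlonglongrightarrow> U z"
      using LIMSEQ_subseq_LIMSEQ[OF lim_un(1) r] by (simp add: o_def)
    show "AE z in lebesgue_on S. (\<lambda>n. un' (r n) z (e_x k)) \<longlonglongrightarrow> column k (A z)"
      using lim_col by eventually_elim blast
  qed (use un un_b unx_b mU mA in \<open>auto simp: le_max_iff_disj\<close>)
  have wt: "has_weak_partial S e_t U Gt"
  proof (rule weak_partial_of_limit[OF S, where w = un and w' = un' and B = "max (Cu + \<epsilon>) (Ct + \<epsilon>)"])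
    show "AE z in lebesgue_on S. (\<lambda>n. un n z) \<longlonglongrightarrow> U z" "AE z in lebesgue_on S. (\<lambda>n. un' n z e_t) \<longlonglongrightarrow> Gt z"
      using lim_un by auto
  qed (use un un_b unt_b mU mGt in \<open>auto simp: le_max_iff_disj\<close>)
  have sol: "has_bochner_integral (lebesgue_on S)
      (\<lambda>z. U z $ i * partial e_t \<phi> z - (\<Sum>k\<in>UNIV. \<sigma> (A z) $ i $ k * partial (e_x k) \<phi> z)) 0"
    if \<phi>: "\<phi> \<in> test_functions S" for \<phi> i
  proof (rule divergence_identity_limit[OF S, where w = "\<lambda>n z. un (r n) z $ i" and V = "\<lambda>n. vn (r n) i"
        and V' = "\<lambda>n. vn' (r n) i" and B = "max (Cu + \<epsilon>) B" and g = "\<lambda>z. \<sigma> (A z) $ i" and \<phi> = \<phi>])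
    show "continuous_on S (\<lambda>z. un (r n) z $ i)" for n
      by (rule continuous_on_component[OF C1_on_continuous[OF un]])
    show "\<bar>un (r n) z $ i\<bar> \<le> max (Cu + \<epsilon>) B" if "z \<in> S" for n z
      using component_le_norm_cart[of "un (r n) z" i] un_b[OF that, of "r n"] by linarith
    show "norm (vn' (r n) i z e_t) \<le> max (Cu + \<epsilon>) B" if "z \<in> S" for n z
      using Finite_Cartesian_Product.norm_nth_le[of "snd (Wn (r n) z)" i] norm_snd_le[of "snd (Wn (r n) z)" "fst (Wn (r n) z)"] B[OF Wn[OF that, of "r n"]]
      by (simp add: sndW)
    show "(\<lambda>z. U z $ i) \<in> borel_measurable (lebesgue_on S)"
      using measurable_compose[OF mU borel_measurable_continuous_onI[of "\<lambda>x. x $ i"]] by (simp add: continuous_on_component)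
    have "continuous_on UNIV (\<lambda>x. \<sigma> (fst x) $ i)"
      by (rule continuous_on_component, rule continuous_on_compose2[OF \<sigma>(1)], rule continuous_on_fst, rule continuous_on_id) auto
    then show "(\<lambda>z. \<sigma> (A z) $ i) \<in> borel_measurable (lebesgue_on S)"
      using measurable_compose[OF mW borel_measurable_continuous_onI] unfolding A_def by blast
    show "AE z in lebesgue_on S. (\<lambda>n. un (r n) z $ i) \<longlonglongrightarrow> U z $ i"
      using tendsto_vec_nth[OF LIMSEQ_subseq_LIMSEQ[OF lim_un(1) r]] by (simp add: o_def)
    show "AE z in lebesgue_on S. (\<lambda>n. vn' (r n) i z e_t) \<longlonglongrightarrow> \<sigma> (A z) $ i"
      using limW
    proof eventually_elim
      case (elim z)
      have "\<sigma> (A z) = snd (Winf z)" using elim(2) unfolding graph_set_def A_def by auto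
      then show ?case using tendsto_vec_nth[OF tendsto_snd[OF elim(1)]] by (simp add: sndW)
    qed
  qed (use vn divn \<phi> in auto)
  have LA: "L_inf S (\<lambda>z. column k (A z))" for k
    unfolding L_inf_def
  proof (intro conjI exI)
    show "AE z in lebesgue_on S. norm (column k (A z)) \<le> B1"
    proof -
      have "AE z in lebesgue_on S. z \<in> S" by (rule AE_I2) (simp add: space_restrict_space)
      then show ?thesis using lim_col
      proof eventually_elim
        case (elim z)
        then show ?case using LIMSEQ_le_const2[OF tendsto_norm] unx_b by blast
      qed
    qed
  qed (rule mA)
  have lim_h: "AE z in lebesgue_on S. \<forall>k. (\<lambda>n. h' (r n) z (e_x k)) \<longlonglongrightarrow> column k (A z) - blinfun_apply (u' z) (e_x k)"
    using lim_col
  proof eventually_elim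
    case (elim z)
    have "h' n z w = un' n z w - blinfun_apply (u' z) w" for n w by (simp add: un'_def)
    then show ?case using elim by (auto intro!: tendsto_diff)
  qed
  have hx: "norm (h' n z (e_x k)) \<le> 2 * B1" if "z \<in> S" for n z k
  proof -
    have "blinfun_apply (u' z) (e_x k) = column k (fst (W0 z))" by (simp add: W0_def column_def vec_eq_iff)
    then have "norm (blinfun_apply (u' z) (e_x k)) \<le> B1" using col[OF B[OF W0\<Sigma>[OF inS[OF that]]]] by simp
    moreover have "h' n z (e_x k) = un' n z (e_x k) - blinfun_apply (u' z) (e_x k)" by (simp add: un'_def)
    ultimately show ?thesis using norm_triangle_ineq4[of "un' n z (e_x k)" "blinfun_apply (u' z) (e_x k)"] unx_b[OF that, of n k]
      by simp
  qed
  have fr: "U z = u z" if "z \<in> frontier S" for z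
    using that F0[of z] S(1) by (auto simp: U_def frontier_def interior_open)
  have "nearby_solution \<sigma> S u u' (2 * (real CARD('m) * B)) \<epsilon> U A Gt (\<lambda>n. h (r n)) (\<lambda>n. h' (r n))"
    unfolding nearby_solution_def
    using cU Fb fr wx wt mGt LA sol hb(1) hx[unfolded B1_def] lim_h C1_compact_mono[OF h subset_UNIV]
    by (auto simp: U_def Gt_def)
  then show ?thesis by blast
qed

theorem theorem1p1:
  fixes \<Omega> :: "(real^'n) set" and T :: real
    and \<sigma> :: "real^'n^'m \<Rightarrow> real^'n^'m"
    and \<Sigma> :: "((real^'n^'m) \<times> (real^'n^'m)) set"
    and u :: "(real^'n) \<times> real \<Rightarrow> real^'m"
    and u' :: "(real^'n) \<times> real \<Rightarrow> ((real^'n) \<times> real) \<Rightarrow>\<^sub>L (real^'m)"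
    and v :: "'m \<Rightarrow> (real^'n) \<times> real \<Rightarrow> real^'n"
    and v' :: "'m \<Rightarrow> (real^'n) \<times> real \<Rightarrow> ((real^'n) \<times> real) \<Rightarrow>\<^sub>L (real^'n)"
  assumes "bounded_lipschitz_domain \<Omega>" and "T > 0"
    and "continuous_on UNIV \<sigma>" and "condition_OC \<sigma> \<Sigma>"
    and "C1_closure_deriv (cylinder \<Omega> T) u u'"
    and "\<And>i. C1_closure_deriv (cylinder \<Omega> T) (v i) (v' i)"
    and "\<And>i z. z \<in> closure (cylinder \<Omega> T) \<Longrightarrow>
           u z $ i = (\<Sum>k\<in>UNIV. blinfun_apply (v' i z) (e_x k) $ k)"
    and "\<And>z. z \<in> closure (cylinder \<Omega> T) \<Longrightarrow>
           ((\<chi> i k. blinfun_apply (u' z) (e_x k) $ i), (\<chi> i. blinfun_apply (v' i z) e_t)) \<in> \<Sigma>"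
  shows "\<exists>U :: nat \<Rightarrow> (real^'n) \<times> real \<Rightarrow> real^'m.
           (\<forall>j. W1_inf (cylinder \<Omega> T) (U j) \<and> weak_solution \<sigma> (cylinder \<Omega> T) (U j) \<and>
                boundary_values (cylinder \<Omega> T) (U j) u) \<and>
           weak_star_W1_inf (cylinder \<Omega> T) U u"
proof -
  define S where "S = cylinder \<Omega> T"
  have \<Omega>: "open \<Omega>" "bounded \<Omega>" using assms(1) unfolding bounded_lipschitz_domain_def by auto
  have S: "open S" "bounded S" unfolding S_def cylinder_def using \<Omega> by (auto intro: open_Times bounded_Times)
  have SL: "S \<in> lmeasurable" using S by (simp add: lmeasurable_open)
  have SS: "S \<in> sets lebesgue" using SL by (rule fmeasurableD)
  have inS: "z \<in> S \<Longrightarrow> z \<in> closure S" for z using closure_subset by auto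
  note u = assms(5)[folded S_def]
  have compact_cl: "compact (closure S)" using S(2) by simp
  have "bounded \<Sigma>" using assms(4) unfolding condition_OC_def by blast
  then obtain B where B: "B > 0" "\<And>x. x \<in> \<Sigma> \<Longrightarrow> norm x \<le> B" unfolding bounded_pos by blast
  define M where "M = 2 * (real CARD('m) * B)"
  have M: "M > 0" using B by (simp add: M_def)
  define \<epsilon> where "\<epsilon> j = inverse (real (Suc j))" for j
  have \<epsilon>: "\<epsilon> j > 0" for j by (simp add: \<epsilon>_def)
  have \<epsilon>0: "\<epsilon> \<longlonglongrightarrow> 0" unfolding \<epsilon>_def[abs_def] by (rule LIMSEQ_inverse_real_of_nat)
  have "\<forall>j. \<exists>U A Gt h h'. nearby_solution \<sigma> S u u' M (\<epsilon> j) U A Gt h h'"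
    unfolding M_def
    using nearby_solution_exists[OF S assms(3,4) u assms(6,7,8)[folded S_def] B(2) \<epsilon>] by blast
  then obtain U A Gt h h' where "\<And>j. nearby_solution \<sigma> S u u' M (\<epsilon> j) (U j) (A j) (Gt j) (h j) (h' j)"
    by metis
  note X = this[unfolded nearby_solution_def]
  have U: "continuous_on (closure S) (U j)" "\<And>z. z \<in> closure S \<Longrightarrow> norm (U j z - u z) \<le> \<epsilon> j"
    "\<And>z. z \<in> frontier S \<Longrightarrow> U j z = u z" for j using X[of j] by auto
  have wx: "has_weak_partial S (e_x k) (U j) (\<lambda>z. column k (A j z))" and LA: "L_inf S (\<lambda>z. column k (A j z))"
    and wt: "has_weak_partial S e_t (U j) (Gt j)" and mGt: "Gt j \<in> borel_measurable (lebesgue_on S)" for j k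
    using X[of j] by auto
  have Gt: "norm (Gt j z - blinfun_apply (u' z) e_t) \<le> \<epsilon> j" if "z \<in> S" for j z using X[of j] that by auto
  have sol: "has_bochner_integral (lebesgue_on S)
        (\<lambda>z. U j z $ i * partial e_t \<phi> z - (\<Sum>k\<in>UNIV. \<sigma> (A j z) $ i $ k * partial (e_x k) \<phi> z)) 0"
    if "\<phi> \<in> test_functions S" for j i \<phi> using X[of j] that by auto
  have h: "C1_compact UNIV (h j n) (h' j n)" "norm (h j n z) \<le> \<epsilon> j" "z \<in> S \<Longrightarrow> norm (h' j n z (e_x k)) \<le> M" for j n z k
    using X[of j] by blast+
  have lim_h: "AE z in lebesgue_on S. (\<lambda>n. h' j n z (e_x k)) \<longlonglongrightarrow> column k (A j z) - blinfun_apply (u' z) (e_x k)" for j k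
    using X[of j] by (auto elim: AE_mp)
  have L_cont: "L_inf S f" if c: "continuous_on (closure S) f" for f :: "(real^'n) \<times> real \<Rightarrow> real^'m"
  proof -
    obtain C where "\<And>z. z \<in> closure S \<Longrightarrow> norm (f z) \<le> C"
      using compact_imp_bounded[OF compact_continuous_image[OF c compact_cl]] unfolding bounded_iff by blast
    then have "AE z in lebesgue_on S. norm (f z) \<le> C" by (intro AE_I2) (simp add: space_restrict_space inS)
    then show ?thesis unfolding L_inf_def
      using continuous_imp_measurable_on_sets_lebesgue[OF continuous_on_subset[OF c closure_subset] SS] by blast
  qed
  have LU: "L_inf S (U j)" for j by (rule L_cont[OF U(1)])
  have Lu': "L_inf S (\<lambda>z. blinfun_apply (u' z) b)" for b by (rule L_cont[OF C1_closure_deriv_C1_on(3)[OF u]])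
  have Lu: "L_inf S u" by (rule L_cont[OF C1_closure_deriv_C1_on(2)[OF u]])
  have LGt: "L_inf S (Gt j)" for j
  proof -
    obtain C where "AE z in lebesgue_on S. norm (blinfun_apply (u' z) e_t) \<le> C" using Lu' unfolding L_inf_def by blast
    moreover have "AE z in lebesgue_on S. norm (Gt j z - blinfun_apply (u' z) e_t) \<le> \<epsilon> j"
      by (rule AE_I2) (use Gt in \<open>simp add: space_restrict_space\<close>)
    ultimately have "AE z in lebesgue_on S. norm (Gt j z) \<le> C + \<epsilon> j"
    proof eventually_elim
      case (elim z)
      then show ?case using norm_triangle_ineq[of "Gt j z - blinfun_apply (u' z) e_t" "blinfun_apply (u' z) e_t"] by simp
    qed
    then show ?thesis unfolding L_inf_def using mGt by blast
  qed
  have wu: "has_weak_partial S b u (\<lambda>z. blinfun_apply (u' z) b)" for b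
  proof -
    obtain C1 C2 where C: "\<And>z. z \<in> closure S \<Longrightarrow> norm (u z) \<le> C1" "\<And>z. z \<in> closure S \<Longrightarrow> norm (blinfun_apply (u' z) b) \<le> C2"
      using compact_imp_bounded[OF compact_continuous_image[OF C1_closure_deriv_C1_on(2)[OF u] compact_cl]]
        compact_imp_bounded[OF compact_continuous_image[OF C1_closure_deriv_C1_on(3)[OF u] compact_cl, of b]]
      unfolding bounded_iff by blast
    show ?thesis
      by (rule weak_partial_of_limit[OF S C1_closure_deriv_C1_on(1)[OF u], where B = "max C1 C2"])
         (use C inS Lu Lu' in \<open>auto simp: le_max_iff_disj L_inf_def\<close>)
  qed
  have partials: "\<exists>g. L_inf S g \<and> has_weak_partial S b (U j) g" if "b \<in> Basis" for b j
    using Basis_cases[OF that] wx LA wt LGt by metis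
  have "W1_inf S (U j)" for j unfolding W1_inf_def using LU partials by blast
  moreover have "weak_solution \<sigma> S (U j)" for j
    unfolding weak_solution_def W11_loc_def using partials wx sol wt unfolding has_weak_partial_def by blast
  moreover have "boundary_values S (U j) u" for j
    unfolding boundary_values_def using U by (intro exI[of _ "U j"]) auto
  moreover have "weak_star_L_inf S U u"
    by (rule weak_star_of_uniform[OF LU Lu _ \<epsilon>0 SS]) (use U(2) inS in auto)
  moreover have "\<exists>G g. (\<forall>j. has_weak_partial S b (U j) (G j)) \<and> has_weak_partial S b u g \<and> weak_star_L_inf S G g"
    if "b \<in> Basis" for b
    using Basis_cases[OF that]
  proof cases
    case (1 k)
    have "weak_star_L_inf S (\<lambda>j z. column k (A j z)) (\<lambda>z. blinfun_apply (u' z) (e_x k))"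
      by (rule weak_star_of_small_primitives[OF S LA Lu' h(1,2) h(3) lim_h \<epsilon>0 M])
    then show ?thesis unfolding 1
      by (intro exI[of _ "\<lambda>j z. column k (A j z)"] exI[of _ "\<lambda>z. blinfun_apply (u' z) (e_x k)"] conjI allI wx wu)
  next
    case 2
    have "weak_star_L_inf S Gt (\<lambda>z. blinfun_apply (u' z) e_t)"
      by (rule weak_star_of_uniform[OF LGt Lu' Gt \<epsilon>0 SS])
    then show ?thesis unfolding 2
      by (intro exI[of _ Gt] exI[of _ "\<lambda>z. blinfun_apply (u' z) e_t"] conjI allI wt wu)
  qed
  ultimately show ?thesis unfolding weak_star_W1_inf_def S_def by blast
qed

end
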